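(* Let $k$ be an uncountable field and let $R$ be an affine prime Goldie non-simple non-PI $k$-algebra with $\operatorname{GKdim}(R)<3$. Suppose $R$ has an element $x$, not algebraic over $k$, such that $x+P\in R/P$ is algebraic over $k$ for every prime ideal $P$ of $R$ with $\operatorname{GKdim}(R/P)=1$, and suppose also that for every such prime $P$ the polynomial ring $Z(R/P)[t]$ has the property ( * ). Then $R$ is primitive.
   Context: All algebras are associative with 1. A $k$-algebra is affine if it is finitely generated as a $k$-algebra. $\operatorname{GKdim}$ is Gelfand--Kirillov dimension over $k$. PI means satisfying a (nontrivial) polynomial identity. $Z(S)$ denotes the center of a ring $S$. An element is algebraic over $k$ if it is a root of a nonzero polynomial in $k[t]$. Primitive means left primitive (having a faithful simple left module). Goldie means left and right Goldie. For a commutative $k$-algebra $C$, the polynomial ring $C[t]$ has the property ( * ) if: whenever $f(t),g(t)\in C[t]$ are nonzero and $f(t)g(t)\in k[t]$, then $f(t)\in k[t]$ and $g(t)\in k[t]$. (For example, $C=k[X]$ has this property.) *)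

theory Defs
  imports
    "HOL-Algebra.Algebra"
    "HOL-Library.Countable_Set"
    "HOL-Library.Extended_Real"
begin

section \<open>Algebras over a field\<close>

text \<open>
  The locale \<open>algebra\<close> of HOL-Algebra is restricted to commutative rings.  Here an associative
  unital algebra over a field \<open>K\<close> is a ring \<open>R\<close> with a structure map \<open>\<phi>\<close> from \<open>K\<close> to the
  centre of \<open>R\<close>; scalar multiplication is \<open>c \<cdot> r = \<phi> c \<otimes> r\<close>.
\<close>

locale field_algebra = K: field K + R: ring R
  for K :: "('k, 'm) ring_scheme" and R :: "('a, 'n) ring_scheme" and \<phi> :: "'k \<Rightarrow> 'a" +
  assumes structure_hom: "\<phi> \<in> ring_hom K R"
    and structure_central:
      "\<lbrakk> c \<in> carrier K; r \<in> carrier R \<rbrakk> \<Longrightarrow> \<phi> c \<otimes>\<^bsub>R\<^esub> r = r \<otimes>\<^bsub>R\<^esub> \<phi> c"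

definition quot_structure :: "('a, 'n) ring_scheme \<Rightarrow> ('k \<Rightarrow> 'a) \<Rightarrow> 'a set \<Rightarrow> 'k \<Rightarrow> 'a set"
  where "quot_structure R \<phi> I = (\<lambda>c. I +>\<^bsub>R\<^esub> \<phi> c)"

lemma (in field_algebra) field_algebra_Quot:
  assumes "ideal I R"
  shows "field_algebra K (R Quot I) (quot_structure R \<phi> I)"
proof -
  interpret I: ideal I R by fact
  interpret Q: ring "R Quot I" by (rule I.quotient_is_ring)
  have car: "\<phi> c \<in> carrier R" if "c \<in> carrier K" for c
    using structure_hom that by (rule ring_hom_closed)
  have pi: "(+>\<^bsub>R\<^esub>) I \<in> ring_hom R (R Quot I)" by (rule I.rcos_ring_hom)
  show ?thesis
  proof
    show "quot_structure R \<phi> I \<in> ring_hom K (R Quot I)"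
      using ring_hom_trans[OF structure_hom pi] by (simp add: quot_structure_def comp_def)
  next
    fix c Y assume c: "c \<in> carrier K" and Y: "Y \<in> carrier (R Quot I)"
    then obtain r where r: "r \<in> carrier R" "Y = I +>\<^bsub>R\<^esub> r"
      by (auto simp: FactRing_simps)
    show "quot_structure R \<phi> I c \<otimes>\<^bsub>R Quot I\<^esub> Y = Y \<otimes>\<^bsub>R Quot I\<^esub> quot_structure R \<phi> I c"
      using ring_hom_mult[OF pi car[OF c] r(1)] ring_hom_mult[OF pi r(1) car[OF c]]
        structure_central[OF c r(1)] r(2)
      by (simp add: quot_structure_def)
  qed
qed

definition affine_algebra ::
    "('k, 'm) ring_scheme \<Rightarrow> ('a, 'n) ring_scheme \<Rightarrow> ('k \<Rightarrow> 'a) \<Rightarrow> bool"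
  where "affine_algebra K R \<phi> \<longleftrightarrow>
    (\<exists>S. finite S \<and> S \<subseteq> carrier R \<and> generate_ring R (\<phi> ` carrier K \<union> S) = carrier R)"

definition algebraic_over ::
    "('k, 'm) ring_scheme \<Rightarrow> ('a, 'n) ring_scheme \<Rightarrow> ('k \<Rightarrow> 'a) \<Rightarrow> 'a \<Rightarrow> bool"
  where "algebraic_over K R \<phi> x \<longleftrightarrow>
    (\<exists>p \<in> carrier (UP K). p \<noteq> \<zero>\<^bsub>UP K\<^esub> \<and> eval K R \<phi> x p = \<zero>\<^bsub>R\<^esub>)"

subsection \<open>Polynomial identities\<close>

text \<open>
  An element of the free algebra on indeterminates \<open>X\<^sub>0, X\<^sub>1, \<dots>\<close> is given by its coefficient
  function on words (lists of indices of indeterminates).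
\<close>

definition free_algebra_elem :: "('k, 'm) ring_scheme \<Rightarrow> (nat list \<Rightarrow> 'k) \<Rightarrow> bool"
  where "free_algebra_elem K f \<longleftrightarrow> range f \<subseteq> carrier K \<and> finite {w. f w \<noteq> \<zero>\<^bsub>K\<^esub>}"

definition list_prod :: "('a, 'n) monoid_scheme \<Rightarrow> 'a list \<Rightarrow> 'a"
  where "list_prod R xs = foldr (\<otimes>\<^bsub>R\<^esub>) xs \<one>\<^bsub>R\<^esub>"

definition free_algebra_eval ::
    "('k, 'm) ring_scheme \<Rightarrow> ('a, 'n) ring_scheme \<Rightarrow> ('k \<Rightarrow> 'a) \<Rightarrow> (nat \<Rightarrow> 'a) \<Rightarrow>
      (nat list \<Rightarrow> 'k) \<Rightarrow> 'a"
  where "free_algebra_eval K R \<phi> \<rho> f =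
    (\<Oplus>\<^bsub>R\<^esub> w \<in> {w. f w \<noteq> \<zero>\<^bsub>K\<^esub>}. \<phi> (f w) \<otimes>\<^bsub>R\<^esub> list_prod R (map \<rho> w))"

definition PI_algebra ::
    "('k, 'm) ring_scheme \<Rightarrow> ('a, 'n) ring_scheme \<Rightarrow> ('k \<Rightarrow> 'a) \<Rightarrow> bool"
  where "PI_algebra K R \<phi> \<longleftrightarrow>
    (\<exists>f. free_algebra_elem K f \<and> (\<exists>w. f w \<noteq> \<zero>\<^bsub>K\<^esub>) \<and>
      (\<forall>\<rho>. range \<rho> \<subseteq> carrier R \<longrightarrow> free_algebra_eval K R \<phi> \<rho> f = \<zero>\<^bsub>R\<^esub>))"

subsection \<open>Gelfand--Kirillov dimension\<close>

text \<open>
  Despite its name, the library predicate \<open>subalgebra k V R\<close> says that \<open>V\<close> is a \<open>k\<close>-subspace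
  of \<open>R\<close>.  The dimension theory of HOL-Algebra is stated for a subfield \<open>k\<close> of the ring,
  which here is the image of \<open>\<phi>\<close>.
\<close>

definition linear_span :: "('a, 'n) ring_scheme \<Rightarrow> 'a set \<Rightarrow> 'a set \<Rightarrow> 'a set"
  where "linear_span R k A = \<Inter>{E. subalgebra k E R \<and> A \<subseteq> E}"

text \<open>The subspace \<open>V\<^sup>0 + V\<^sup>1 + \<dots> + V\<^sup>n\<close>, where \<open>V\<^sup>0 = k\<close>.\<close>

definition power_sum_space :: "('a, 'n) ring_scheme \<Rightarrow> 'a set \<Rightarrow> 'a set \<Rightarrow> nat \<Rightarrow> 'a set"
  where "power_sum_space R k V n =
    linear_span R k {list_prod R ws | ws. set ws \<subseteq> V \<and> length ws \<le> n}"

definition GKdim ::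
    "('k, 'm) ring_scheme \<Rightarrow> ('a, 'n) ring_scheme \<Rightarrow> ('k \<Rightarrow> 'a) \<Rightarrow> ereal"
  where "GKdim K R \<phi> = (let k = \<phi> ` carrier K in
    SUP V \<in> {V. subalgebra k V R \<and> ring.finite_dimension R k V}.
      limsup (\<lambda>n. ereal (log (real n) (real (ring.dim R k (power_sum_space R k V n))))))"

subsection \<open>Centre and the property (*)\<close>

definition ring_center :: "('a, 'n) ring_scheme \<Rightarrow> ('a, 'n) ring_scheme"
  where "ring_center R =
    R\<lparr>carrier := {z \<in> carrier R. \<forall>r \<in> carrier R. z \<otimes>\<^bsub>R\<^esub> r = r \<otimes>\<^bsub>R\<^esub> z}\<rparr>"

text \<open>The copy of \<open>k[t]\<close> inside \<open>C[t]\<close>.\<close>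

definition base_polys ::
    "('k, 'm) ring_scheme \<Rightarrow> ('c, 'n) ring_scheme \<Rightarrow> ('k \<Rightarrow> 'c) \<Rightarrow> (nat \<Rightarrow> 'c) set"
  where "base_polys K C \<phi> =
    {p \<in> carrier (UP C). \<forall>n. coeff (UP C) p n \<in> \<phi> ` carrier K}"

definition poly_star ::
    "('k, 'm) ring_scheme \<Rightarrow> ('c, 'n) ring_scheme \<Rightarrow> ('k \<Rightarrow> 'c) \<Rightarrow> bool"
  where "poly_star K C \<phi> \<longleftrightarrow>
    (\<forall>f \<in> carrier (UP C). \<forall>g \<in> carrier (UP C).
      f \<noteq> \<zero>\<^bsub>UP C\<^esub> \<longrightarrow> g \<noteq> \<zero>\<^bsub>UP C\<^esub> \<longrightarrow> f \<otimes>\<^bsub>UP C\<^esub> g \<in> base_polys K C \<phi> \<longrightarrow>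
      f \<in> base_polys K C \<phi> \<and> g \<in> base_polys K C \<phi>)"

section \<open>Noncommutative rings\<close>

text \<open>
  The library locale \<open>ideal\<close> means two-sided ideal, but its \<open>primeideal\<close> requires a
  commutative ring, so primeness is defined here by products of two-sided ideals.
\<close>

definition prime_two_sided :: "('a, 'n) ring_scheme \<Rightarrow> 'a set \<Rightarrow> bool"
  where "prime_two_sided R P \<longleftrightarrow> ideal P R \<and> P \<noteq> carrier R \<and>
    (\<forall>I J. ideal I R \<longrightarrow> ideal J R \<longrightarrow> ideal_prod R I J \<subseteq> P \<longrightarrow> I \<subseteq> P \<or> J \<subseteq> P)"

definition prime_ring :: "('a, 'n) ring_scheme \<Rightarrow> bool"
  where "prime_ring R \<longleftrightarrow> ring R \<and> prime_two_sided R {\<zero>\<^bsub>R\<^esub>}"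

definition simple_ring :: "('a, 'n) ring_scheme \<Rightarrow> bool"
  where "simple_ring R \<longleftrightarrow> ring R \<and> carrier R \<noteq> {\<zero>\<^bsub>R\<^esub>} \<and>
    (\<forall>I. ideal I R \<longrightarrow> I = {\<zero>\<^bsub>R\<^esub>} \<or> I = carrier R)"

subsection \<open>Goldie rings\<close>

text \<open>
  Finite uniform dimension is expressed as the absence of an infinite direct sum of nonzero
  left ideals; the right-hand conditions are those of the opposite ring.
\<close>

definition left_ideal :: "('a, 'n) ring_scheme \<Rightarrow> 'a set \<Rightarrow> bool"
  where "left_ideal R I \<longleftrightarrow> additive_subgroup I R \<and>
    (\<forall>r \<in> carrier R. \<forall>a \<in> I. r \<otimes>\<^bsub>R\<^esub> a \<in> I)"

definition left_annihilator :: "('a, 'n) ring_scheme \<Rightarrow> 'a set \<Rightarrow> 'a set"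
  where "left_annihilator R S = {r \<in> carrier R. \<forall>s \<in> S. r \<otimes>\<^bsub>R\<^esub> s = \<zero>\<^bsub>R\<^esub>}"

definition acc_left_annihilators :: "('a, 'n) ring_scheme \<Rightarrow> bool"
  where "acc_left_annihilators R \<longleftrightarrow>
    (\<forall>A :: nat \<Rightarrow> 'a set.
      (\<forall>n. \<exists>S \<subseteq> carrier R. A n = left_annihilator R S) \<and> (\<forall>n. A n \<subseteq> A (Suc n)) \<longrightarrow>
      (\<exists>N. \<forall>n \<ge> N. A n = A N))"

definition infinite_left_direct_sum :: "('a, 'n) ring_scheme \<Rightarrow> (nat \<Rightarrow> 'a set) \<Rightarrow> bool"
  where "infinite_left_direct_sum R I \<longleftrightarrow>
    (\<forall>n. left_ideal R (I n) \<and> I n \<noteq> {\<zero>\<^bsub>R\<^esub>}) \<and>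
    (\<forall>n x. (\<forall>i \<le> n. x i \<in> I i) \<and> (\<Oplus>\<^bsub>R\<^esub> i \<in> {..n}. x i) = \<zero>\<^bsub>R\<^esub> \<longrightarrow>
      (\<forall>i \<le> n. x i = \<zero>\<^bsub>R\<^esub>))"

definition left_Goldie :: "('a, 'n) ring_scheme \<Rightarrow> bool"
  where "left_Goldie R \<longleftrightarrow>
    acc_left_annihilators R \<and> (\<nexists>I. infinite_left_direct_sum R I)"

definition opposite_ring :: "('a, 'n) ring_scheme \<Rightarrow> ('a, 'n) ring_scheme"
  where "opposite_ring R = R\<lparr>mult := \<lambda>a b. b \<otimes>\<^bsub>R\<^esub> a\<rparr>"

definition Goldie :: "('a, 'n) ring_scheme \<Rightarrow> bool"
  where "Goldie R \<longleftrightarrow> left_Goldie R \<and> left_Goldie (opposite_ring R)"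

subsection \<open>Primitive rings\<close>

text \<open>The library locale \<open>module\<close> without commutativity of the ring.\<close>

locale left_module = R?: ring R + M?: abelian_group M
  for R :: "('a, 'n) ring_scheme" (structure) and M :: "('a, 'b, 'q) module_scheme" (structure) +
  assumes smult_closed:
      "\<lbrakk> a \<in> carrier R; x \<in> carrier M \<rbrakk> \<Longrightarrow> a \<odot>\<^bsub>M\<^esub> x \<in> carrier M"
    and smult_l_distr:
      "\<lbrakk> a \<in> carrier R; b \<in> carrier R; x \<in> carrier M \<rbrakk> \<Longrightarrow>
        (a \<oplus>\<^bsub>R\<^esub> b) \<odot>\<^bsub>M\<^esub> x = a \<odot>\<^bsub>M\<^esub> x \<oplus>\<^bsub>M\<^esub> b \<odot>\<^bsub>M\<^esub> x"
    and smult_r_distr: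
      "\<lbrakk> a \<in> carrier R; x \<in> carrier M; y \<in> carrier M \<rbrakk> \<Longrightarrow>
        a \<odot>\<^bsub>M\<^esub> (x \<oplus>\<^bsub>M\<^esub> y) = a \<odot>\<^bsub>M\<^esub> x \<oplus>\<^bsub>M\<^esub> a \<odot>\<^bsub>M\<^esub> y"
    and smult_assoc1:
      "\<lbrakk> a \<in> carrier R; b \<in> carrier R; x \<in> carrier M \<rbrakk> \<Longrightarrow>
        (a \<otimes>\<^bsub>R\<^esub> b) \<odot>\<^bsub>M\<^esub> x = a \<odot>\<^bsub>M\<^esub> (b \<odot>\<^bsub>M\<^esub> x)"
    and smult_one: "x \<in> carrier M \<Longrightarrow> \<one>\<^bsub>R\<^esub> \<odot>\<^bsub>M\<^esub> x = x"

definition simple_left_module ::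
    "('a, 'n) ring_scheme \<Rightarrow> ('a, 'b, 'q) module_scheme \<Rightarrow> bool"
  where "simple_left_module R M \<longleftrightarrow> left_module R M \<and> carrier M \<noteq> {\<zero>\<^bsub>M\<^esub>} \<and>
    (\<forall>N. submodule N R M \<longrightarrow> N = {\<zero>\<^bsub>M\<^esub>} \<or> N = carrier M)"

definition faithful_module ::
    "('a, 'n) ring_scheme \<Rightarrow> ('a, 'b, 'q) module_scheme \<Rightarrow> bool"
  where "faithful_module R M \<longleftrightarrow>
    (\<forall>r \<in> carrier R. (\<forall>x \<in> carrier M. r \<odot>\<^bsub>M\<^esub> x = \<zero>\<^bsub>M\<^esub>) \<longrightarrow> r = \<zero>\<^bsub>R\<^esub>)"

text \<open>
  HOL cannot quantify over the type of the module.  The element type \<open>'a set\<close> loses nothing,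
  because every simple left module is isomorphic to \<open>R/L\<close> for a maximal left ideal \<open>L\<close>, whose
  elements are subsets of \<open>R\<close>; see \<open>primitive_ringI\<close> below.
\<close>

definition primitive_ring :: "('a, 'n) ring_scheme \<Rightarrow> bool"
  where "primitive_ring R \<longleftrightarrow>
    (\<exists>M :: ('a, 'a set) module. simple_left_module R M \<and> faithful_module R M)"

lemma primitive_ringI:
  fixes R :: "('a, 'n) ring_scheme" and M :: "('a, 'b, 'q) module_scheme"
  assumes simple: "simple_left_module R M" and faithful: "faithful_module R M"
  shows "primitive_ring R"
proof -
  interpret left_module R M using simple by (simp add: simple_left_module_def)
  have sub: "N = {\<zero>\<^bsub>M\<^esub>} \<or> N = carrier M" if "submodule N R M" for N
    using simple that by (simp add: simple_left_module_def)
  have "carrier M \<noteq> {\<zero>\<^bsub>M\<^esub>}" using simple by (simp add: simple_left_module_def)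
  then obtain m where m: "m \<in> carrier M" "m \<noteq> \<zero>\<^bsub>M\<^esub>" using M.zero_closed by blast
  have z0: "a \<odot>\<^bsub>M\<^esub> \<zero>\<^bsub>M\<^esub> = \<zero>\<^bsub>M\<^esub>" if "a \<in> carrier R" for a
    using smult_r_distr[OF that M.zero_closed M.zero_closed] smult_closed[OF that M.zero_closed]
    by (metis M.add.l_cancel_one' M.l_zero M.zero_closed)
  have neg: "a \<odot>\<^bsub>M\<^esub> (\<ominus>\<^bsub>M\<^esub> y) = \<ominus>\<^bsub>M\<^esub> (a \<odot>\<^bsub>M\<^esub> y)" if "a \<in> carrier R" "y \<in> carrier M" for a y
    using smult_r_distr[OF that(1) M.a_inv_closed[OF that(2)] that(2)] z0[OF that(1)] that
    by (metis M.a_inv_closed M.l_neg M.minus_equality smult_closed)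
  have negl: "(\<ominus>\<^bsub>R\<^esub> a) \<odot>\<^bsub>M\<^esub> y = \<ominus>\<^bsub>M\<^esub> (a \<odot>\<^bsub>M\<^esub> y)" if a: "a \<in> carrier R" and y: "y \<in> carrier M" for a y
  proof -
    have "\<zero>\<^bsub>R\<^esub> \<odot>\<^bsub>M\<^esub> y = \<zero>\<^bsub>M\<^esub>"
      using smult_l_distr[OF R.zero_closed R.zero_closed y] smult_closed[OF R.zero_closed y]
      by (metis M.add.l_cancel_one' R.l_zero R.zero_closed)
    then show ?thesis
      using smult_l_distr[OF R.a_inv_closed[OF a] a y] a y
      by (metis M.minus_equality R.a_inv_closed R.l_neg smult_closed)
  qed
  have "submodule ((\<lambda>r. r \<odot>\<^bsub>M\<^esub> m) ` carrier R) R M"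
  proof (intro submodule.intro submodule_axioms.intro M.add.subgroupI)
    show "(\<lambda>r. r \<odot>\<^bsub>M\<^esub> m) ` carrier R \<subseteq> carrier M" using m smult_closed by auto
    show "(\<lambda>r. r \<odot>\<^bsub>M\<^esub> m) ` carrier R \<noteq> {}" using R.zero_closed by blast
    fix a assume "a \<in> (\<lambda>r. r \<odot>\<^bsub>M\<^esub> m) ` carrier R"
    then obtain r where r: "r \<in> carrier R" "a = r \<odot>\<^bsub>M\<^esub> m" by auto
    show "\<ominus>\<^bsub>M\<^esub> a \<in> (\<lambda>r. r \<odot>\<^bsub>M\<^esub> m) ` carrier R"
      using negl[OF r(1) m(1)] r by (metis R.a_inv_closed imageI)
    fix b assume "b \<in> (\<lambda>r. r \<odot>\<^bsub>M\<^esub> m) ` carrier R"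
    then obtain s where s: "s \<in> carrier R" "b = s \<odot>\<^bsub>M\<^esub> m" by auto
    show "a \<oplus>\<^bsub>M\<^esub> b \<in> (\<lambda>r. r \<odot>\<^bsub>M\<^esub> m) ` carrier R"
      using smult_l_distr[OF r(1) s(1) m(1)] r s by (metis R.a_closed imageI)
  next
    fix a y assume a: "a \<in> carrier R" and "y \<in> (\<lambda>r. r \<odot>\<^bsub>M\<^esub> m) ` carrier R"
    then obtain r where r: "r \<in> carrier R" "y = r \<odot>\<^bsub>M\<^esub> m" by auto
    show "a \<odot>\<^bsub>M\<^esub> y \<in> (\<lambda>r. r \<odot>\<^bsub>M\<^esub> m) ` carrier R"
      using smult_assoc1[OF a r(1) m(1)] a r by (metis R.m_closed imageI)
  qed
  moreover have "m \<in> (\<lambda>r. r \<odot>\<^bsub>M\<^esub> m) ` carrier R"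
    using smult_one[OF m(1)] by (metis R.one_closed imageI)
  ultimately have gen: "(\<lambda>r. r \<odot>\<^bsub>M\<^esub> m) ` carrier R = carrier M" using sub m(2) by blast
  define h where "h y = {r \<in> carrier R. r \<odot>\<^bsub>M\<^esub> m = y}" for y
  define g where "g = inv_into (carrier M) h"
  have "inj_on h (carrier M)"
  proof (rule inj_onI)
    fix y y' assume y: "y \<in> carrier M" and eq: "h y = h y'"
    from y gen obtain r where "r \<in> carrier R" "r \<odot>\<^bsub>M\<^esub> m = y" by (metis imageE)
    then have "r \<in> h y'" using eq by (auto simp: h_def)
    then show "y = y'" using \<open>r \<odot>\<^bsub>M\<^esub> m = y\<close> by (simp add: h_def)
  qed
  then have gh [simp]: "g (h y) = y" if "y \<in> carrier M" for y
    using that by (simp add: g_def)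
  define M' :: "('a, 'a set) module" where "M' =
    \<lparr>carrier = h ` carrier M, monoid.mult = undefined, one = undefined, ring.zero = h \<zero>\<^bsub>M\<^esub>,
     add = (\<lambda>A B. h (g A \<oplus>\<^bsub>M\<^esub> g B)), smult = (\<lambda>r A. h (r \<odot>\<^bsub>M\<^esub> g A))\<rparr>"
  have M': "carrier M' = h ` carrier M" "\<zero>\<^bsub>M'\<^esub> = h \<zero>\<^bsub>M\<^esub>"
    "A \<oplus>\<^bsub>M'\<^esub> B = h (g A \<oplus>\<^bsub>M\<^esub> g B)" "r \<odot>\<^bsub>M'\<^esub> A = h (r \<odot>\<^bsub>M\<^esub> g A)" for A B r
    by (simp_all add: M'_def)
  have ag: "abelian_group M'"
  proof (rule abelian_groupI)
    fix A assume "A \<in> carrier M'"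
    then obtain y where y: "y \<in> carrier M" "A = h y" by (auto simp: M')
    show "\<exists>B \<in> carrier M'. B \<oplus>\<^bsub>M'\<^esub> A = \<zero>\<^bsub>M'\<^esub>"
      by (rule bexI[of _ "h (\<ominus>\<^bsub>M\<^esub> y)"]) (use y in \<open>auto simp: M' M.l_neg\<close>)
  next
    fix A B assume "A \<in> carrier M'" "B \<in> carrier M'"
    then obtain y z where "y \<in> carrier M" "A = h y" "z \<in> carrier M" "B = h z"
      by (auto simp: M')
    then show "A \<oplus>\<^bsub>M'\<^esub> B = B \<oplus>\<^bsub>M'\<^esub> A" using M.a_comm[of y z] by (simp add: M')
  qed (auto simp: M' M.a_assoc)
  have lm: "left_module R M'"
    by (intro left_module.intro left_module_axioms.intro R.ring_axioms ag)
      (auto simp: M' smult_closed smult_l_distr smult_r_distr smult_assoc1 smult_one)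
  interpret M'': abelian_group M' by (rule ag)
  have neg': "\<ominus>\<^bsub>M'\<^esub> (h y) = h (\<ominus>\<^bsub>M\<^esub> y)" if "y \<in> carrier M" for y
    by (rule M''.minus_equality) (use that in \<open>auto simp: M' M.l_neg\<close>)
  have "N' = {\<zero>\<^bsub>M'\<^esub>} \<or> N' = carrier M'" if N': "submodule N' R M'" for N'
  proof -
    interpret N': submodule N' R M' by fact
    define N where "N = {y \<in> carrier M. h y \<in> N'}"
    have N'_eq: "N' = h ` N" using N'.subset by (auto simp: N_def M')
    have "submodule N R M"
    proof (intro submodule.intro submodule_axioms.intro M.add.subgroupI)
      show "N \<subseteq> carrier M" by (auto simp: N_def)
      show "N \<noteq> {}" using N'.one_closed N'_eq by auto
      fix a assume a: "a \<in> N"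
      show "\<ominus>\<^bsub>M\<^esub> a \<in> N"
      proof -
        have "a \<in> carrier M" "h a \<in> N'" using a by (auto simp: N_def)
        moreover from this have "\<ominus>\<^bsub>M'\<^esub> (h a) \<in> N'" unfolding a_inv_def by (intro N'.m_inv_closed)
        ultimately show ?thesis by (simp add: N_def neg')
      qed
      fix b assume b: "b \<in> N"
      show "a \<oplus>\<^bsub>M\<^esub> b \<in> N"
      proof -
        have ab: "a \<in> carrier M" "h a \<in> N'" "b \<in> carrier M" "h b \<in> N'"
          using a b by (simp_all add: N_def)
        then have "h a \<oplus>\<^bsub>M'\<^esub> h b \<in> N'" using N'.m_closed[of "h a" "h b"] by simp
        then show ?thesis using ab by (simp add: N_def M')
      qed
    next
      fix a y assume "a \<in> carrier R" "y \<in> N"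
      then show "a \<odot>\<^bsub>M\<^esub> y \<in> N"
        using N'.smult_closed[of a "h y"] by (auto simp: N_def M' smult_closed)
    qed
    from sub[OF this] show ?thesis unfolding N'_eq M' by (elim disjE) simp_all
  qed
  moreover have "carrier M' \<noteq> {\<zero>\<^bsub>M'\<^esub>}"
  proof
    assume "carrier M' = {\<zero>\<^bsub>M'\<^esub>}"
    then have "h m = h \<zero>\<^bsub>M\<^esub>" using m(1) unfolding M' by blast
    then show False using gh[OF m(1)] gh[OF M.zero_closed] m(2) by simp
  qed
  ultimately have "simple_left_module R M'" using lm by (simp add: simple_left_module_def)
  moreover have "faithful_module R M'"
    unfolding faithful_module_def
  proof (intro ballI impI)
    fix r assume r: "r \<in> carrier R" and ann: "\<forall>A \<in> carrier M'. r \<odot>\<^bsub>M'\<^esub> A = \<zero>\<^bsub>M'\<^esub>"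
    have "r \<odot>\<^bsub>M\<^esub> y = \<zero>\<^bsub>M\<^esub>" if y: "y \<in> carrier M" for y
    proof -
      have "h (r \<odot>\<^bsub>M\<^esub> y) = h \<zero>\<^bsub>M\<^esub>" using bspec[OF ann, of "h y"] y by (simp add: M')
      then show ?thesis
        by (metis gh[OF smult_closed[OF r y]] gh[OF M.zero_closed])
    qed
    then show "r = \<zero>\<^bsub>R\<^esub>" using faithful r unfolding faithful_module_def by blast
  qed
  ultimately show ?thesis unfolding primitive_ring_def by blast
qed

end

theory Submission
  imports Defs "HOL-Library.List_Lenlexorder" "HOL-Library.Multiset" "HOL-Combinatorics.Permutations"
begin

text \<open>
  Write \<open>F\<close> for the copy of the base field in \<open>R\<close>.  It suffices to find a proper left ideal of the
  form \<open>R(x - c)\<close>, \<open>c \<in> F\<close>, whose maximal overideals have zero core.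

  A nonzero ideal \<open>I\<close> of a prime left Goldie ring contains a left regular element, so the growth of
  \<open>R/I\<close> is smaller than that of \<open>R\<close> by a factor \<open>n\<close>; it is subquadratic, hence linear by Bergman's gap
  theorem.  If \<open>x\<close> were transcendental modulo \<open>I\<close>, then it would be transcendental modulo some prime
  \<open>P \<supseteq> I\<close>, and \<open>R/P\<close> would have GK dimension exactly 1, against the hypothesis.  So \<open>x\<close> is algebraic
  modulo every nonzero ideal.

  Let \<open>L\<close> be a maximal left ideal with core \<open>P \<noteq> 0\<close>.  Linear growth of \<open>R/P\<close> bounds the length of
  chains of left ideals with infinite dimensional quotients.  If \<open>R/L\<close> were infinite dimensional,
  then \<open>R/P\<close> would be a finite direct sum of copies of \<open>R/L\<close>, every element of \<open>R/P\<close> would be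
  algebraic by Amitsur's trick, and normal words would show that \<open>R/P\<close> is finite dimensional.
  Hence \<open>P\<close> has finite codimension.

  Since \<open>R\<close> is not PI, the intersection \<open>D\<^sub>m\<close> of all ideals of codimension less than \<open>m\<close> is nonzero, as
  \<open>R/D\<^sub>m\<close> satisfies the standard identity of degree \<open>m\<close>.  So \<open>x - c\<close> is invertible modulo every
  \<open>D\<^sub>m\<close> for all but countably many \<open>c\<close>, while it is left invertible in \<open>R\<close> for only countably many \<open>c\<close>.
  A maximal left ideal above \<open>R(x - c)\<close> for one of the remaining \<open>c\<close> has zero core.
\<close>

section \<open>Linear algebra over a central subfield\<close>

text \<open>The obstacle is a maximal left ideal whose core \<open>P\<close> is nonzero and might
  have infinite codimension: only linear growth of \<open>R/P\<close> is at hand. Growth is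
  exploited through one bound on chains of left ideals with infinite dimensional factors. Applied to
  annihilators, to powers of an element and to products of linear factors, it makes
  \<open>R/P\<close> behave like an artinian ring whose elements have finite spectrum.

  Uncountability of the field serves twice. Amitsur's count plays it against the countable dimension
  of an affine algebra, and it absorbs the exceptional scalars of all \<open>D\<^sub>m\<close>
  together: each \<open>D\<^sub>m\<close> excludes finitely many \<open>c\<close>, but there are
  infinitely many \<open>m\<close>. For the final \<open>c\<close>, a core of codimension less than
  \<open>m\<close> would contain \<open>D\<^sub>m\<close>, and
  \<open>R = R(x - c) + D\<^sub>m\<close> would lie inside the maximal left ideal.

  All counting takes place in \<open>R\<close> relative to an ideal, by triangular families that
  cannot be larger than a spanning set; quotient rings appear only to read the hypotheses on
  \<open>R/P\<close>.\<close>

locale central_subfield = ring R for R (structure) +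
  fixes F
  assumes subfield_F: "subfield F R"
    and F_central: "\<lbrakk> c \<in> F; r \<in> carrier R \<rbrakk> \<Longrightarrow> c \<otimes> r = r \<otimes> c"
begin

lemma F_subring: "subring F R"
  using subfield_F by (rule subfieldE(1))

lemma F_carrier: "c \<in> F \<Longrightarrow> c \<in> carrier R"
  using subfieldE(3)[OF subfield_F] by blast

lemma F_one: "\<one> \<in> F" and F_zero: "\<zero> \<in> F"
  using subringE[OF F_subring] by auto

lemma F_closed: "a \<in> F \<Longrightarrow> b \<in> F \<Longrightarrow> a \<otimes> b \<in> F"
    "a \<in> F \<Longrightarrow> b \<in> F \<Longrightarrow> a \<oplus> b \<in> F"
    "a \<in> F \<Longrightarrow> \<ominus> a \<in> F"
  using subringE[OF F_subring] by auto

lemma F_minus_closed: "a \<in> F \<Longrightarrow> b \<in> F \<Longrightarrow> a \<ominus> b \<in> F"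
  by (simp add: minus_eq F_closed)

lemma F_inverse:
  assumes "c \<in> F" "c \<noteq> \<zero>"
  obtains d where "d \<in> F" "d \<otimes> c = \<one>" "c \<otimes> d = \<one>"
  using subfield_m_inv[OF subfield_F, of c] assms by auto

lemma one_neq_zero: "\<one> \<noteq> \<zero>"
  using subfieldE(6)[OF subfield_F] by auto

section \<open>Subspaces and spans\<close>

definition subspace :: "'a set \<Rightarrow> bool"
  where "subspace V \<longleftrightarrow> V \<subseteq> carrier R \<and> \<zero> \<in> V \<and> (\<forall>a\<in>V. \<forall>b\<in>V. a \<oplus> b \<in> V) \<and>
    (\<forall>c\<in>F. \<forall>a\<in>V. c \<otimes> a \<in> V)"

abbreviation spn :: "'a set \<Rightarrow> 'a set" where "spn \<equiv> linear_span R F"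

lemma subspaceI:
  assumes "V \<subseteq> carrier R" "\<zero> \<in> V" "\<And>a b. a \<in> V \<Longrightarrow> b \<in> V \<Longrightarrow> a \<oplus> b \<in> V"
    "\<And>c a. c \<in> F \<Longrightarrow> a \<in> V \<Longrightarrow> c \<otimes> a \<in> V"
  shows "subspace V"
  using assms by (simp add: subspace_def)

lemma subspaceD:
  assumes "subspace V"
  shows "V \<subseteq> carrier R" "a \<in> V \<Longrightarrow> a \<in> carrier R" "\<zero> \<in> V" "\<lbrakk> a \<in> V; b \<in> V \<rbrakk> \<Longrightarrow> a \<oplus> b \<in> V"
    "\<lbrakk> c \<in> F; a \<in> V \<rbrakk> \<Longrightarrow> c \<otimes> a \<in> V"
  using assms by (auto simp: subspace_def)

lemma subspace_uminus: "subspace V \<Longrightarrow> a \<in> V \<Longrightarrow> \<ominus> a \<in> V"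
  by (metis F_closed(3) F_one l_minus l_one one_closed subspaceD(2,5))

lemma subspace_minus: "subspace V \<Longrightarrow> a \<in> V \<Longrightarrow> b \<in> V \<Longrightarrow> a \<ominus> b \<in> V"
  by (simp add: minus_eq subspace_uminus subspaceD(4))

text \<open>The elementwise form suits span arguments, the library form carries the dimension
  theory. Closure under negation comes from multiplication by \<ominus>\<one> \<in>
  \<open>F\<close>.\<close>

lemma subspace_iff_subalgebra: "subspace V \<longleftrightarrow> subalgebra F V R"
proof
  assume V: "subspace V"
  show "subalgebra F V R"
  proof (intro subalgebra.intro subalgebra_axioms.intro add.subgroupI)
    show "V \<noteq> {}" using V by (auto simp: subspace_def)
  qed (use V subspace_uminus[OF V] in \<open>auto simp: subspace_def a_inv_def\<close>)
next
  assume "subalgebra F V R"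
  then interpret subalgebra F V R .
  show "subspace V"
    using subset one_closed m_closed smult_closed by (intro subspaceI) auto
qed

lemma subspace_carrier: "subspace (carrier R)"
  by (intro subspaceI) (auto intro: F_carrier)

lemma subspace_zero: "subspace {\<zero>}"
  by (intro subspaceI) (auto simp: F_carrier)

lemma spn_def': "spn A = \<Inter>{E. subspace E \<and> A \<subseteq> E}"
  by (simp add: linear_span_def subspace_iff_subalgebra)

lemma spn_superset: "A \<subseteq> spn A"
  by (auto simp: spn_def')

lemma spn_min: "subspace Q \<Longrightarrow> A \<subseteq> Q \<Longrightarrow> spn A \<subseteq> Q"
  by (auto simp: spn_def')

lemma spn_base: "a \<in> A \<Longrightarrow> a \<in> spn A"
  using spn_superset by blast

lemma spn_mono: "A \<subseteq> B \<Longrightarrow> spn A \<subseteq> spn B"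
  unfolding spn_def' by (intro Inter_anti_mono) auto

lemma subspace_spn: "A \<subseteq> carrier R \<Longrightarrow> subspace (spn A)"
  using subspace_carrier by (intro subspaceI) (auto simp: spn_def' subspace_def)

lemma spn_carrier: "A \<subseteq> carrier R \<Longrightarrow> spn A \<subseteq> carrier R"
  by (rule spn_min[OF subspace_carrier])

lemma spn_subset_spn: "A \<subseteq> spn B \<Longrightarrow> B \<subseteq> carrier R \<Longrightarrow> spn A \<subseteq> spn B"
  by (intro spn_min subspace_spn)

lemma spn_subspace: "subspace V \<Longrightarrow> spn V = V"
  using spn_min[of V V] spn_superset[of V] by auto

lemma subspace_set_sum:
  assumes "subspace A" "subspace B"
  shows "subspace {a \<oplus> b | a b. a \<in> A \<and> b \<in> B}"
proof (intro subspaceI)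
  show "{a \<oplus> b |a b. a \<in> A \<and> b \<in> B} \<subseteq> carrier R"
    using subspaceD(2)[OF assms(1)] subspaceD(2)[OF assms(2)] by auto
  show "\<zero> \<in> {a \<oplus> b |a b. a \<in> A \<and> b \<in> B}"
    using subspaceD(3)[OF assms(1)] subspaceD(3)[OF assms(2)] l_zero[OF zero_closed] by force
next
  fix x y assume "x \<in> {a \<oplus> b |a b. a \<in> A \<and> b \<in> B}" "y \<in> {a \<oplus> b |a b. a \<in> A \<and> b \<in> B}"
  then obtain a b c d where h: "x = a \<oplus> b" "y = c \<oplus> d" "a \<in> A" "c \<in> A" "b \<in> B" "d \<in> B" by blast
  then have "x \<oplus> y = (a \<oplus> c) \<oplus> (b \<oplus> d)"
    using subspaceD(2)[OF assms(1)] subspaceD(2)[OF assms(2)] by (simp add: a_ac)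
  then show "x \<oplus> y \<in> {a \<oplus> b |a b. a \<in> A \<and> b \<in> B}"
    using h subspaceD(4)[OF assms(1)] subspaceD(4)[OF assms(2)] by blast
next
  fix c x assume c: "c \<in> F" and "x \<in> {a \<oplus> b |a b. a \<in> A \<and> b \<in> B}"
  then obtain a b where h: "x = a \<oplus> b" "a \<in> A" "b \<in> B" by blast
  then have "c \<otimes> x = c \<otimes> a \<oplus> c \<otimes> b"
    using subspaceD(2)[OF assms(1)] subspaceD(2)[OF assms(2)] F_carrier[OF c] by (simp add: r_distr)
  then show "c \<otimes> x \<in> {a \<oplus> b |a b. a \<in> A \<and> b \<in> B}"
    using h c subspaceD(5)[OF assms(1)] subspaceD(5)[OF assms(2)] by blast
qed

lemma spn_Un:
  assumes "subspace A" "subspace B"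
  shows "spn (A \<union> B) = {a \<oplus> b | a b. a \<in> A \<and> b \<in> B}"
proof
  show "spn (A \<union> B) \<subseteq> {a \<oplus> b |a b. a \<in> A \<and> b \<in> B}"
  proof (rule spn_min[OF subspace_set_sum[OF assms]])
    have "a \<in> {a \<oplus> b |a b. a \<in> A \<and> b \<in> B}" if "a \<in> A" for a
      using that subspaceD(3)[OF assms(2)] subspaceD(2)[OF assms(1) that] by force
    moreover have "a \<in> {a \<oplus> b |a b. a \<in> A \<and> b \<in> B}" if "a \<in> B" for a
      using that subspaceD(3)[OF assms(1)] subspaceD(2)[OF assms(2) that] by force
    ultimately show "A \<union> B \<subseteq> {a \<oplus> b |a b. a \<in> A \<and> b \<in> B}" by blast
  qed
  have "subspace (spn (A \<union> B))"
    using assms by (intro subspace_spn) (auto simp: subspace_def)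
  then show "{a \<oplus> b |a b. a \<in> A \<and> b \<in> B} \<subseteq> spn (A \<union> B)"
    using spn_superset[of "A \<union> B"] by (auto intro: subspaceD(4))
qed

lemma spn_Un_cong:
  assumes "A \<subseteq> carrier R" "B \<subseteq> carrier R"
  shows "spn (A \<union> B) = {a \<oplus> b | a b. a \<in> spn A \<and> b \<in> spn B}"
proof -
  have "spn (A \<union> B) = spn (spn A \<union> spn B)"
  proof
    show "spn (A \<union> B) \<subseteq> spn (spn A \<union> spn B)"
      using spn_superset by (intro spn_mono) blast
    show "spn (spn A \<union> spn B) \<subseteq> spn (A \<union> B)"
      using assms spn_mono[of A "A \<union> B"] spn_mono[of B "A \<union> B"] by (intro spn_subset_spn) auto
  qed
  then show ?thesis using spn_Un[OF subspace_spn subspace_spn] assms by simp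
qed

lemma subspace_line: "u \<in> carrier R \<Longrightarrow> subspace ((\<lambda>c. c \<otimes> u) ` F)"
proof (intro subspaceI)
  fix a b assume "u \<in> carrier R" "a \<in> (\<lambda>c. c \<otimes> u) ` F" "b \<in> (\<lambda>c. c \<otimes> u) ` F"
  then show "a \<oplus> b \<in> (\<lambda>c. c \<otimes> u) ` F"
    using F_closed(2) F_carrier by (auto simp: l_distr[symmetric])
next
  fix c a assume "u \<in> carrier R" "c \<in> F" "a \<in> (\<lambda>c. c \<otimes> u) ` F"
  then show "c \<otimes> a \<in> (\<lambda>c. c \<otimes> u) ` F"
    using F_closed(1) F_carrier by (auto simp: m_assoc[symmetric])
next
  assume "u \<in> carrier R" then show "\<zero> \<in> (\<lambda>c. c \<otimes> u) ` F"
    using F_zero l_null by (metis imageI)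
qed (auto intro: F_carrier)

lemma spn_singleton: "u \<in> carrier R \<Longrightarrow> spn {u} = (\<lambda>c. c \<otimes> u) ` F"
proof
  assume u: "u \<in> carrier R"
  show "spn {u} \<subseteq> (\<lambda>c. c \<otimes> u) ` F"
    using u F_one l_one by (intro spn_min subspace_line) force+
  show "(\<lambda>c. c \<otimes> u) ` F \<subseteq> spn {u}"
    using subspaceD(5)[OF subspace_spn] spn_base[of u "{u}"] u by auto
qed

lemma spn_insertE:
  assumes "y \<in> spn (insert u A)" "u \<in> carrier R" "A \<subseteq> carrier R"
  obtains c b where "c \<in> F" "b \<in> spn A" "y = c \<otimes> u \<oplus> b"
proof -
  have "y \<in> spn ({u} \<union> A)" using assms by simp
  then have "y \<in> {a \<oplus> b | a b. a \<in> spn {u} \<and> b \<in> spn A}"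
    using spn_Un_cong[of "{u}" A] assms by simp
  then show thesis
    using that unfolding spn_singleton[OF assms(2)] by blast
qed

lemma smult_cancel_subspace:
  assumes "c \<in> F" "c \<noteq> \<zero>" "subspace V" "c \<otimes> u \<in> V" "u \<in> carrier R"
  shows "u \<in> V"
proof -
  obtain d where d: "d \<in> F" "d \<otimes> c = \<one>" using F_inverse assms(1,2) by blast
  have "d \<otimes> (c \<otimes> u) \<in> V" using subspaceD(5)[OF assms(3) d(1) assms(4)] .
  moreover have "d \<otimes> (c \<otimes> u) = u"
    using m_assoc[of d c u] d assms F_carrier by simp
  ultimately show ?thesis by simp
qed

lemma subspace_add_cancel:
  assumes "subspace V" "a \<oplus> b \<in> V" "b \<in> V" "a \<in> carrier R"
  shows "a \<in> V"
proof -
  have b: "b \<in> carrier R" using assms(1,3) by (rule subspaceD(2))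
  have "(a \<oplus> b) \<ominus> b \<in> V" using assms by (intro subspace_minus)
  also have "(a \<oplus> b) \<ominus> b = a" using b assms(4) by (simp add: minus_eq a_assoc r_neg)
  finally show ?thesis .
qed

lemma subspace_diff_cancel:
  assumes "subspace V" "a \<ominus> b \<in> V" "b \<in> V" "a \<in> carrier R"
  shows "a \<in> V"
proof -
  have b: "b \<in> carrier R" using assms(1,3) by (rule subspaceD(2))
  have "(a \<ominus> b) \<oplus> b \<in> V" using assms by (intro subspaceD(4))
  also have "(a \<ominus> b) \<oplus> b = a" using b assms(4) by (simp add: minus_eq a_assoc l_neg)
  finally show ?thesis .
qed

section \<open>Exchange and counting of independent elements modulo a set\<close>

lemma spn_exchange:
  assumes "finite T" "T \<subseteq> carrier R" "P \<subseteq> carrier R" "u \<in> spn (T \<union> P)" "u \<notin> spn P"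
  shows "\<exists>t\<in>T. t \<in> spn (insert u (T - {t} \<union> P))"
  using assms
proof (induction T rule: finite_induct)
  case empty then show ?case by simp
next
  case (insert t T)
  have u: "u \<in> carrier R" using insert.prems spn_carrier[of "insert t T \<union> P"] by blast
  show ?case
  proof (cases "u \<in> spn (T \<union> P)")
    case True
    then obtain t' where t': "t' \<in> T" "t' \<in> spn (insert u (T - {t'} \<union> P))"
      using insert by auto
    then have "t' \<in> spn (insert u (insert t T - {t'} \<union> P))"
      using spn_mono[of "insert u (T - {t'} \<union> P)" "insert u (insert t T - {t'} \<union> P)"] by blast
    then show ?thesis using t' by blast
  next
    case False
    \<comment> \<open>Here \<open>t\<close> is indispensable for \<open>u\<close>, so its
      coefficient \<open>c\<close> is nonzero and the equation can be solved for
      \<open>t\<close>.\<close>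
    have "u \<in> spn (insert t (T \<union> P))" using insert.prems by simp
    then obtain c b where cb: "c \<in> F" "b \<in> spn (T \<union> P)" "u = c \<otimes> t \<oplus> b"
      using insert.prems by (elim spn_insertE) auto
    have tb: "t \<in> carrier R" "b \<in> carrier R" "c \<in> carrier R"
      using insert.prems cb spn_carrier[of "T \<union> P"] F_carrier by blast+
    have "c \<noteq> \<zero>" using False cb tb by auto
    let ?V = "spn (insert u (insert t T - {t} \<union> P))"
    have V: "subspace ?V" using insert.prems u by (intro subspace_spn) auto
    have "spn (T \<union> P) \<subseteq> ?V" using insert.hyps by (intro spn_mono) auto
    then have "b \<in> ?V" using cb by blast
    moreover have "c \<otimes> t \<oplus> b \<in> ?V" using cb(3) spn_base[of u] by simp
    ultimately have "c \<otimes> t \<in> ?V" using subspace_add_cancel[OF V] tb by auto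
    then have "t \<in> ?V" using smult_cancel_subspace[OF cb(1) \<open>c \<noteq> \<zero>\<close> V] tb by auto
    then show ?thesis by blast
  qed
qed

text \<open>Steinitz: \<open>u 0\<close> replaces some \<open>t\<close> and then joins
  \<open>P\<close>, the vectors taken for granted, which is why the induction lets \<open>T\<close>,
  \<open>P\<close> and \<open>u\<close> vary. The later dimension bounds reduce to this count; with
  an ideal for \<open>P\<close> it takes place in the quotient without forming it.\<close>

lemma chain_bound:
  fixes u :: "nat \<Rightarrow> 'a"
  assumes "finite T" "T \<subseteq> carrier R" "P \<subseteq> carrier R"
    and "\<And>a. a < N \<Longrightarrow> u a \<in> spn (T \<union> P)"
    and "\<And>a. a < N \<Longrightarrow> u a \<notin> spn (u ` {..<a} \<union> P)"
  shows "N \<le> card T"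
  using assms
proof (induction N arbitrary: T P u)
  case 0 then show ?case by simp
next
  case (Suc N)
  have "u 0 \<notin> spn P" using Suc.prems(5)[of 0] by simp
  then obtain t where t: "t \<in> T" "t \<in> spn (insert (u 0) (T - {t} \<union> P))"
    using spn_exchange[OF Suc.prems(1-3) Suc.prems(4)[of 0]] by auto
  have uc: "u a \<in> carrier R" if "a < Suc N" for a
    using Suc.prems(4)[OF that] spn_carrier[of "T \<union> P"] Suc.prems by blast
  have "N \<le> card (T - {t})"
  proof (rule Suc.IH[of _ "insert (u 0) P" "\<lambda>a. u (Suc a)"])
    fix a assume a: "a < N"
    have "T \<union> P \<subseteq> spn (insert (u 0) (T - {t} \<union> P))"
      using t spn_superset[of "insert (u 0) (T - {t} \<union> P)"] by blast
    then have "spn (T \<union> P) \<subseteq> spn (insert (u 0) (T - {t} \<union> P))"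
      using Suc.prems uc[of 0] by (intro spn_subset_spn) auto
    then show "u (Suc a) \<in> spn (T - {t} \<union> insert (u 0) P)"
      using Suc.prems(4)[of "Suc a"] a by auto
    have "u ` {..<Suc a} = insert (u 0) ((\<lambda>a. u (Suc a)) ` {..<a})"
      unfolding lessThan_Suc_eq_insert_0 by auto
    then have "u ` {..<Suc a} \<union> P = (\<lambda>a. u (Suc a)) ` {..<a} \<union> insert (u 0) P" by auto
    then show "u (Suc a) \<notin> spn ((\<lambda>a. u (Suc a)) ` {..<a} \<union> insert (u 0) P)"
      using Suc.prems(5)[of "Suc a"] a by simp
  qed (use Suc.prems uc[of 0] in auto)
  then show ?case using t(1) Suc.prems(1) by (metis Suc_leI card_Diff1_less le_less_trans less_Suc_eq_le card.remove not_less_eq_eq)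
qed

text \<open>A subspace \<open>Z\<close> separating \<open>u a\<close> from its predecessors
  certifies independence. In applications such a \<open>Z\<close> is easier to name than the span of
  the predecessors.\<close>

lemma triangular_bound:
  fixes u :: "nat \<Rightarrow> 'a"
  assumes "finite T" "T \<subseteq> carrier R" "P \<subseteq> carrier R"
    and "\<And>a. a < N \<Longrightarrow> u a \<in> spn (T \<union> P)"
    and "\<And>a. a < N \<Longrightarrow> \<exists>Z. subspace Z \<and> P \<subseteq> Z \<and> (\<forall>b<a. u b \<in> Z) \<and> u a \<notin> Z"
  shows "N \<le> card T"
proof (rule chain_bound[OF assms(1-4)])
  fix a assume "a < N"
  then obtain Z where "subspace Z" "P \<subseteq> Z" "\<forall>b<a. u b \<in> Z" "u a \<notin> Z" using assms(5) by blast
  then show "u a \<notin> spn (u ` {..<a} \<union> P)" using spn_min[of Z "u ` {..<a} \<union> P"] by auto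
qed auto

text \<open>The pairs are listed lexicographically, \<open>i\<close> before \<open>j\<close>, by
  coding \<open>(i, j)\<close> as \<open>i * M + j\<close>.\<close>

lemma triangular_bound2:
  fixes u :: "nat \<Rightarrow> nat \<Rightarrow> 'a"
  assumes "finite T" "T \<subseteq> carrier R" "P \<subseteq> carrier R"
    and "\<And>i j. i < N \<Longrightarrow> j < M \<Longrightarrow> u i j \<in> spn (T \<union> P)"
    and "\<And>i j. i < N \<Longrightarrow> j < M \<Longrightarrow> \<exists>Z. subspace Z \<and> P \<subseteq> Z \<and>
      (\<forall>i'<i. \<forall>j'<M. u i' j' \<in> Z) \<and> (\<forall>j'<j. u i j' \<in> Z) \<and> u i j \<notin> Z"
  shows "N * M \<le> card T"
proof (cases "M = 0")
  case False
  have *: "a div M < N" "a mod M < M" if "a < N * M" for a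
    using that False by (auto simp: less_mult_imp_div_less)
  show ?thesis
  proof (rule triangular_bound[OF assms(1-3), of _ "\<lambda>a. u (a div M) (a mod M)"])
    fix a assume a: "a < N * M"
    obtain Z where Z: "subspace Z" "P \<subseteq> Z" "\<forall>i'<a div M. \<forall>j'<M. u i' j' \<in> Z"
      "\<forall>j'<a mod M. u (a div M) j' \<in> Z" "u (a div M) (a mod M) \<notin> Z"
      using assms(5)[OF *[OF a]] by blast
    have "u (b div M) (b mod M) \<in> Z" if "b < a" for b
    proof (cases "b div M = a div M")
      case True
      then have "b mod M < a mod M" using that
        by (metis add_less_cancel_left mult_div_mod_eq)
      then show ?thesis using Z(4) True by simp
    next
      case neq: False
      have "b div M \<le> a div M" using that by (simp add: div_le_mono)
      then show ?thesis using Z(3) neq False by simp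
    qed
    then show "\<exists>Z. subspace Z \<and> P \<subseteq> Z \<and> (\<forall>b<a. u (b div M) (b mod M) \<in> Z) \<and>
        u (a div M) (a mod M) \<notin> Z" using Z by blast
  qed (use assms(4) * in auto)
qed simp

text \<open>A longest sequence in \<open>A\<close> that is independent modulo \<open>J\<close> spans
  \<open>A\<close> modulo \<open>J\<close>. A longest one exists because \<open>chain_bound\<close>
  limits its length by \<open>card T\<close>.\<close>

lemma finite_extraction:
  assumes "finite T" "T \<subseteq> carrier R" "J \<subseteq> carrier R" "A \<subseteq> spn (T \<union> J)"
  obtains U where "finite U" "U \<subseteq> A" "card U \<le> card T" "A \<subseteq> spn (U \<union> J)"
proof -
  define Q where "Q N \<longleftrightarrow> (\<exists>u :: nat \<Rightarrow> 'a. \<forall>a<N. u a \<in> A \<and> u a \<notin> spn (u ` {..<a} \<union> J))" for N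
  have bd: "N \<le> card T" if "Q N" for N
    using that assms unfolding Q_def by (elim exE, intro chain_bound[of T J N]) auto
  have "Q 0" by (simp add: Q_def)
  then obtain N where N: "Q N" "\<And>N'. Q N' \<Longrightarrow> N' \<le> N"
    using bd GreatestI_nat[of Q 0 "card T"] Greatest_le_nat[of Q _ "card T"] by blast
  then obtain u :: "nat \<Rightarrow> 'a" where u: "\<And>a. a < N \<Longrightarrow> u a \<in> A" "\<And>a. a < N \<Longrightarrow> u a \<notin> spn (u ` {..<a} \<union> J)"
    unfolding Q_def by blast
  have "A \<subseteq> spn (u ` {..<N} \<union> J)"
  proof
    fix y assume y: "y \<in> A"
    show "y \<in> spn (u ` {..<N} \<union> J)"
    proof (rule ccontr)
      assume n: "y \<notin> spn (u ` {..<N} \<union> J)"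
      have "(u(N := y)) a \<in> A \<and> (u(N := y)) a \<notin> spn ((u(N := y)) ` {..<a} \<union> J)" if "a < Suc N" for a
      proof -
        have "(u(N := y)) ` {..<a} = u ` {..<a}" using that by auto
        then show ?thesis using u[of a] that n y by (cases "a = N") auto
      qed
      then have "Q (Suc N)" unfolding Q_def by blast
      then show False using N(2) by force
    qed
  qed
  moreover have "card (u ` {..<N}) \<le> card T" using card_image_le[of "{..<N}" u] bd[OF N(1)] by simp
  ultimately show thesis using that[of "u ` {..<N}"] u by auto
qed

end

section \<open>Words and Bergman's gap\<close>

lemma factor_eq_nth:
  assumes "take d (drop p w) = take d (drop p' w)" "p + d \<le> length w" "p' + d \<le> length w" "a < d"
  shows "w ! (p + a) = w ! (p' + a)"
proof -
  have "take d (drop p w) ! a = take d (drop p' w) ! a" using assms(1) by simp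
  then show ?thesis using assms(2-4) by simp
qed

text \<open>Sliding a window of length \<open>q\<close> one place to the right drops
  \<open>w ! p\<close> and gains \<open>w ! (p + q)\<close>; its content is unchanged exactly when
  these letters agree.\<close>

lemma mset_factor_shift:
  assumes "p + q < length w" "0 < q"
  shows "add_mset (w ! p) (mset (take q (drop (Suc p) w))) =
    add_mset (w ! (p + q)) (mset (take q (drop p w)))"
proof -
  obtain r where q: "q = Suc r" using assms(2) by (cases q) auto
  have 1: "take q (drop p w) = w ! p # take r (drop (Suc p) w)"
    using assms q by (metis Cons_nth_drop_Suc add_lessD1 take_Suc_Cons)
  have 2: "take q (drop (Suc p) w) = take r (drop (Suc p) w) @ [w ! (p + q)]"
    using assms q take_Suc_conv_app_nth[of r "drop (Suc p) w"] by simp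
  show ?thesis unfolding 1 2 by simp
qed

text \<open>Let \<open>q\<close> be the least shift between two equal factors of length \<open>d\<close> at the start of \<open>w\<close>, and
  suppose that the period \<open>q\<close> first fails at \<open>\<tau>\<close>.  Then \<open>d + 1\<close> factors are distinct: the \<open>q\<close> periodic
  ones, the \<open>d - q\<close> ones that see the failure at different offsets, and the one starting at \<open>\<tau> + 1\<close>,
  whose first \<open>q\<close> letters have another content than those of all the others.\<close>

lemma eventually_periodic_words:
  fixes L :: "'b list set"
  assumes factor: "\<And>u v w. u @ v @ w \<in> L \<Longrightarrow> v \<in> L"
    and fin: "finite {w \<in> L. length w = d}" and few: "card {w \<in> L. length w = d} \<le> d"
    and w: "w \<in> L" "2 * d \<le> length w"
  shows "\<exists>i q. 0 < q \<and> i + q \<le> d \<and> (\<forall>t\<ge>i. t + d < length w \<longrightarrow> w ! t = w ! (t + q))"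
proof -
  define n where "n = length w"
  define f where "f p = take d (drop p w)" for p
  have fL: "f p \<in> {w \<in> L. length w = d}" if "p + d \<le> n" for p
  proof -
    have "w = take p w @ f p @ drop d (drop p w)" unfolding f_def by (metis append_take_drop_id)
    then have "f p \<in> L" using factor w(1) by metis
    then show ?thesis using that by (simp add: f_def n_def)
  qed
  have not_inj: "\<not> inj_on f S" if "S \<subseteq> {..n - d}" "card S > d" for S
  proof
    assume "inj_on f S"
    then have "card S \<le> card {w \<in> L. length w = d}"
      using fL that(1) w(2) by (intro card_inj_on_le[OF _ _ fin]) (auto simp: n_def)
    then show False using few that(2) by simp
  qed
  have "\<not> inj_on f {..d}" using w(2) by (intro not_inj) (auto simp: n_def)
  then obtain p p' where pp: "p \<le> d" "p' \<le> d" "p \<noteq> p'" "f p = f p'" by (auto simp: inj_on_def)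
  define Q where "Q q \<longleftrightarrow> 0 < q \<and> (\<exists>i. i + q \<le> d \<and> f i = f (i + q))" for q
  have "\<exists>q. Q q"
  proof (cases "p < p'")
    case True
    then have "Q (p' - p)" unfolding Q_def using pp by (intro conjI exI[of _ p]) auto
    then show ?thesis by blast
  next
    case False
    then have "Q (p - p')" unfolding Q_def using pp by (intro conjI exI[of _ p']) auto
    then show ?thesis by blast
  qed
  \<comment> \<open>Minimality of the shift is what keeps the factors starting in \<open>A\<close>
    below distinct.\<close>
  then obtain q where q: "Q q" "\<And>q'. q' < q \<Longrightarrow> \<not> Q q'" using LeastI_ex[of Q] not_less_Least[of _ Q] by blast
  then obtain i where i: "0 < q" "i + q \<le> d" "f i = f (i + q)" unfolding Q_def by blast
  have feq: "w ! (s + a) = w ! (s' + a)" if "f s = f s'" "s + d \<le> n" "s' + d \<le> n" "a < d" for s s' a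
    using factor_eq_nth[of d s w s' a] that by (simp add: f_def n_def)
  have "\<forall>t\<ge>i. t + d < n \<longrightarrow> w ! t = w ! (t + q)"
  proof (rule ccontr)
    assume "\<not> ?thesis"
    then have ex: "\<exists>t. i \<le> t \<and> t + d < n \<and> w ! t \<noteq> w ! (t + q)" by blast
    define \<tau> where "\<tau> = (LEAST t. i \<le> t \<and> t + d < n \<and> w ! t \<noteq> w ! (t + q))"
    have \<tau>: "i \<le> \<tau>" "\<tau> + d < n" "w ! \<tau> \<noteq> w ! (\<tau> + q)"
      using LeastI_ex[OF ex] unfolding \<tau>_def by blast+
    have before: "w ! t = w ! (t + q)" if "i \<le> t" "t < \<tau>" for t
      using not_less_Least[of t "\<lambda>t. i \<le> t \<and> t + d < n \<and> w ! t \<noteq> w ! (t + q)"] that \<tau>(2)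
      unfolding \<tau>_def[symmetric] by auto
    \<comment> \<open>Equality of the factors at \<open>i\<close> and \<open>i + q\<close> already
      forces period \<open>q\<close> at the \<open>d\<close> places from \<open>i\<close>
      on.\<close>
    have \<tau>d: "i + d \<le> \<tau>"
    proof (rule ccontr)
      assume "\<not> i + d \<le> \<tau>"
      then have "w ! (i + (\<tau> - i)) = w ! (i + q + (\<tau> - i))"
        using \<tau>(1) i w(2) by (intro feq) (auto simp: n_def)
      then show False using \<tau>(1,3) by (simp add: add.commute add.left_commute)
    qed
    have content: "mset (take q (drop s w)) = mset (take q (drop \<tau> w))" if "i \<le> s" "s \<le> \<tau>" for s
      using that(2,1)
    proof (induction s rule: inc_induct)
      case (step s)
      have "s + q < length w" using step.hyps \<tau>(2) i(2) by (simp add: n_def)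
      then show ?case using mset_factor_shift[of s q w] before[of s] step i(1) by simp
    qed simp
    have content': "mset (take q (drop (Suc \<tau>) w)) \<noteq> mset (take q (drop \<tau> w))"
    proof
      assume eq: "mset (take q (drop (Suc \<tau>) w)) = mset (take q (drop \<tau> w))"
      have "\<tau> + q < length w" using \<tau>(2) i(2) by (simp add: n_def)
      then show False using mset_factor_shift[of \<tau> q w] i(1) \<tau>(3) unfolding eq by simp
    qed
    \<comment> \<open>\<open>A\<close> holds \<open>q\<close> starts in the periodic stretch.
      \<open>B\<close> holds the \<open>d - q\<close> starts up to \<tau> whose factor reaches the
      place \<tau> + \<open>q\<close>, and the start \<tau> + 1. Together these are
      \<open>d + 1\<close> starts.\<close>
    define A where "A = {i..<i + q}"
    define B where "B = {\<tau> + q + 1 - d..<\<tau> + 2}"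
    have "i + q \<le> \<tau> + q + 1 - d" using \<tau>d by simp
    then have "A \<inter> B = {}" unfolding A_def B_def by auto
    then have "card (A \<union> B) = card A + card B" by (intro card_Un_disjoint) (auto simp: A_def B_def)
    also have "\<dots> = d + 1" using \<tau>d i unfolding A_def B_def by simp
    finally have "card (A \<union> B) > d" by simp
    moreover have "A \<union> B \<subseteq> {..n - d}" using \<tau> \<tau>d i unfolding A_def B_def by auto
    ultimately have "\<not> inj_on f (A \<union> B)" using not_inj by blast
    then obtain s s' where ss: "s \<in> A \<union> B" "s' \<in> A \<union> B" "s < s'" "f s = f s'"
      unfolding inj_on_def by (metis nat_neq_iff)
    have si: "i \<le> s" "s' \<le> Suc \<tau>" using ss(1,2) \<tau>d i unfolding A_def B_def by auto
    have sn: "s + d \<le> n" "s' + d \<le> n" using si ss(3) \<tau>(2) by auto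
    \<comment> \<open>Equal factors contradict the minimality of \<open>q\<close> if both start in
      \<open>A\<close>, the content of the first \<open>q\<close> letters if the second starts at
      \<tau> + 1, and otherwise they carry the failure at \<tau> back to a place before
      \<tau>.\<close>
    consider "s' \<in> A" | "s' \<in> B" "s' = Suc \<tau>" | "s' \<in> B" "s' \<le> \<tau>"
      using ss(2) unfolding B_def by force
    then show False
    proof cases
      case 1
      then have "s' < i + q" "i \<le> s" using si by (auto simp: A_def)
      then have "Q (s' - s)" unfolding Q_def using ss(3,4) i(2) by (intro conjI exI[of _ s]) auto
      then show False using q(2)[of "s' - s"] \<open>s' < i + q\<close> \<open>i \<le> s\<close> ss(3) by simp
    next
      case 2
      have "take q (drop s w) = take q (f s)" "take q (drop s' w) = take q (f s')"
        using i(2) by (simp_all add: f_def min_absorb1)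
      then have "take q (drop s w) = take q (drop s' w)" using ss(4) by simp
      then show False using content[of s] content' 2 ss(3) si by simp
    next
      case 3
      have o: "\<tau> + q + 1 \<le> s' + d" using 3(1) by (auto simp: B_def)
      have "w ! (s + (\<tau> - s')) = w ! (s' + (\<tau> - s'))"
        by (rule feq[OF ss(4) sn]) (use o i 3 in auto)
      moreover have "w ! (s + (\<tau> - s' + q)) = w ! (s' + (\<tau> - s' + q))"
        by (rule feq[OF ss(4) sn]) (use o i 3 in auto)
      moreover have "w ! (s + (\<tau> - s')) = w ! (s + (\<tau> - s') + q)"
        by (rule before) (use si ss(3) 3 in auto)
      ultimately show False using \<tau>(3) 3(2) by (simp add: add.assoc)
    qed
  qed
  then show ?thesis using i unfolding n_def by blast
qed

text \<open>The combinatorial half of Bergman's gap theorem. A long word is recovered from its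
  preperiod, its period, a prefix of length \<open>2 * d\<close> and a suffix of length
  \<open>d\<close>, since every letter in between repeats the one \<open>q\<close> places earlier.
  The number of such data does not depend on the length of the word.\<close>

lemma bounded_factorial_language:
  fixes L :: "'b list set"
  assumes factor: "\<And>u v w. u @ v @ w \<in> L \<Longrightarrow> v \<in> L"
    and alphabet: "finite Y" "L \<subseteq> lists Y"
    and few: "card {w \<in> L. length w = d} \<le> d"
  shows "\<exists>C. \<forall>n. card {w \<in> L. length w = n} \<le> C"
proof -
  define W where "W n = {w \<in> L. length w = n}" for n
  have W_sub: "W n \<subseteq> {w. set w \<subseteq> Y \<and> length w = n}" for n
    using alphabet(2) by (auto simp: W_def lists_eq_set)
  have finW: "finite (W n)" for n
    by (rule finite_subset[OF W_sub finite_lists_length_eq[OF alphabet(1)]])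
  define D where "D = {..d} \<times> {..d} \<times> W (2 * d) \<times> W d"
  have "finite D" by (auto simp: D_def finW)
  have big: "card (W n) \<le> card D" if n: "2 * d \<le> n" for n
  proof -
    have "\<exists>i q. 0 < q \<and> i + q \<le> d \<and> (\<forall>t\<ge>i. t + d < n \<longrightarrow> w ! t = w ! (t + q))" if "w \<in> W n" for w
      using eventually_periodic_words[of L d w, OF factor] that n few finW[of d]
      by (auto simp: W_def)
    then obtain i q where iq: "\<And>w. w \<in> W n \<Longrightarrow> 0 < q w \<and> i w + q w \<le> d \<and>
        (\<forall>t\<ge>i w. t + d < n \<longrightarrow> w ! t = w ! (t + q w))" by metis
    define h where "h w = (i w, q w, take (2 * d) w, drop (n - d) w)" for w
    have "h w \<in> D" if "w \<in> W n" for w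
    proof -
      have w: "w \<in> L" "length w = n" using that by (auto simp: W_def)
      have "take (2 * d) w \<in> L" using factor[of "[]" "take (2 * d) w" "drop (2 * d) w"] w by simp
      moreover have "drop (n - d) w \<in> L" using factor[of "take (n - d) w" "drop (n - d) w" "[]"] w by simp
      ultimately show ?thesis using iq[OF that] w n by (auto simp: h_def D_def W_def)
    qed
    moreover have "inj_on h (W n)"
    proof (rule inj_onI)
      fix w w' assume ww: "w \<in> W n" "w' \<in> W n" and eq: "h w = h w'"
      have len: "length w = n" "length w' = n" using ww by (auto simp: W_def)
      have "w ! t = w' ! t" if "t < n" for t
        using that
      proof (induction t rule: less_induct)
        case (less t)
        have e: "i w' = i w" "q w' = q w" "take (2 * d) w = take (2 * d) w'" "drop (n - d) w = drop (n - d) w'"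
          using eq by (auto simp: h_def)
        consider "t < 2 * d" | "n - d \<le> t" | "2 * d \<le> t" "t < n - d" by linarith
        then show ?case
        proof cases
          case 1 then show ?thesis using e(3) by (metis nth_take)
        next
          case 2
          have "drop (n - d) w ! (t - (n - d)) = drop (n - d) w' ! (t - (n - d))" using e(4) by simp
          then show ?thesis using 2 less.prems len by simp
        next
          case 3
          have p: "0 < q w" "i w + q w \<le> d" using iq[OF ww(1)] by auto
          have "i w \<le> t - q w" "t - q w + d < n" "q w \<le> t" using p 3 by auto
          then have "w ! t = w ! (t - q w)" "w' ! t = w' ! (t - q w)"
            using iq[OF ww(1)] iq[OF ww(2)] unfolding e(1,2) by (metis le_add_diff_inverse2)+
          then show ?thesis using less.IH[of "t - q w"] p 3 by simp
        qed
      qed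
      then show "w = w'" using len by (intro nth_equalityI) auto
    qed
    ultimately show ?thesis using \<open>finite D\<close> by (intro card_inj_on_le) auto
  qed
  \<comment> \<open>Lengths below \<open>2 * d\<close> are finitely many and only enlarge the
    constant.\<close>
  have "card (W n) \<le> card D + (\<Sum>m<2 * d. card (W m))" for n
  proof (cases "2 * d \<le> n")
    case False
    then have "card (W n) \<le> (\<Sum>m<2 * d. card (W m))"
      using member_le_sum[of n "{..<2 * d}" "\<lambda>m. card (W m)"] by simp
    then show ?thesis by simp
  qed (use big[of n] in simp)
  then show ?thesis unfolding W_def by blast
qed

section \<open>The length-lexicographic order on words\<close>

lemma lenlex_append_mono:
  fixes u v p s :: "nat list"
  assumes "u < v" shows "p @ u @ s < p @ v @ s"
  using assms lenlex_append1[of u v "{(u, v). u < v}" s s] by (simp add: list_less_def irrefl_def)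

lemma lenlex_length_le: "(u :: nat list) \<le> v \<Longrightarrow> length u \<le> length v"
  using lenlex_length[of u v "{(u, v). u < v}"] by (auto simp: list_le_def list_less_def)

context central_subfield
begin

section \<open>Values of words and normal words modulo an ideal\<close>

definition word_val :: "(nat \<Rightarrow> 'a) \<Rightarrow> nat list \<Rightarrow> 'a"
  where "word_val g w = list_prod R (map g w)"

lemma list_prod_simps [simp]: "list_prod R [] = \<one>" "list_prod R (a # as) = a \<otimes> list_prod R as"
  by (simp_all add: list_prod_def)

lemma list_prod_closed: "set as \<subseteq> carrier R \<Longrightarrow> list_prod R as \<in> carrier R"
  by (induction as) auto

lemma list_prod_append:
  "set as \<subseteq> carrier R \<Longrightarrow> set bs \<subseteq> carrier R \<Longrightarrow> list_prod R (as @ bs) = list_prod R as \<otimes> list_prod R bs"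
  by (induction as) (auto simp: list_prod_closed m_assoc)

lemma word_val_closed: "g ` {..<l} \<subseteq> carrier R \<Longrightarrow> w \<in> lists {..<l} \<Longrightarrow> word_val g w \<in> carrier R"
  unfolding word_val_def by (intro list_prod_closed) auto

lemma word_val_append:
  "g ` {..<l} \<subseteq> carrier R \<Longrightarrow> u \<in> lists {..<l} \<Longrightarrow> v \<in> lists {..<l} \<Longrightarrow>
    word_val g (u @ v) = word_val g u \<otimes> word_val g v"
  unfolding word_val_def map_append by (intro list_prod_append) auto

text \<open>Centrality of \<open>F\<close> lets scalars pass through \<open>a\<close>, so
  multiplication from both sides is linear.\<close>

lemma subspace_vimage:
  assumes "subspace Z" "a \<in> carrier R" "b \<in> carrier R"
  shows "subspace {y \<in> carrier R. a \<otimes> y \<otimes> b \<in> Z}"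
proof (intro subspaceI)
  fix c y assume c: "c \<in> F" and y: "y \<in> {y \<in> carrier R. a \<otimes> y \<otimes> b \<in> Z}"
  have "a \<otimes> (c \<otimes> y) \<otimes> b = c \<otimes> (a \<otimes> y \<otimes> b)"
    using assms c y F_carrier[OF c] F_central[OF c assms(2)] by (simp flip: m_assoc)
  then show "c \<otimes> y \<in> {y \<in> carrier R. a \<otimes> y \<otimes> b \<in> Z}"
    using assms c y F_carrier[OF c] subspaceD(5)[OF assms(1)] by simp
next
  fix y z assume "y \<in> {y \<in> carrier R. a \<otimes> y \<otimes> b \<in> Z}" "z \<in> {y \<in> carrier R. a \<otimes> y \<otimes> b \<in> Z}"
  then show "y \<oplus> z \<in> {y \<in> carrier R. a \<otimes> y \<otimes> b \<in> Z}"
    using assms subspaceD(4)[OF assms(1)] by (simp add: r_distr l_distr)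
qed (use assms subspaceD(3)[OF assms(1)] in auto)

lemma subspace_rvimage: "subspace Z \<Longrightarrow> b \<in> carrier R \<Longrightarrow> subspace {y \<in> carrier R. y \<otimes> b \<in> Z}"
  using subspace_vimage[of Z \<one> b] by (simp cong: conj_cong)

lemma subspace_lvimage: "subspace Z \<Longrightarrow> a \<in> carrier R \<Longrightarrow> subspace {y \<in> carrier R. a \<otimes> y \<in> Z}"
  using subspace_vimage[of Z a \<one>] by (simp cong: conj_cong)

lemma subspace_left_ideal: "left_ideal R I \<Longrightarrow> subspace I"
proof -
  assume I: "left_ideal R I"
  then interpret additive_subgroup I R by (simp add: left_ideal_def)
  show "subspace I" using I F_carrier by (intro subspaceI) (auto simp: left_ideal_def)
qed

lemma left_ideal_ideal: "ideal I R \<Longrightarrow> left_ideal R I"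
  using ideal.I_l_closed[of I R] unfolding left_ideal_def by (auto simp: ideal.axioms)

lemma subspace_ideal: "ideal I R \<Longrightarrow> subspace I"
  by (intro subspace_left_ideal left_ideal_ideal)

text \<open>Normal words in the sense of Groebner bases: no reduction modulo \<open>I\<close> to
  smaller words exists. Their values form a basis, modulo \<open>I\<close>, of the span of all word
  values.\<close>

definition normal :: "(nat \<Rightarrow> 'a) \<Rightarrow> nat \<Rightarrow> 'a set \<Rightarrow> nat list \<Rightarrow> bool"
  where "normal g l I w \<longleftrightarrow> w \<in> lists {..<l} \<and>
    word_val g w \<notin> spn (word_val g ` {w' \<in> lists {..<l}. w' < w} \<union> I)"

text \<open>A reduction of \<open>w\<close> to smaller words, multiplied by \<open>u\<close> and
  \<open>v\<close>, reduces \<open>u @ w @ v\<close>: the order is compatible with concatenation and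
  \<open>I\<close> is two-sided. So the normal words form a language closed under factors.\<close>

lemma normal_factor:
  assumes g: "g ` {..<l} \<subseteq> carrier R" and I: "ideal I R" and n: "normal g l I (u @ w @ v)"
  shows "normal g l I w"
proof -
  let ?A = "\<lambda>w. word_val g ` {w' \<in> lists {..<l}. w' < w} \<union> I"
  have l: "u \<in> lists {..<l}" "w \<in> lists {..<l}" "v \<in> lists {..<l}" using n by (auto simp: normal_def)
  note wv = word_val_closed[OF g]
  have Ic: "I \<subseteq> carrier R" using subspaceD(1)[OF subspace_ideal[OF I]] .
  have Ac: "?A w \<subseteq> carrier R" for w using Ic wv by auto
  have val: "word_val g (u @ w' @ v) = word_val g u \<otimes> word_val g w' \<otimes> word_val g v" if "w' \<in> lists {..<l}" for w'
    using l that wv by (simp add: word_val_append[OF g] m_assoc)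
  have False if "word_val g w \<in> spn (?A w)"
  proof -
    let ?Q = "{y \<in> carrier R. word_val g u \<otimes> y \<otimes> word_val g v \<in> spn (?A (u @ w @ v))}"
    have "spn (?A w) \<subseteq> ?Q"
    proof (rule spn_min)
      show "subspace ?Q" by (rule subspace_vimage[OF subspace_spn[OF Ac] wv[OF l(1)] wv[OF l(3)]])
      show "?A w \<subseteq> ?Q"
      proof
        fix y assume "y \<in> ?A w"
        then consider w' where "w' \<in> lists {..<l}" "w' < w" "y = word_val g w'" | "y \<in> I" by blast
        then show "y \<in> ?Q"
        proof cases
          case 1
          then have "word_val g (u @ w' @ v) \<in> spn (?A (u @ w @ v))"
            using l lenlex_append_mono[of w' w u v] by (intro spn_base) auto
          then show ?thesis using 1 val wv by simp
        next
          case 2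
          then have "word_val g u \<otimes> y \<otimes> word_val g v \<in> I"
            using wv l by (intro ideal.I_r_closed[OF I] ideal.I_l_closed[OF I]) auto
          then show ?thesis using 2 Ic by (auto intro!: spn_base)
        qed
      qed
    qed
    then have "word_val g (u @ w @ v) \<in> spn (?A (u @ w @ v))" using that val[OF l(2)] by auto
    then show False using n by (simp add: normal_def)
  qed
  then show ?thesis using l(2) by (auto simp: normal_def)
qed

text \<open>Rewriting terminates because the length-lexicographic order is a well-order. Since
  smaller words are not longer, normal words of length at most \<open>n\<close> suffice for all
  words of length at most \<open>n\<close>.\<close>

lemma normal_spanning:
  assumes g: "g ` {..<l} \<subseteq> carrier R" and I: "I \<subseteq> carrier R" and w: "w \<in> lists {..<l}"
  shows "word_val g w \<in> spn (word_val g ` {w'. normal g l I w' \<and> w' \<le> w} \<union> I)"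
  using w
proof (induction w rule: less_induct)
  case (less w)
  let ?B = "\<lambda>w. word_val g ` {w'. normal g l I w' \<and> w' \<le> w} \<union> I"
  have Bc: "?B w \<subseteq> carrier R" using I word_val_closed[OF g] by (auto simp: normal_def)
  show ?case
  proof (cases "normal g l I w")
    case True
    then show ?thesis by (intro spn_base) auto
  next
    case False
    then have "word_val g w \<in> spn (word_val g ` {w' \<in> lists {..<l}. w' < w} \<union> I)"
      using less.prems by (simp add: normal_def)
    also have "\<dots> \<subseteq> spn (?B w)"
    proof (intro spn_subset_spn Bc Un_least subsetI)
      fix y assume "y \<in> word_val g ` {w' \<in> lists {..<l}. w' < w}"
      then obtain w' where w': "w' \<in> lists {..<l}" "w' < w" "y = word_val g w'" by blast
      then have "y \<in> spn (?B w')" using less.IH by blast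
      moreover have "?B w' \<subseteq> ?B w" using w'(2) by auto
      ultimately show "y \<in> spn (?B w)" using spn_mono by blast
    qed (auto intro: spn_base)
    finally show ?thesis .
  qed
qed

lemma power_sum_space_word_val:
  "power_sum_space R F (g ` {..<l}) n = spn (word_val g ` {w \<in> lists {..<l}. length w \<le> n})"
proof -
  have "{list_prod R ws |ws. set ws \<subseteq> g ` {..<l} \<and> length ws \<le> n} =
      word_val g ` {w \<in> lists {..<l}. length w \<le> n}"
  proof (intro equalityI subsetI)
    fix y assume "y \<in> {list_prod R ws |ws. set ws \<subseteq> g ` {..<l} \<and> length ws \<le> n}"
    then obtain ws where ws: "y = list_prod R ws" "ws \<in> lists (g ` {..<l})" "length ws \<le> n"
      by (auto simp: lists_eq_set)
    then obtain w where "w \<in> lists {..<l}" "ws = map g w" unfolding lists_image by blast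
    then show "y \<in> word_val g ` {w \<in> lists {..<l}. length w \<le> n}" using ws by (auto simp: word_val_def)
  next
    fix y assume "y \<in> word_val g ` {w \<in> lists {..<l}. length w \<le> n}"
    then obtain w where "y = list_prod R (map g w)" "w \<in> lists {..<l}" "length w \<le> n" by (auto simp: word_val_def)
    then show "y \<in> {list_prod R ws |ws. set ws \<subseteq> g ` {..<l} \<and> length ws \<le> n}"
      by (intro CollectI exI[of _ "map g w"]) auto
  qed
  then show ?thesis by (simp add: power_sum_space_def)
qed

text \<open>Growth of the image of \<open>Y\<close> in \<open>R/I\<close>, expressed by spanning
  sets lifted to \<open>R\<close>. The factor \<open>n + 1\<close> accommodates
  \<open>n = 0\<close>.\<close>

definition linear_growth :: "'a set \<Rightarrow> 'a set \<Rightarrow> nat \<Rightarrow> bool"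
  where "linear_growth Y I C \<longleftrightarrow> (\<forall>n. \<exists>T. finite T \<and> T \<subseteq> carrier R \<and> card T \<le> C * (n + 1) \<and>
    power_sum_space R F Y n \<subseteq> spn (T \<union> I))"

lemma finite_normal: "finite {w. normal g l I w \<and> length w = n}" "finite {w. normal g l I w \<and> length w \<le> n}"
proof -
  show *: "finite {w. normal g l I w \<and> length w \<le> n}"
    by (rule finite_subset[OF _ finite_lists_length_le[of "{..<l}" n]]) (auto simp: normal_def)
  show "finite {w. normal g l I w \<and> length w = n}"
    by (rule finite_subset[OF _ *]) auto
qed

text \<open>Bergman's gap for \<open>R/I\<close>: at most \<open>d\<close> normal words of one
  length \<open>d\<close> bound their number in every length, and summation over the lengths up to
  \<open>n\<close> gives the factor \<open>n + 1\<close>.\<close>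

lemma normal_linear_growth:
  assumes g: "g ` {..<l} \<subseteq> carrier R" and I: "ideal I R"
    and few: "card {w. normal g l I w \<and> length w = d} \<le> d"
  obtains C where "linear_growth (g ` {..<l}) I C"
proof -
  have Ic: "I \<subseteq> carrier R" using subspaceD(1)[OF subspace_ideal[OF I]] .
  have "\<exists>C. \<forall>n. card {w \<in> Collect (normal g l I). length w = n} \<le> C"
  proof (rule bounded_factorial_language[where Y = "{..<l}" and d = d])
    show "v \<in> Collect (normal g l I)" if "u @ v @ w \<in> Collect (normal g l I)" for u v w
      using normal_factor[OF g I, of u v w] that by simp
    show "Collect (normal g l I) \<subseteq> lists {..<l}" unfolding normal_def by blast
  qed (use few in auto)
  then obtain C where C: "\<And>n. card {w. normal g l I w \<and> length w = n} \<le> C" by auto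
  have "linear_growth (g ` {..<l}) I C"
    unfolding linear_growth_def
  proof (intro allI exI conjI)
    fix n
    let ?N = "{w. normal g l I w \<and> length w \<le> n}"
    show "finite (word_val g ` ?N)" by (intro finite_imageI finite_normal)
    show "word_val g ` ?N \<subseteq> carrier R" using word_val_closed[OF g] by (auto simp: normal_def)
    have "card (word_val g ` ?N) \<le> card ?N" by (intro card_image_le finite_normal)
    also have "card ?N = card (\<Union>m\<in>{..n}. {w. normal g l I w \<and> length w = m})"
      by (rule arg_cong[of _ _ card]) auto
    also have "\<dots> \<le> (\<Sum>m\<in>{..n}. card {w. normal g l I w \<and> length w = m})"
      by (intro card_UN_le) auto
    also have "\<dots> \<le> (\<Sum>m\<in>{..n}. C)" by (intro sum_mono C)
    finally show "card (word_val g ` ?N) \<le> C * (n + 1)" by (simp add: mult.commute)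
    show "power_sum_space R F (g ` {..<l}) n \<subseteq> spn (word_val g ` ?N \<union> I)"
      unfolding power_sum_space_word_val
    proof (intro spn_subset_spn image_subsetI)
      fix w assume w: "w \<in> {w \<in> lists {..<l}. length w \<le> n}"
      then have "word_val g w \<in> spn (word_val g ` {w'. normal g l I w' \<and> w' \<le> w} \<union> I)"
        by (intro normal_spanning[OF g Ic]) auto
      moreover have "{w'. normal g l I w' \<and> w' \<le> w} \<subseteq> ?N" using lenlex_length_le w by fastforce
      ultimately show "word_val g w \<in> spn (word_val g ` ?N \<union> I)"
        using spn_mono[of "word_val g ` {w'. normal g l I w' \<and> w' \<le> w} \<union> I" "word_val g ` ?N \<union> I"] by blast
    qed (use Ic word_val_closed[OF g] in \<open>auto simp: normal_def\<close>)
  qed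
  then show thesis using that by blast
qed

end

section \<open>Growth and finite codimension\<close>

context central_subfield
begin

abbreviation pss :: "'a set \<Rightarrow> nat \<Rightarrow> 'a set" where "pss \<equiv> power_sum_space R F"

section \<open>The filtration by word length\<close>

lemma subspace_rmult_image:
  assumes "subspace V" "a \<in> carrier R"
  shows "subspace ((\<lambda>y. y \<otimes> a) ` V)"
proof (intro subspaceI)
  note V = subspaceD[OF assms(1)]
  show "\<zero> \<in> (\<lambda>y. y \<otimes> a) ` V" using V(3) assms(2) by (metis image_eqI l_null)
  fix y z assume "y \<in> (\<lambda>y. y \<otimes> a) ` V" "z \<in> (\<lambda>y. y \<otimes> a) ` V"
  then obtain y' z' where "y' \<in> V" "z' \<in> V" "y = y' \<otimes> a" "z = z' \<otimes> a" by blast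
  then show "y \<oplus> z \<in> (\<lambda>y. y \<otimes> a) ` V"
    using V(2,4) assms(2) by (intro image_eqI[of _ _ "y' \<oplus> z'"]) (auto simp: l_distr)
next
  note V = subspaceD[OF assms(1)]
  fix c y assume "c \<in> F" "y \<in> (\<lambda>y. y \<otimes> a) ` V"
  then obtain y' where "y' \<in> V" "y = y' \<otimes> a" by blast
  then show "c \<otimes> y \<in> (\<lambda>y. y \<otimes> a) ` V"
    using V(2,5) assms(2) \<open>c \<in> F\<close> F_carrier by (intro image_eqI[of _ _ "c \<otimes> y'"]) (auto simp: m_assoc)
qed (use subspaceD(2)[OF assms(1)] assms(2) in auto)

lemma pss_generators_closed:
  "Y \<subseteq> carrier R \<Longrightarrow> {list_prod R ws |ws. set ws \<subseteq> Y \<and> length ws \<le> n} \<subseteq> carrier R"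
  using list_prod_closed by auto

lemma subspace_pss: "Y \<subseteq> carrier R \<Longrightarrow> subspace (pss Y n)"
  unfolding power_sum_space_def by (intro subspace_spn pss_generators_closed)

lemma pss_closed: "Y \<subseteq> carrier R \<Longrightarrow> pss Y n \<subseteq> carrier R"
  using subspaceD(1)[OF subspace_pss] .

lemma pss_mono: "m \<le> n \<Longrightarrow> Z \<subseteq> Y \<Longrightarrow> pss Z m \<subseteq> pss Y n"
  unfolding power_sum_space_def by (intro spn_mono) (blast intro: le_trans order_trans)

lemma list_prod_in_pss: "set ws \<subseteq> Y \<Longrightarrow> length ws \<le> n \<Longrightarrow> list_prod R ws \<in> pss Y n"
  unfolding power_sum_space_def by (intro spn_base) auto

lemma one_in_pss: "\<one> \<in> pss Y n"
  using list_prod_in_pss[of "[]" Y n] by simp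

lemma generator_in_pss: "Y \<subseteq> carrier R \<Longrightarrow> y \<in> Y \<Longrightarrow> n > 0 \<Longrightarrow> y \<in> pss Y n"
  using list_prod_in_pss[of "[y]" Y n] by auto

lemma pss_mult:
  assumes Y: "Y \<subseteq> carrier R" and a: "a \<in> pss Y m" and b: "b \<in> pss Y n"
  shows "a \<otimes> b \<in> pss Y (m + n)"
proof -
  let ?G = "\<lambda>n. {list_prod R ws |ws. set ws \<subseteq> Y \<and> length ws \<le> n}"
  note S = subspace_pss[OF Y]
  have *: "list_prod R ws \<otimes> b \<in> pss Y (m + n)" if ws: "set ws \<subseteq> Y" "length ws \<le> m" for ws
  proof -
    have "spn (?G n) \<subseteq> {y \<in> carrier R. list_prod R ws \<otimes> y \<in> pss Y (m + n)}"
    proof (intro spn_min subspace_lvimage S list_prod_closed subsetI)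
      fix y assume "y \<in> ?G n"
      then obtain vs where vs: "y = list_prod R vs" "set vs \<subseteq> Y" "length vs \<le> n" by blast
      then have "list_prod R (ws @ vs) \<in> pss Y (m + n)" using ws by (intro list_prod_in_pss) auto
      then show "y \<in> {y \<in> carrier R. list_prod R ws \<otimes> y \<in> pss Y (m + n)}"
        using vs ws Y by (auto simp: list_prod_append list_prod_closed)
    qed (use ws Y in auto)
    then show ?thesis using b unfolding power_sum_space_def by blast
  qed
  have bc: "b \<in> carrier R" using b pss_closed[OF Y] by blast
  have "spn (?G m) \<subseteq> {y \<in> carrier R. y \<otimes> b \<in> pss Y (m + n)}"
  proof (intro spn_min subspace_rvimage S bc subsetI)
    fix y assume "y \<in> ?G m"
    then show "y \<in> {y \<in> carrier R. y \<otimes> b \<in> pss Y (m + n)}"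
      using * pss_generators_closed[OF Y, of m] by blast
  qed
  then show ?thesis using a unfolding power_sum_space_def by blast
qed

lemma pss_finite_spanning:
  assumes "finite Y" "Y \<subseteq> carrier R"
  obtains T where "finite T" "T \<subseteq> carrier R" "pss Y n = spn T"
proof
  have "{list_prod R ws |ws. set ws \<subseteq> Y \<and> length ws \<le> n} = list_prod R ` {ws. set ws \<subseteq> Y \<and> length ws \<le> n}"
    by auto
  then show "finite {list_prod R ws |ws. set ws \<subseteq> Y \<and> length ws \<le> n}"
    using finite_lists_length_le[OF assms(1)] by simp
  show "{list_prod R ws |ws. set ws \<subseteq> Y \<and> length ws \<le> n} \<subseteq> carrier R"
    by (rule pss_generators_closed[OF assms(2)])
qed (simp add: power_sum_space_def)

section \<open>Growth of R against growth of R/I\<close>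

definition subcubic :: "'a set \<Rightarrow> bool"
  where "subcubic Y \<longleftrightarrow> (\<exists>r<3. \<exists>n0. \<forall>n\<ge>n0. \<exists>T. finite T \<and> T \<subseteq> carrier R \<and>
    real (card T) \<le> real n powr r \<and> pss Y n \<subseteq> spn T)"

lemma pow_left_regular:
  assumes "c \<in> carrier R" "\<And>r. r \<in> carrier R \<Longrightarrow> r \<otimes> c = \<zero> \<Longrightarrow> r = \<zero>"
    and "r \<in> carrier R" "r \<otimes> c [^] (k::nat) = \<zero>"
  shows "r = \<zero>"
  using assms(3,4)
proof (induction k)
  case (Suc k)
  have "(r \<otimes> c [^] k) \<otimes> c = \<zero>" using Suc.prems assms(1) by (simp add: m_assoc)
  then have "r \<otimes> c [^] k = \<zero>" using assms(2)[of "r \<otimes> c [^] k"] Suc.prems assms(1) by simp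
  then show ?case using Suc by blast
qed simp

text \<open>If \<open>c \<in> I\<close> is left regular and the words \<open>w\<close> are independent modulo \<open>I\<close>, then the
  products \<open>w c\<^sup>k\<close> are independent, so passing to \<open>R/I\<close> lowers the growth exponent by one.\<close>

lemma few_normal_words:
  assumes g: "g ` {..<l} \<subseteq> carrier R" and I: "ideal I R" and c: "c \<in> I"
    and reg: "\<And>r. r \<in> carrier R \<Longrightarrow> r \<otimes> c = \<zero> \<Longrightarrow> r = \<zero>"
    and sub: "subcubic (insert c (g ` {..<l}))"
  obtains d where "card {w. normal g l I w \<and> length w = d} \<le> d"
proof (rule ccontr)
  assume "\<not> thesis"
  \<comment> \<open>If the gap never occurs, there are quadratically many normal words up to length
    \<open>n\<close>; multiplied by \<open>n\<close> powers of \<open>c\<close> they force cubic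
    growth of \<open>R\<close>.\<close>
  then have many: "d + 1 \<le> card {w. normal g l I w \<and> length w = d}" for d using that[of d] by force
  let ?Y = "insert c (g ` {..<l})"
  have Ic: "I \<subseteq> carrier R" using subspaceD(1)[OF subspace_ideal[OF I]] .
  have cc: "c \<in> carrier R" using c Ic by blast
  obtain r n0 where r: "r < 3" "\<And>n. n \<ge> n0 \<Longrightarrow> \<exists>T. finite T \<and> T \<subseteq> carrier R \<and>
    real (card T) \<le> real n powr r \<and> pss ?Y n \<subseteq> spn T"
    using sub unfolding subcubic_def by metis
  have bound: "real (n * (n * n)) \<le> 2 * real (2 * n) powr r" if n: "n0 \<le> 2 * n" for n
  proof -
    obtain T where T: "finite T" "T \<subseteq> carrier R" "real (card T) \<le> real (2 * n) powr r"
      "pss ?Y (2 * n) \<subseteq> spn T" using r(2)[OF n] by blast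
    define N where "N = {w. normal g l I w \<and> length w \<le> n}"
    define ws where "ws = sorted_list_of_set N"
    have "finite N" unfolding N_def by (rule finite_normal)
    then have ws: "set ws = N" "length ws = card N" "sorted_wrt (<) ws" by (auto simp: ws_def)
    have wsN: "ws ! j \<in> N" if "j < card N" for j using that ws by (metis nth_mem)
    have val: "word_val g w \<in> carrier R" if "w \<in> lists {..<l}" for w using word_val_closed[OF g that] .
    have wsl: "ws ! j \<in> lists {..<l}" if "j < card N" for j using wsN[OF that] by (auto simp: N_def normal_def)
    have "n * card N \<le> card T"
    \<comment> \<open>The exponent \<open>n - i\<close> runs down from \<open>n\<close> to 1, so
      that earlier elements carry more factors \<open>c \<in> I\<close>. Words of length at most
      \<open>n\<close> times these powers have length at most \<open>2 * n\<close>.\<close>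
    proof (rule triangular_bound2[of T "{\<zero>}" n "card N" "\<lambda>i j. word_val g (ws ! j) \<otimes> c [^] (n - i)"])
      fix i j assume ij: "i < n" "j < card N"
      have "list_prod R (replicate k c) = c [^] k" for k
        using cc nat_pow_Suc2[OF cc] by (induction k) auto
      then have "word_val g (ws ! j) \<otimes> c [^] (n - i) = list_prod R (map g (ws ! j) @ replicate (n - i) c)"
        using wsl[OF ij(2)] cc g by (subst list_prod_append) (auto simp: word_val_def)
      also have "\<dots> \<in> pss ?Y (2 * n)"
        using wsN[OF ij(2)] wsl[OF ij(2)] by (intro list_prod_in_pss) (auto simp: N_def)
      finally show "word_val g (ws ! j) \<otimes> c [^] (n - i) \<in> spn (T \<union> {\<zero>})"
        using T(4) spn_mono[of T "T \<union> {\<zero>}"] by blast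
      define A where "A = word_val g ` {w' \<in> lists {..<l}. w' < ws ! j} \<union> I"
      have V: "subspace (spn A)" unfolding A_def using Ic val by (intro subspace_spn) auto
      \<comment> \<open>An element of an earlier row is \<open>y \<otimes> c [^] (n - i)\<close>
        with \<open>y \<in> I\<close>, because its surplus factors \<open>c\<close> put
        \<open>y\<close> into \<open>I\<close>. Left regularity cancels the common power and leads
        back to the normality of \<open>ws ! j\<close>.\<close>
      define Z where "Z = (\<lambda>y. y \<otimes> c [^] (n - i)) ` spn A"
      have sZ: "subspace Z" unfolding Z_def by (rule subspace_rmult_image[OF V]) (use cc in auto)
      have "word_val g (ws ! j') \<otimes> c [^] (n - i') \<in> Z" if "i' < i" "j' < card N" for i' j'
      proof -
        obtain k where k: "n - i' = k + 1 + (n - i)" "k = i - i' - 1" using \<open>i' < i\<close> ij(1) by simp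
        have "word_val g (ws ! j') \<otimes> c [^] k \<otimes> c \<in> I"
          using wsl[OF that(2)] val cc by (intro ideal.I_l_closed[OF I c]) auto
        then have "word_val g (ws ! j') \<otimes> c [^] k \<otimes> c \<in> spn A" by (intro spn_base) (auto simp: A_def)
        moreover have "word_val g (ws ! j') \<otimes> c [^] (n - i') =
            word_val g (ws ! j') \<otimes> c [^] k \<otimes> c \<otimes> c [^] (n - i)"
        proof -
          have "c [^] (n - i') = c [^] k \<otimes> c \<otimes> c [^] (n - i)"
            unfolding k(1) using nat_pow_mult[OF cc, of "k + 1" "n - i"] by simp
          then show ?thesis using wsl[OF that(2)] val cc by (simp add: m_assoc)
        qed
        ultimately show ?thesis unfolding Z_def by blast
      qed
      moreover have "word_val g (ws ! j') \<otimes> c [^] (n - i) \<in> Z" if "j' < j" for j'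
      proof -
        have "ws ! j' < ws ! j" using sorted_wrt_nth_less[OF ws(3) that] ws(2) ij by simp
        then have "word_val g (ws ! j') \<in> A" using wsl[of j'] that ij by (auto simp: A_def)
        then show ?thesis unfolding Z_def using spn_base by blast
      qed
      moreover have "word_val g (ws ! j) \<otimes> c [^] (n - i) \<notin> Z"
      proof
        assume "word_val g (ws ! j) \<otimes> c [^] (n - i) \<in> Z"
        then obtain y where y: "y \<in> spn A" "word_val g (ws ! j) \<otimes> c [^] (n - i) = y \<otimes> c [^] (n - i)"
          unfolding Z_def by blast
        have yc: "y \<in> carrier R" using y(1) subspaceD(2)[OF V] by blast
        have "(word_val g (ws ! j) \<ominus> y) \<otimes> c [^] (n - i) = \<zero>"
          using y(2) yc val[OF wsl[OF ij(2)]] cc by (simp add: minus_eq l_distr l_minus r_neg)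
        then have "word_val g (ws ! j) \<ominus> y = \<zero>"
          using pow_left_regular[OF cc reg] yc val[OF wsl[OF ij(2)]] by blast
        then have "word_val g (ws ! j) = y" using yc val[OF wsl[OF ij(2)]] by simp
        then show False using y(1) wsN[OF ij(2)] by (auto simp: N_def normal_def A_def)
      qed
      ultimately show "\<exists>Z. subspace Z \<and> {\<zero>} \<subseteq> Z \<and>
          (\<forall>i'<i. \<forall>j'<card N. word_val g (ws ! j') \<otimes> c [^] (n - i') \<in> Z) \<and>
          (\<forall>j'<j. word_val g (ws ! j') \<otimes> c [^] (n - i) \<in> Z) \<and>
          word_val g (ws ! j) \<otimes> c [^] (n - i) \<notin> Z"
        using sZ subspaceD(3)[OF sZ] by blast
    qed (use T in auto)
    moreover have "n * n \<le> 2 * card N"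
    proof -
      have "N = (\<Union>m\<in>{..n}. {w. normal g l I w \<and> length w = m})" by (auto simp: N_def)
      then have "card N = card (\<Union>m\<in>{..n}. {w. normal g l I w \<and> length w = m})" by simp
      also have "\<dots> = (\<Sum>m\<in>{..n}. card {w. normal g l I w \<and> length w = m})"
        by (intro card_UN_disjoint) (auto simp: finite_normal)
      also have "\<dots> \<ge> (\<Sum>m\<in>{..n}. m + 1)" by (intro sum_mono many)
      finally have "card N \<ge> (\<Sum>m\<in>{..n}. m + 1)" .
      moreover have "2 * (\<Sum>m\<in>{..n}. m + 1) \<ge> n * n" by (induction n) auto
      ultimately show ?thesis by linarith
    qed
    ultimately have "n * (n * n) \<le> 2 * card T"
    proof -
      have "n * (n * n) \<le> n * (2 * card N)" using \<open>n * n \<le> 2 * card N\<close> by (rule mult_le_mono2)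
      also have "\<dots> = 2 * (n * card N)" by simp
      also have "\<dots> \<le> 2 * card T" using \<open>n * card N \<le> card T\<close> by (rule mult_le_mono2)
      finally show ?thesis .
    qed
    then have "real (n * (n * n)) \<le> 2 * real (card T)" by linarith
    then show ?thesis using T(3) by linarith
  qed
  \<comment> \<open>Any \<open>n > a\<close> has \<open>n powr (3 - r) > 2 * 2 powr r\<close>,
    against \<open>bound\<close>. The positive gap \<open>3 - r\<close> is why the exponent in
    \<open>subcubic\<close> is strictly below 3 instead of merely approaching it.\<close>
  define a where "a = (2 * 2 powr r) powr (1 / (3 - r))"
  obtain n1 where n1: "a < real n1" using reals_Archimedean2 by blast
  define n where "n = max 1 (max n0 n1)"
  have n: "n \<ge> 1" "n0 \<le> 2 * n" "a < real n" using n1 by (auto simp: n_def)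
  have "2 * 2 powr r = a powr (3 - r)" using r(1) by (simp add: a_def powr_powr)
  also have "\<dots> < real n powr (3 - r)" using r(1) n(3) by (intro powr_less_mono2) (auto simp: a_def)
  finally have n2: "2 * 2 powr r < real n powr (3 - r)" .
  have "real (n * (n * n)) = real n powr 3"
    using n(1) by (simp add: powr_realpow[of _ 3, simplified] power3_eq_cube)
  also have "\<dots> = real n powr (3 - r) * real n powr r" by (simp add: powr_add[symmetric])
  finally have "real n powr (3 - r) * real n powr r \<le> 2 * 2 powr r * real n powr r"
    using bound[OF n(2)] by (simp add: powr_mult)
  moreover have "real n powr r > 0" using n(1) by simp
  ultimately have "real n powr (3 - r) \<le> 2 * 2 powr r" by (simp del: powr_gt_zero)
  then show False using n2 by simp
qed

lemma linear_growth_modulo: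
  assumes Y: "finite Y" "Y \<subseteq> carrier R" and I: "ideal I R" and c: "c \<in> I"
    and reg: "\<And>r. r \<in> carrier R \<Longrightarrow> r \<otimes> c = \<zero> \<Longrightarrow> r = \<zero>"
    and sub: "subcubic (insert c Y)"
  obtains C where "linear_growth Y I C"
proof -
  obtain g :: "nat \<Rightarrow> 'a" where "bij_betw g {..<card Y} Y"
    using ex_bij_betw_nat_finite[OF Y(1)] by (auto simp: atLeast0LessThan)
  then have g: "g ` {..<card Y} = Y" by (simp add: bij_betw_def)
  obtain d where "card {w. normal g (card Y) I w \<and> length w = d} \<le> d"
    by (rule few_normal_words[of g "card Y" I c]) (use assms g in auto)
  then show thesis using normal_linear_growth[of g "card Y" I d] that g Y(2) I by auto
qed

section \<open>Finite codimension\<close>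

definition fincod :: "'a set \<Rightarrow> bool"
  where "fincod J \<longleftrightarrow> (\<exists>T. finite T \<and> T \<subseteq> carrier R \<and> spn (T \<union> J) = carrier R)"

lemma fincodI: "finite T \<Longrightarrow> T \<subseteq> carrier R \<Longrightarrow> J \<subseteq> carrier R \<Longrightarrow> carrier R \<subseteq> spn (T \<union> J) \<Longrightarrow> fincod J"
  unfolding fincod_def using spn_carrier[of "T \<union> J"] by (intro exI[of _ T]) blast

lemma fincod_mono:
  assumes "fincod J" "J \<subseteq> J'" "J' \<subseteq> carrier R"
  shows "fincod J'"
proof -
  obtain T where T: "finite T" "T \<subseteq> carrier R" "spn (T \<union> J) = carrier R"
    using assms(1) by (auto simp: fincod_def)
  have "spn (T \<union> J) \<subseteq> spn (T \<union> J')" using assms(2) by (intro spn_mono) blast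
  then show ?thesis using T assms(3) by (intro fincodI[of T]) auto
qed

text \<open>Right multiplication by \<open>y\<close> embeds \<open>R\<close> modulo the colon space
  into \<open>R/J\<close>. A finite set spanning the image is lifted along this map to
  \<open>V\<close>.\<close>

lemma fincod_colon:
  assumes "fincod J" "subspace J" "y \<in> carrier R"
  shows "fincod {r \<in> carrier R. r \<otimes> y \<in> J}"
proof -
  obtain T where T: "finite T" "T \<subseteq> carrier R" "spn (T \<union> J) = carrier R"
    using assms(1) by (auto simp: fincod_def)
  note J = subspaceD(1)[OF assms(2)]
  let ?A = "(\<lambda>r. r \<otimes> y) ` carrier R"
  obtain U where U: "finite U" "U \<subseteq> ?A" "?A \<subseteq> spn (U \<union> J)"
    by (rule finite_extraction[OF T(1,2) J, of ?A]) (use T(3) assms(3) in auto)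
  obtain V where V: "V \<subseteq> carrier R" "finite V" "U = (\<lambda>r. r \<otimes> y) ` V"
    using finite_subset_image[OF U(1,2)] by blast
  let ?Q = "{r \<in> carrier R. r \<otimes> y \<in> J}"
  have S: "subspace (spn (V \<union> ?Q))" using V by (intro subspace_spn) auto
  have Z: "subspace ((\<lambda>r. r \<otimes> y) ` spn (V \<union> ?Q))" by (rule subspace_rmult_image[OF S assms(3)])
  have sub: "spn (U \<union> J) \<subseteq> {z. \<exists>a\<in>spn (V \<union> ?Q). \<exists>b\<in>J. z = a \<otimes> y \<oplus> b}"
  proof -
    have "spn (U \<union> J) \<subseteq> spn ((\<lambda>r. r \<otimes> y) ` spn (V \<union> ?Q) \<union> J)"
      using V(3) spn_superset[of "V \<union> ?Q"] by (intro spn_mono) auto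
    then show ?thesis unfolding spn_Un[OF Z assms(2)] by blast
  qed
  have "carrier R \<subseteq> spn (V \<union> ?Q)"
  proof
    fix r assume r: "r \<in> carrier R"
    then obtain a b where ab: "a \<in> spn (V \<union> ?Q)" "b \<in> J" "r \<otimes> y = a \<otimes> y \<oplus> b" using U(3) sub by blast
    have ac: "a \<in> carrier R" "b \<in> carrier R" using ab subspaceD(2)[OF S] J by auto
    have "(r \<ominus> a) \<otimes> y = r \<otimes> y \<ominus> a \<otimes> y" using r ac assms(3) by (simp add: minus_eq l_distr l_minus)
    also have "\<dots> = b" using ac assms(3) unfolding ab(3) by (simp add: minus_eq a_ac r_neg)
    finally have "r \<ominus> a \<in> ?Q" using ab r ac by simp
    then have "r \<ominus> a \<in> spn (V \<union> ?Q)" by (intro spn_base) simp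
    then show "r \<in> spn (V \<union> ?Q)" using subspace_diff_cancel[OF S] ab r by blast
  qed
  then show ?thesis using V by (intro fincodI) auto
qed

text \<open>\<open>A/(A \<inter> B)\<close> embeds in \<open>R/B\<close>, so a finite set
  \<open>U\<close> spans it, and \<open>S\<close> covers the remaining part
  \<open>R/A\<close>.\<close>

lemma fincod_Int:
  assumes "fincod A" "fincod B" "subspace A" "subspace B"
  shows "fincod (A \<inter> B)"
proof -
  obtain T where T: "finite T" "T \<subseteq> carrier R" "spn (T \<union> B) = carrier R"
    using assms(2) by (auto simp: fincod_def)
  obtain S where S: "finite S" "S \<subseteq> carrier R" "spn (S \<union> A) = carrier R"
    using assms(1) by (auto simp: fincod_def)
  note A = subspaceD(1)[OF assms(3)] and B = subspaceD(1)[OF assms(4)]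
  obtain U where U: "finite U" "U \<subseteq> A" "A \<subseteq> spn (U \<union> B)"
    by (rule finite_extraction[OF T(1,2) B, of A]) (use T(3) A in auto)
  have Uc: "U \<subseteq> carrier R" using U(2) A by blast
  have V: "subspace (spn (S \<union> U \<union> A \<inter> B))" using S(2) Uc A by (intro subspace_spn) auto
  have "A \<subseteq> spn (S \<union> U \<union> A \<inter> B)"
  proof
    fix a assume a: "a \<in> A"
    have "spn (U \<union> B) = {x \<oplus> b | x b. x \<in> spn U \<and> b \<in> B}"
      using spn_Un_cong[OF Uc B] spn_subspace[OF assms(4)] by simp
    then obtain x b where x: "x \<in> spn U" "b \<in> B" "a = x \<oplus> b" using a U(3) by blast
    have xA: "x \<in> A" using x(1) spn_min[OF assms(3) U(2)] by blast
    have "x \<in> carrier R" "b \<in> carrier R" using xA x(2) A B by auto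
    then have "b \<oplus> x \<in> A" using a a_comm[of b x] x(3) by simp
    then have "b \<in> A" using subspace_add_cancel[OF assms(3)] xA x(2) B by blast
    then have "b \<in> spn (S \<union> U \<union> A \<inter> B)" using x(2) by (intro spn_base) auto
    moreover have "x \<in> spn (S \<union> U \<union> A \<inter> B)" using x(1) spn_mono[of U "S \<union> U \<union> A \<inter> B"] by blast
    ultimately show "a \<in> spn (S \<union> U \<union> A \<inter> B)" unfolding x(3) by (rule subspaceD(4)[OF V, rotated])
  qed
  then have "carrier R \<subseteq> spn (S \<union> U \<union> A \<inter> B)"
    unfolding S(3)[symmetric]
  proof (intro spn_subset_spn Un_least)
    show "S \<subseteq> spn (S \<union> U \<union> A \<inter> B)" using spn_superset[of "S \<union> U \<union> A \<inter> B"] by blast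
  qed (use S(2) Uc A in auto)
  then show ?thesis using S(1,2) Uc U(1) A by (intro fincodI[of "S \<union> U"]) auto
qed

lemma fincod_carrier: "fincod (carrier R)"
  by (rule fincodI[of "{}"]) (auto intro: spn_base)

section \<open>Chains of left ideals with infinite dimensional factors\<close>

definition generates :: "'a set \<Rightarrow> bool"
  where "generates Y \<longleftrightarrow> finite Y \<and> Y \<subseteq> carrier R \<and> (\<forall>a\<in>carrier R. \<exists>n. a \<in> pss Y n)"

lemma left_idealD:
  "left_ideal R J \<Longrightarrow> r \<in> carrier R \<Longrightarrow> a \<in> J \<Longrightarrow> r \<otimes> a \<in> J"
  by (simp add: left_ideal_def)

lemma left_mult_stable_contains_pss:
  assumes Y: "Y \<subseteq> carrier R" and V: "subspace V" "\<one> \<in> V" "\<And>y a. y \<in> Y \<Longrightarrow> a \<in> V \<Longrightarrow> y \<otimes> a \<in> V"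
  shows "pss Y n \<subseteq> V"
proof -
  have "set ws \<subseteq> Y \<Longrightarrow> list_prod R ws \<in> V" for ws by (induction ws) (auto intro: V)
  then show ?thesis unfolding power_sum_space_def by (intro spn_min V) auto
qed

text \<open>If words of length \<open>j + 1\<close> gave nothing new modulo \<open>J\<close> over
  those of length \<open>j\<close>, then \<open>pss Y j\<close> and \<open>J\<close> would span a
  space stable under left multiplication by the generators, hence all of \<open>R\<close>, and
  \<open>J\<close> would have finite codimension. So every length contributes a new element.\<close>

lemma infinite_codim_sequence:
  assumes gen: "generates Y" and J: "left_ideal R J" and inf: "\<not> fincod J"
  obtains w :: "nat \<Rightarrow> 'a" where "\<And>j. w j \<in> pss Y j" "\<And>j. w j \<notin> spn (w ` {..<j} \<union> J)"
proof -
  have Y: "finite Y" "Y \<subseteq> carrier R" "\<And>a. a \<in> carrier R \<Longrightarrow> \<exists>n. a \<in> pss Y n"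
    using gen by (auto simp: generates_def)
  note sJ = subspace_left_ideal[OF J]
  note Jc = subspaceD(1)[OF sJ]
  have one: "\<one> \<notin> J"
  proof
    assume "\<one> \<in> J"
    then have "carrier R \<subseteq> J" using left_idealD[OF J _ \<open>\<one> \<in> J\<close>] by (metis r_one subsetI)
    then show False using inf fincod_carrier Jc by (metis subset_antisym)
  qed
  have "\<exists>w\<in>pss Y (Suc j). w \<notin> spn (pss Y j \<union> J)" for j
  proof (rule ccontr)
    let ?V = "spn (pss Y j \<union> J)"
    assume "\<not> ?thesis"
    then have sub: "pss Y (Suc j) \<subseteq> ?V" by blast
    have V: "subspace ?V" using pss_closed[OF Y(2)] Jc by (intro subspace_spn) auto
    have "y \<otimes> a \<in> ?V" if y: "y \<in> Y" and a: "a \<in> ?V" for y a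
    proof -
      have yc: "y \<in> carrier R" using y Y(2) by blast
      have "?V \<subseteq> {z \<in> carrier R. y \<otimes> z \<in> ?V}"
      proof (intro spn_min subspace_lvimage V yc subsetI)
        fix z assume "z \<in> pss Y j \<union> J"
        moreover have "y \<otimes> z \<in> ?V" if "z \<in> pss Y j"
          using pss_mult[OF Y(2) generator_in_pss[OF Y(2) y, of 1] that] sub by auto
        moreover have "y \<otimes> z \<in> ?V" if "z \<in> J" using left_idealD[OF J yc that] by (intro spn_base) auto
        ultimately show "z \<in> {z \<in> carrier R. y \<otimes> z \<in> ?V}" using pss_closed[OF Y(2)] Jc by auto
      qed
      then show ?thesis using a by blast
    qed
    moreover have "\<one> \<in> ?V" using one_in_pss by (intro spn_base) auto
    ultimately have "pss Y n \<subseteq> ?V" for n by (rule left_mult_stable_contains_pss[OF Y(2) V, rotated])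
    then have "carrier R \<subseteq> ?V" using Y(3) by blast
    moreover obtain T where T: "finite T" "T \<subseteq> carrier R" "pss Y j = spn T"
      using pss_finite_spanning[OF Y(1,2)] by blast
    moreover have "?V \<subseteq> spn (T \<union> J)"
      unfolding T(3) using T(2) Jc spn_mono[of T "T \<union> J"] spn_superset[of "T \<union> J"] by (intro spn_subset_spn) auto
    ultimately have "fincod J" using Jc by (intro fincodI[of T]) auto
    then show False using inf by simp
  qed
  then obtain v where v: "\<And>j. v j \<in> pss Y (Suc j)" "\<And>j. v j \<notin> spn (pss Y j \<union> J)" by metis
  \<comment> \<open>The shift of the index puts \<open>w j\<close> into \<open>pss Y j\<close>; the
    initial \<one> is new because it does not lie in \<open>J\<close>.\<close>
  define w where "w j = (case j of 0 \<Rightarrow> \<one> | Suc i \<Rightarrow> v i)" for j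
  have w: "w j \<in> pss Y j" for j using v one_in_pss by (cases j) (auto simp: w_def)
  moreover have "w j \<notin> spn (w ` {..<j} \<union> J)" for j
  proof (cases j)
    case 0
    then show ?thesis using one spn_subspace[OF sJ] by (simp add: w_def)
  next
    case (Suc i)
    have "w ` {..<Suc i} \<subseteq> pss Y i"
    proof (rule image_subsetI)
      fix b assume "b \<in> {..<Suc i}"
      then show "w b \<in> pss Y i" using w[of b] pss_mono[of b i Y Y] by auto
    qed
    then have "spn (w ` {..<Suc i} \<union> J) \<subseteq> spn (pss Y i \<union> J)" by (intro spn_mono) auto
    then show ?thesis using v(2)[of i] Suc by (auto simp: w_def)
  qed
  ultimately show thesis using that by blast
qed

text \<open>Each step of the chain contributes at least \<open>n + 1\<close> independent elements of length \<open>n + p\<close>, with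
  \<open>p\<close> depending only on the \<open>a i\<close>.\<close>

lemma chain_length_bound:
  assumes gen: "generates Y" and lin: "linear_growth Y P C" and P: "P \<subseteq> carrier R"
    and D: "\<And>i. i < N \<Longrightarrow> left_ideal R (D i)" "\<And>i. i < N \<Longrightarrow> P \<subseteq> D i"
    and a: "\<And>i. i < N \<Longrightarrow> a i \<in> carrier R" "\<And>i i'. i < N \<Longrightarrow> i' < i \<Longrightarrow> a i' \<in> D i"
    and inf: "\<And>i. i < N \<Longrightarrow> \<not> fincod {r \<in> carrier R. r \<otimes> a i \<in> D i}"
  shows "N \<le> C"
proof -
  have Y: "finite Y" "Y \<subseteq> carrier R" "\<And>a. a \<in> carrier R \<Longrightarrow> \<exists>n. a \<in> pss Y n"
    using gen by (auto simp: generates_def)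
  let ?J = "\<lambda>i. {r \<in> carrier R. r \<otimes> a i \<in> D i}"
  have J: "left_ideal R (?J i)" if i: "i < N" for i
  proof -
    have S: "subspace (?J i)" by (intro subspace_rvimage subspace_left_ideal D a i)
    have "additive_subgroup (?J i) R"
      using S subspace_iff_subalgebra by (simp add: additive_subgroup_def subalgebra_def)
    then show ?thesis
      using left_idealD[OF D(1)[OF i]] a(1)[OF i] by (auto simp: left_ideal_def m_assoc)
  qed
  define Q where "Q i w \<longleftrightarrow> (\<forall>j::nat. w j \<in> pss Y j) \<and> (\<forall>j. w j \<notin> spn (w ` {..<j} \<union> ?J i))" for i w
  have "\<exists>w. Q i w" if "i < N" for i
    unfolding Q_def by (rule infinite_codim_sequence[OF gen J[OF that] inf[OF that]]) auto
  then obtain w where "\<And>i. i < N \<Longrightarrow> Q i (w i)" by metis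
  then have w: "\<And>i j. i < N \<Longrightarrow> w i j \<in> pss Y j"
    "\<And>i j. i < N \<Longrightarrow> w i j \<notin> spn (w i ` {..<j} \<union> ?J i)" unfolding Q_def by blast+
  have "\<exists>n. a i \<in> pss Y n" if "i < N" for i using Y(3) a(1)[OF that] by blast
  then obtain e where e: "\<And>i. i < N \<Longrightarrow> a i \<in> pss Y (e i)" by metis
  \<comment> \<open>A common length bound for all \<open>a i\<close>; the inserted 0 covers
    \<open>N = 0\<close>.\<close>
  define p where "p = Max (insert 0 (e ` {..<N}))"
  have ep: "a i \<in> pss Y p" if "i < N" for i
  proof -
    have "e i \<le> p" unfolding p_def using that by (intro Max_ge) auto
    then show ?thesis using e[OF that] pss_mono[of "e i" p Y Y] by blast
  qed
  have bound: "N * (n + 1) \<le> C * (n + p + 1)" for n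
  proof -
    obtain T where T: "finite T" "T \<subseteq> carrier R" "card T \<le> C * (n + p + 1)" "pss Y (n + p) \<subseteq> spn (T \<union> P)"
      using lin unfolding linear_growth_def by blast
    have "N * (n + 1) \<le> card T"
    proof (rule triangular_bound2[OF T(1,2) P, where u = "\<lambda>i j. w i j \<otimes> a i"])
      fix i j assume ij: "i < N" "j < n + 1"
      have wc: "w i j' \<in> carrier R" for j' using w(1)[OF ij(1)] pss_closed[OF Y(2)] by blast
      show "w i j \<otimes> a i \<in> spn (T \<union> P)"
        using pss_mult[OF Y(2) w(1)[OF ij(1)] ep[OF ij(1)], of j] pss_mono[of "j + p" "n + p" Y Y] ij(2) T(4) by auto
      let ?S = "spn (w i ` {..<j} \<union> ?J i)"
      have S: "subspace ?S" using wc by (intro subspace_spn) auto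
      note aS = subspace_rmult_image[OF S a(1)[OF ij(1)]] and Di = subspace_left_ideal[OF D(1)[OF ij(1)]]
      \<comment> \<open>\<open>D i\<close> absorbs the earlier steps of the chain, the other summand
        the earlier elements of step \<open>i\<close>. If \<open>w i j \<otimes> a i\<close> were in
        \<open>Z\<close>, then \<open>w i j\<close> would depend on its predecessors modulo the
        colon ideal.\<close>
      define Z where "Z = spn ((\<lambda>y. y \<otimes> a i) ` ?S \<union> D i)"
      have "subspace Z" unfolding Z_def using aS Di by (intro subspace_spn) (auto simp: subspace_def)
      moreover have "P \<subseteq> Z" using D(2)[OF ij(1)] unfolding Z_def by (auto intro: spn_base)
      moreover have "w i' j' \<otimes> a i' \<in> Z" if "i' < i" for i' j'
      proof -
        have "w i' j' \<in> carrier R" using w(1)[of i' j'] that ij(1) pss_closed[OF Y(2)] by auto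
        then have "w i' j' \<otimes> a i' \<in> D i" using left_idealD[OF D(1)[OF ij(1)]] a(2)[OF ij(1) that] by blast
        then show ?thesis unfolding Z_def by (intro spn_base) auto
      qed
      moreover have "w i j' \<otimes> a i \<in> Z" if "j' < j" for j'
        unfolding Z_def using that by (intro spn_base UnI1 imageI) auto
      moreover have "w i j \<otimes> a i \<notin> Z"
      proof
        assume "w i j \<otimes> a i \<in> Z"
        then obtain y d where yd: "y \<in> ?S" "d \<in> D i" "w i j \<otimes> a i = y \<otimes> a i \<oplus> d"
          unfolding Z_def spn_Un[OF aS Di] by blast
        have c: "y \<in> carrier R" "d \<in> carrier R" using yd subspaceD(2)[OF S] subspaceD(2)[OF Di] by auto
        have "(w i j \<ominus> y) \<otimes> a i = w i j \<otimes> a i \<ominus> y \<otimes> a i"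
          using c wc a(1)[OF ij(1)] by (simp add: minus_eq l_distr l_minus)
        also have "\<dots> = d" using c a(1)[OF ij(1)] unfolding yd(3) by (simp add: minus_eq a_ac r_neg)
        finally have "w i j \<ominus> y \<in> ?J i" using yd(2) wc c by simp
        then have "w i j \<ominus> y \<in> ?S" by (intro spn_base) auto
        then have "w i j \<in> ?S" using subspace_diff_cancel[OF S _ yd(1) wc] by blast
        then show False using w(2)[OF ij(1)] by blast
      qed
      ultimately show "\<exists>Z. subspace Z \<and> P \<subseteq> Z \<and> (\<forall>i'<i. \<forall>j'<n + 1. w i' j' \<otimes> a i' \<in> Z) \<and>
          (\<forall>j'<j. w i j' \<otimes> a i \<in> Z) \<and> w i j \<otimes> a i \<notin> Z" by blast
    qed
    then show ?thesis using T(3) by simp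
  qed
  show ?thesis
  proof (rule ccontr)
    assume "\<not> N \<le> C"
    \<comment> \<open>The choice \<open>n = C * p\<close> makes \<open>bound\<close> fail by 1 for
      \<open>N = C + 1\<close>.\<close>
    then have "(C + 1) * (C * p + 1) \<le> N * (C * p + 1)" by (intro mult_le_mono1) simp
    also have "\<dots> \<le> C * (C * p + p + 1)" by (rule bound)
    finally show False by (simp add: algebra_simps)
  qed
qed

end

section \<open>Algebraic elements and spectra\<close>

context central_subfield
begin

abbreviation powers :: "'a \<Rightarrow> nat \<Rightarrow> 'a set" where "powers s n \<equiv> (\<lambda>i. s [^] i) ` {..<n}"

text \<open>A monic relation for \<open>s\<close> modulo \<open>I\<close>, written with spans so
  that no polynomials are involved. Monic relations can be multiplied, and over a field every
  nonzero relation can be made monic.\<close>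

definition algebraic_mod :: "'a set \<Rightarrow> 'a \<Rightarrow> bool"
  where "algebraic_mod I s \<longleftrightarrow> (\<exists>n::nat. s [^] n \<in> spn (powers s n \<union> I))"

lemma left_idealI: "subspace J \<Longrightarrow> (\<And>r a. r \<in> carrier R \<Longrightarrow> a \<in> J \<Longrightarrow> r \<otimes> a \<in> J) \<Longrightarrow> left_ideal R J"
  by (simp add: left_ideal_def additive_subgroup_def subspace_iff_subalgebra subalgebra_def)

lemma left_ideal_closed: "left_ideal R J \<Longrightarrow> J \<subseteq> carrier R"
  by (rule subspaceD(1)[OF subspace_left_ideal])

lemma left_ideal_carrier_iff:
  assumes "left_ideal R J" shows "J = carrier R \<longleftrightarrow> \<one> \<in> J"
  using left_idealD[OF assms, of _ \<one>] left_ideal_closed[OF assms] by (metis one_closed r_one subsetI subset_antisym)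

lemma left_ideal_sum:
  assumes "left_ideal R J" "z \<in> carrier R"
  shows "left_ideal R {r \<otimes> z \<oplus> j | r j. r \<in> carrier R \<and> j \<in> J}"
proof (rule left_idealI)
  note Jc = left_ideal_closed[OF assms(1)]
  have "{r \<otimes> z \<oplus> j | r j. r \<in> carrier R \<and> j \<in> J} = {a \<oplus> b |a b. a \<in> (\<lambda>r. r \<otimes> z) ` carrier R \<and> b \<in> J}" by blast
  then show "subspace {r \<otimes> z \<oplus> j | r j. r \<in> carrier R \<and> j \<in> J}"
    using subspace_set_sum[OF subspace_rmult_image[OF subspace_carrier assms(2)] subspace_left_ideal[OF assms(1)]] by simp
  fix r a assume r: "r \<in> carrier R" and "a \<in> {r \<otimes> z \<oplus> j | r j. r \<in> carrier R \<and> j \<in> J}"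
  then obtain r' j where a: "a = r' \<otimes> z \<oplus> j" "r' \<in> carrier R" "j \<in> J" by blast
  then have "r \<otimes> a = (r \<otimes> r') \<otimes> z \<oplus> r \<otimes> j" using r assms(2) Jc by (auto simp: r_distr m_assoc)
  then show "r \<otimes> a \<in> {r \<otimes> z \<oplus> j | r j. r \<in> carrier R \<and> j \<in> J}"
    using r a left_idealD[OF assms(1) r a(3)] by blast
qed

lemma left_ideal_sum_superset:
  assumes "left_ideal R J" "z \<in> carrier R"
  shows "J \<subseteq> {r \<otimes> z \<oplus> j | r j. r \<in> carrier R \<and> j \<in> J}" "z \<in> {r \<otimes> z \<oplus> j | r j. r \<in> carrier R \<and> j \<in> J}"
proof -
  show "J \<subseteq> {r \<otimes> z \<oplus> j | r j. r \<in> carrier R \<and> j \<in> J}"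
  proof
    fix j assume j: "j \<in> J"
    then have "j = \<zero> \<otimes> z \<oplus> j" using left_ideal_closed[OF assms(1)] assms(2) by auto
    then show "j \<in> {r \<otimes> z \<oplus> j | r j. r \<in> carrier R \<and> j \<in> J}" using j by blast
  qed
  have "z = \<one> \<otimes> z \<oplus> \<zero>" using assms(2) by simp
  then show "z \<in> {r \<otimes> z \<oplus> j | r j. r \<in> carrier R \<and> j \<in> J}"
    using subspaceD(3)[OF subspace_left_ideal[OF assms(1)]] by blast
qed

section \<open>Products of linear factors and the spectrum of an algebraic element\<close>

primrec linear_prod :: "'a \<Rightarrow> (nat \<Rightarrow> 'a) \<Rightarrow> nat \<Rightarrow> 'a"
  where "linear_prod s b 0 = \<one>"
  | "linear_prod s b (Suc i) = linear_prod s b i \<otimes> (s \<ominus> b i)"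

lemma shift_closed: "s \<in> carrier R \<Longrightarrow> c \<in> F \<Longrightarrow> s \<ominus> c \<in> carrier R"
  using F_carrier by simp

lemma linear_prod_closed:
  "s \<in> carrier R \<Longrightarrow> (\<And>l. l < i \<Longrightarrow> b l \<in> F) \<Longrightarrow> linear_prod s b i \<in> carrier R"
  by (induction i) (auto simp: shift_closed)

lemma mult_shift:
  assumes "z \<in> carrier R" "s \<in> carrier R" "c \<in> F" "d \<in> F"
  shows "z \<otimes> (s \<ominus> d) = z \<otimes> (s \<ominus> c) \<oplus> (c \<ominus> d) \<otimes> z"
proof -
  have cd: "c \<in> carrier R" "d \<in> carrier R" using assms F_carrier by auto
  have "z \<otimes> (s \<ominus> d) = z \<otimes> ((s \<ominus> c) \<oplus> (c \<ominus> d))"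
    using assms cd by (simp add: minus_eq a_assoc r_neg1)
  also have "\<dots> = z \<otimes> (s \<ominus> c) \<oplus> z \<otimes> (c \<ominus> d)" using assms cd by (simp add: r_distr)
  also have "z \<otimes> (c \<ominus> d) = (c \<ominus> d) \<otimes> z" using F_central[OF F_minus_closed[OF assms(3,4)] assms(1)] by simp
  finally show ?thesis .
qed

text \<open>Modulo \<open>P\<close> the element \<open>z\<close> is an eigenvector of right
  multiplication by \<open>s\<close> with eigenvalue \<open>c\<close>, so
  \<open>s \<ominus> d\<close> acts on it by the scalar \<open>c \<ominus> d\<close>, which is
  invertible for \<open>c \<noteq> d\<close>.\<close>

lemma shift_mult_mod:
  assumes "subspace P" "z \<in> carrier R" "s \<in> carrier R" "c \<in> F" "d \<in> F" "z \<otimes> (s \<ominus> c) \<in> P"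
  shows "z \<in> P \<Longrightarrow> z \<otimes> (s \<ominus> d) \<in> P" "z \<otimes> (s \<ominus> d) \<in> P \<Longrightarrow> c \<noteq> d \<Longrightarrow> z \<in> P"
proof -
  note eq = mult_shift[OF assms(2-5)]
  note cd = F_minus_closed[OF assms(4,5)]
  show "z \<otimes> (s \<ominus> d) \<in> P" if "z \<in> P"
    unfolding eq using subspaceD(4)[OF assms(1) assms(6) subspaceD(5)[OF assms(1) cd that]] .
  assume "z \<otimes> (s \<ominus> d) \<in> P" "c \<noteq> d"
  then have "(c \<ominus> d) \<otimes> z \<oplus> z \<otimes> (s \<ominus> c) \<in> P"
    unfolding eq using a_comm[of "(c \<ominus> d) \<otimes> z" "z \<otimes> (s \<ominus> c)"] assms F_carrier cd by simp
  then have "(c \<ominus> d) \<otimes> z \<in> P"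
    using subspace_add_cancel[OF assms(1) _ assms(6)] assms(2) F_carrier[OF cd] by simp
  moreover have "c \<ominus> d \<noteq> \<zero>" using \<open>c \<noteq> d\<close> F_carrier assms by simp
  ultimately show "z \<in> P" using smult_cancel_subspace[OF cd _ assms(1)] assms(2) by blast
qed

text \<open>For distinct bad scalars the product of the first \<open>k\<close> linear factors lies
  in the proper left ideal \<open>R(s - b i) + I\<close> exactly when \<open>k > i\<close>. Hence
  \<open>n + 1\<close> bad scalars give \<open>n + 1\<close> products independent modulo
  \<open>I\<close>, in a space spanned modulo \<open>I\<close> by the \<open>n\<close> powers below
  the degree of the relation.\<close>

lemma finite_spectrum:
  assumes I: "left_ideal R I" and s: "s \<in> carrier R" and alg: "algebraic_mod I s"
  shows "finite {c \<in> F. {r \<otimes> (s \<ominus> c) \<oplus> j | r j. r \<in> carrier R \<and> j \<in> I} \<noteq> carrier R}"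
proof (rule ccontr)
  let ?J = "\<lambda>c. {r \<otimes> (s \<ominus> c) \<oplus> j | r j. r \<in> carrier R \<and> j \<in> I}"
  assume "infinite {c \<in> F. ?J c \<noteq> carrier R}"
  then obtain b :: "nat \<Rightarrow> 'a" where b: "inj b" "range b \<subseteq> {c \<in> F. ?J c \<noteq> carrier R}"
    using infinite_countable_subset by blast
  have bF: "b i \<in> F" for i using b(2) by auto
  obtain n where n: "s [^] n \<in> spn (powers s n \<union> I)" using alg by (auto simp: algebraic_mod_def)
  have pc: "linear_prod s b i \<in> carrier R" for i by (intro linear_prod_closed s bF)
  note Ic = left_ideal_closed[OF I]
  let ?V = "spn (powers s n \<union> I)"
  have "powers s n \<union> I \<subseteq> carrier R" using s Ic by auto
  then have V: "subspace ?V" by (rule subspace_spn)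
  have sV: "s \<otimes> v \<in> ?V" if "v \<in> ?V" for v
  proof -
    have "?V \<subseteq> {v \<in> carrier R. s \<otimes> v \<in> ?V}"
    proof (intro spn_min subspace_lvimage V s Un_least image_subsetI subsetI)
      fix i assume "i \<in> {..<n}"
      then have "Suc i = n \<or> Suc i \<in> {..<n}" by auto
      then have "Suc i = n \<or> s [^] Suc i \<in> powers s n"
        using imageI[of "Suc i" "{..<n}" "\<lambda>i. s [^] i"] by blast
      then have "s [^] Suc i \<in> ?V" using n spn_base[of "s [^] Suc i" "powers s n \<union> I"] by blast
      then show "s [^] i \<in> {v \<in> carrier R. s \<otimes> v \<in> ?V}" using s nat_pow_Suc2[OF s, of i] by simp
    next
      fix j assume "j \<in> I"
      then show "j \<in> {v \<in> carrier R. s \<otimes> v \<in> ?V}" using left_idealD[OF I s] Ic by (auto intro: spn_base)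
    qed
    then show ?thesis using that by blast
  qed
  have pw: "s [^] i \<in> ?V" for i :: nat
  proof (induction i)
    case 0
    then show ?case using n by (cases "n = 0") (auto intro!: spn_base image_eqI[of _ _ 0])
  next
    case (Suc i) then show ?case using sV nat_pow_Suc2[OF s, of i] by simp
  qed
  have pV: "linear_prod s b i \<in> spn (range (\<lambda>i::nat. s [^] i))" for i
  proof (induction i)
    case 0 then show ?case by (auto intro!: spn_base image_eqI[of _ _ 0])
  next
    case (Suc i)
    let ?W = "spn (range (\<lambda>i::nat. s [^] i))"
    have W: "subspace ?W" using s by (intro subspace_spn) auto
    have "?W \<subseteq> {v \<in> carrier R. v \<otimes> (s \<ominus> b i) \<in> ?W}"
    proof (intro spn_min subspace_rvimage W shift_closed s bF image_subsetI)
      fix k :: nat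
      have "s [^] k \<otimes> (s \<ominus> b i) = s [^] Suc k \<ominus> b i \<otimes> s [^] k"
        using s F_carrier[OF bF] F_central[OF bF, of "s [^] k" i] by (simp add: minus_eq r_distr r_minus)
      also have "\<dots> \<in> ?W" by (intro subspace_minus[OF W] subspaceD(5)[OF W] bF spn_base rangeI)
      finally show "s [^] k \<in> {v \<in> carrier R. v \<otimes> (s \<ominus> b i) \<in> ?W}" using s by simp
    qed
    then show ?case using Suc by auto
  qed
  have "spn (range (\<lambda>i::nat. s [^] i)) \<subseteq> ?V" by (rule spn_min[OF V]) (use pw in blast)
  then have pV': "linear_prod s b i \<in> ?V" for i using pV by blast
  have "n + 1 \<le> card (powers s n)"
  \<comment> \<open>The products are listed from long to short, because the separating ideal
    contains the longer ones.\<close>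
  proof (rule triangular_bound[where P = I and u = "\<lambda>i. linear_prod s b (n - i)"])
    fix a assume "a < n + 1"
    let ?i = "n - a"
    note J = left_ideal_sum[OF I shift_closed[OF s bF[of ?i]]]
      and Jsup = left_ideal_sum_superset[OF I shift_closed[OF s bF[of ?i]]]
    note sJ = subspace_left_ideal[OF J]
    have shift: "z \<otimes> (s \<ominus> b ?i) \<in> ?J (b ?i)" if "z \<in> carrier R" for z
      using left_idealD[OF J that Jsup(2)] .
    have not: "linear_prod s b k \<notin> ?J (b ?i)" if "k \<le> ?i" for k
      using that
    proof (induction k)
      case 0
      then show ?case using left_ideal_carrier_iff[OF J] b(2) by auto
    next
      case (Suc k)
      have "b ?i \<noteq> b k" using Suc.prems injD[OF b(1)] by fastforce
      then show ?case
        using shift_mult_mod(2)[OF sJ pc[of k] s bF bF shift[OF pc], of k] Suc by auto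
    qed
    have mem: "linear_prod s b k \<in> ?J (b ?i)" if "Suc ?i \<le> k" for k
      using that
    proof (induction k rule: dec_induct)
      case base then show ?case using shift[OF pc[of ?i]] by simp
    next
      case (step k)
      then show ?case using shift_mult_mod(1)[OF sJ pc[of k] s bF bF shift[OF pc]] by simp
    qed
    show "\<exists>Z. subspace Z \<and> I \<subseteq> Z \<and> (\<forall>b'<a. linear_prod s b (n - b') \<in> Z) \<and> linear_prod s b (n - a) \<notin> Z"
    proof (intro exI[of _ "?J (b ?i)"] conjI sJ Jsup allI impI not)
      fix b' assume "b' < a"
      then show "linear_prod s b (n - b') \<in> ?J (b ?i)" using \<open>a < n + 1\<close> by (intro mem) simp
    qed simp
  qed (use s Ic pV' in auto)
  moreover have "card (powers s n) \<le> n" using card_image_le[of "{..<n}" "\<lambda>i. s [^] i"] by simp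
  ultimately show False by simp
qed

section \<open>Polynomials in one element\<close>

abbreviation polys :: "'a \<Rightarrow> 'a set" where "polys s \<equiv> spn (range (\<lambda>i::nat. s [^] i))"

lemma subspace_polys: "s \<in> carrier R \<Longrightarrow> subspace (polys s)"
  by (intro subspace_spn) auto

lemma polys_shift:
  assumes s: "s \<in> carrier R" and c: "c \<in> F" and p: "p \<in> polys s"
  shows "p \<otimes> (s \<ominus> c) \<in> polys s" "p \<otimes> (s \<ominus> c) = (s \<ominus> c) \<otimes> p" "p \<in> carrier R"
proof -
  note W = subspace_polys[OF s]
  have sc: "s \<ominus> c \<in> carrier R" by (rule shift_closed[OF s c])
  have comm: "s [^] k \<otimes> (s \<ominus> c) = (s \<ominus> c) \<otimes> s [^] k" for k :: nat
    using s F_carrier[OF c] F_central[OF c, of "s [^] k"] nat_pow_Suc2[OF s, of k]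
    by (simp add: minus_eq r_distr l_distr r_minus l_minus)
  have mem: "s [^] k \<otimes> (s \<ominus> c) \<in> polys s" for k :: nat
  proof -
    have "s [^] k \<otimes> (s \<ominus> c) = s [^] Suc k \<ominus> c \<otimes> s [^] k"
      using s F_carrier[OF c] F_central[OF c, of "s [^] k"] by (simp add: minus_eq r_distr r_minus)
    also have "\<dots> \<in> polys s" by (intro subspace_minus[OF W] subspaceD(5)[OF W] c spn_base rangeI)
    finally show ?thesis .
  qed
  have "polys s \<subseteq> {p \<in> carrier R. p \<otimes> (s \<ominus> c) \<in> polys s}"
    using s mem by (intro spn_min subspace_rvimage W sc) auto
  then show "p \<otimes> (s \<ominus> c) \<in> polys s" using p by blast
  have "polys s \<subseteq> {p \<in> carrier R. p \<otimes> (s \<ominus> c) = (s \<ominus> c) \<otimes> p}"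
  proof (intro spn_min subspaceI)
    fix d p assume "d \<in> F" "p \<in> {p \<in> carrier R. p \<otimes> (s \<ominus> c) = (s \<ominus> c) \<otimes> p}"
    then show "d \<otimes> p \<in> {p \<in> carrier R. p \<otimes> (s \<ominus> c) = (s \<ominus> c) \<otimes> p}"
      using sc F_carrier[of d] F_central[OF \<open>d \<in> F\<close> sc] by (auto simp: m_assoc) (simp flip: m_assoc)
  qed (use sc comm s in \<open>auto simp: l_distr r_distr\<close>)
  then show "p \<otimes> (s \<ominus> c) = (s \<ominus> c) \<otimes> p" using p by blast
  show "p \<in> carrier R" using subspaceD(2)[OF W p] .
qed

lemma linear_prod_polys:
  assumes "s \<in> carrier R" "\<And>l. l < i \<Longrightarrow> b l \<in> F"
  shows "linear_prod s b i \<in> polys s"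
  using assms(2)
proof (induction i)
  case 0 then show ?case by (auto intro!: spn_base image_eqI[of _ _ 0])
qed (use polys_shift(1)[OF assms(1)] in simp)

lemma linear_prod_factor:
  assumes s: "s \<in> carrier R" and "\<And>l. l < i \<Longrightarrow> b l \<in> F" "l < i"
  shows "\<exists>q\<in>polys s. linear_prod s b i = (s \<ominus> b l) \<otimes> q"
  using assms(2,3)
proof (induction i)
  case (Suc i)
  show ?case
  proof (cases "l = i")
    case True
    then show ?thesis
      using linear_prod_polys[OF s, of i b] polys_shift(2)[OF s, of "b i" "linear_prod s b i"] Suc.prems by auto
  next
    case False
    then obtain q where q: "q \<in> polys s" "linear_prod s b i = (s \<ominus> b l) \<otimes> q" using Suc by auto
    have "linear_prod s b (Suc i) = (s \<ominus> b l) \<otimes> (q \<otimes> (s \<ominus> b i))"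
      using q polys_shift(3)[OF s Suc.prems(1)[of i] q(1)] s Suc.prems
      by (simp add: m_assoc shift_closed)
    then show ?thesis using polys_shift(1)[OF s _ q(1)] Suc.prems by auto
  qed
qed simp

text \<open>The remainder theorem: \<open>k\<close> is the product of the
  \<open>c \<ominus> b l\<close>, the value at \<open>c\<close> of the polynomial with roots
  \<open>b l\<close>.\<close>

lemma linear_prod_remainder:
  assumes s: "s \<in> carrier R" and b: "\<And>l. l < i \<Longrightarrow> b l \<in> F" and c: "c \<in> F" "\<And>l. l < i \<Longrightarrow> b l \<noteq> c"
  shows "\<exists>k\<in>F. \<exists>h\<in>polys s. k \<noteq> \<zero> \<and> linear_prod s b i = k \<oplus> (s \<ominus> c) \<otimes> h"
  using b c(2)
proof (induction i)
  case 0
  have "linear_prod s b 0 = \<one> \<oplus> (s \<ominus> c) \<otimes> \<zero>" using s F_carrier[OF c(1)] by simp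
  then show ?case using F_one one_neq_zero subspaceD(3)[OF subspace_polys[OF s]] by blast
next
  case (Suc i)
  then obtain k h where kh: "k \<in> F" "h \<in> polys s" "k \<noteq> \<zero>" "linear_prod s b i = k \<oplus> (s \<ominus> c) \<otimes> h" by auto
  note W = subspace_polys[OF s]
  have bi: "b i \<in> F" "b i \<noteq> c" using Suc.prems by auto
  have cl: "h \<in> carrier R" "k \<in> carrier R" "s \<ominus> c \<in> carrier R" "s \<ominus> b i \<in> carrier R" "c \<ominus> b i \<in> F"
    using kh polys_shift(3)[OF s c(1) kh(2)] F_carrier shift_closed s bi c F_minus_closed by auto
  have "\<one> \<otimes> (s \<ominus> b i) = \<one> \<otimes> (s \<ominus> c) \<oplus> (c \<ominus> b i) \<otimes> \<one>" by (rule mult_shift) (use s c bi in auto)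
  then have sb: "s \<ominus> b i = (s \<ominus> c) \<oplus> (c \<ominus> b i)" using cl F_carrier[OF cl(5)] by simp
  have "linear_prod s b (Suc i) = k \<otimes> (s \<ominus> b i) \<oplus> (s \<ominus> c) \<otimes> (h \<otimes> (s \<ominus> b i))"
    using kh(4) cl by (simp add: l_distr m_assoc)
  also have "k \<otimes> (s \<ominus> b i) = k \<otimes> (c \<ominus> b i) \<oplus> (s \<ominus> c) \<otimes> k"
    unfolding sb using cl F_carrier[OF cl(5)] F_central[OF kh(1) cl(3)] by (simp add: r_distr a_comm)
  also have "\<dots> \<oplus> (s \<ominus> c) \<otimes> (h \<otimes> (s \<ominus> b i)) = k \<otimes> (c \<ominus> b i) \<oplus> (s \<ominus> c) \<otimes> (k \<oplus> h \<otimes> (s \<ominus> b i))"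
    using cl F_carrier[OF cl(5)] by (simp add: r_distr a_assoc)
  finally have eq: "linear_prod s b (Suc i) = k \<otimes> (c \<ominus> b i) \<oplus> (s \<ominus> c) \<otimes> (k \<oplus> h \<otimes> (s \<ominus> b i))" .
  have "k \<otimes> \<one> \<in> polys s"
    by (intro subspaceD(5)[OF W kh(1)] spn_base) (auto intro!: image_eqI[of _ _ 0])
  then have "k \<oplus> h \<otimes> (s \<ominus> b i) \<in> polys s"
    using subspaceD(4)[OF W] polys_shift(1)[OF s bi(1) kh(2)] cl by simp
  moreover have "k \<otimes> (c \<ominus> b i) \<in> F" by (intro F_closed kh cl)
  moreover have "k \<otimes> (c \<ominus> b i) \<noteq> \<zero>"
  proof
    assume "k \<otimes> (c \<ominus> b i) = \<zero>"
    then have "c \<ominus> b i = \<zero>"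
      using smult_cancel_subspace[OF kh(1,3) subspace_zero, of "c \<ominus> b i"] F_carrier[OF cl(5)] by simp
    then show False using bi F_carrier c by simp
  qed
  ultimately show ?case using eq by blast
qed

text \<open>A nonzero leading coefficient \<open>k\<close> of \<open>g\<close> would reappear in
  \<open>g \<otimes> (s \<ominus> c)\<close> in front of the next power, where transcendence forbids
  it. So the degree of \<open>g\<close> drops until \<open>g \<in> I\<close>, and then \<one> lies
  in \<open>I\<close>.\<close>

lemma not_algebraic_no_inverse:
  assumes I: "ideal I R" and s: "s \<in> carrier R" and na: "\<not> algebraic_mod I s" and c: "c \<in> F"
    and g: "g \<in> spn (powers s n \<union> I)" "g \<otimes> (s \<ominus> c) \<ominus> \<one> \<in> I"
  shows False
  using g
proof (induction n arbitrary: g)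
  note sI = subspace_ideal[OF I]
  note Ic = subspaceD(1)[OF sI]
  have sc: "s \<ominus> c \<in> carrier R" by (rule shift_closed[OF s c])
  {
    case 0
    then have "g \<in> I" using spn_subspace[OF sI] by simp
    then have "g \<otimes> (s \<ominus> c) \<in> I" using ideal.I_r_closed[OF I] sc by blast
    moreover have "g \<otimes> (s \<ominus> c) \<in> carrier R" using \<open>g \<in> I\<close> Ic sc by auto
    ultimately have "g \<otimes> (s \<ominus> c) \<ominus> (g \<otimes> (s \<ominus> c) \<ominus> \<one>) \<in> I" using 0 subspace_minus[OF sI] by blast
    moreover have "g \<otimes> (s \<ominus> c) \<ominus> (g \<otimes> (s \<ominus> c) \<ominus> \<one>) = \<one>"
      using \<open>g \<otimes> (s \<ominus> c) \<in> carrier R\<close> by (simp add: minus_eq minus_add r_neg2)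
    ultimately have "s [^] (0::nat) \<in> spn (powers s 0 \<union> I)" using spn_subspace[OF sI] by simp
    then show False using na unfolding algebraic_mod_def by blast
  next
    case (Suc n)
    have pc: "powers s m \<union> I \<subseteq> carrier R" for m using s Ic by auto
    let ?V = "spn (powers s (Suc n) \<union> I)"
    note V = subspace_spn[OF pc, of "Suc n"]
    have pS: "powers s (Suc n) = insert (s [^] n) (powers s n)" by (simp add: lessThan_Suc)
    then obtain k a where ka: "k \<in> F" "a \<in> spn (powers s n \<union> I)" "g = k \<otimes> s [^] n \<oplus> a"
      using Suc.prems(1) spn_insertE[of g "s [^] n" "powers s n \<union> I"] s pc by auto
    have cl: "k \<in> carrier R" "c \<in> carrier R" "a \<in> carrier R" "s [^] n \<in> carrier R"
      using ka F_carrier c spn_carrier[OF pc] s by auto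
    have "spn (powers s n \<union> I) \<subseteq> {y \<in> carrier R. y \<otimes> (s \<ominus> c) \<in> ?V}"
    proof (intro spn_min subspace_rvimage V sc Un_least image_subsetI subsetI)
      fix i assume i: "i \<in> {..<n}"
      have "s [^] i \<otimes> (s \<ominus> c) = s [^] Suc i \<ominus> c \<otimes> s [^] i"
        using s cl F_central[OF c, of "s [^] i"] by (simp add: minus_eq r_distr r_minus)
      also have "\<dots> \<in> ?V"
        by (intro subspace_minus[OF V] subspaceD(5)[OF V] c spn_base UnI1 imageI) (use i in auto)
      finally show "s [^] i \<in> {y \<in> carrier R. y \<otimes> (s \<ominus> c) \<in> ?V}" using s by simp
    next
      fix y assume "y \<in> I"
      then show "y \<in> {y \<in> carrier R. y \<otimes> (s \<ominus> c) \<in> ?V}"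
        using ideal.I_r_closed[OF I] sc Ic by (auto intro: spn_base)
    qed
    then have a1: "a \<otimes> (s \<ominus> c) \<in> ?V" using ka(2) by blast
    have one: "\<one> \<in> ?V" by (intro spn_base) (auto intro!: image_eqI[of _ _ 0])
    have "g \<otimes> (s \<ominus> c) \<ominus> \<one> \<in> ?V" using Suc.prems(2) by (intro spn_base) auto
    then have "g \<otimes> (s \<ominus> c) \<in> ?V" using subspace_diff_cancel[OF V _ one] ka cl sc by simp
    moreover have "g \<otimes> (s \<ominus> c) = k \<otimes> s [^] Suc n \<oplus> (a \<otimes> (s \<ominus> c) \<ominus> (c \<otimes> k) \<otimes> s [^] n)"
    proof -
      have "(k \<otimes> s [^] n) \<otimes> (s \<ominus> c) = k \<otimes> s [^] Suc n \<ominus> (c \<otimes> k) \<otimes> s [^] n"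
        using s cl F_central[OF c, of "k \<otimes> s [^] n"] by (simp add: minus_eq r_distr r_minus m_assoc)
      then show ?thesis unfolding ka(3) using s cl sc by (simp add: l_distr minus_eq a_ac)
    qed
    moreover have "a \<otimes> (s \<ominus> c) \<ominus> (c \<otimes> k) \<otimes> s [^] n \<in> ?V"
      by (intro subspace_minus[OF V] a1 subspaceD(5)[OF V] F_closed c ka(1) spn_base) auto
    ultimately have "k \<otimes> s [^] Suc n \<in> ?V"
      using subspace_add_cancel[OF V, of "k \<otimes> s [^] Suc n"] s cl by simp
    then have "k = \<zero>"
      using smult_cancel_subspace[OF ka(1) _ V, of "s [^] Suc n"] s na unfolding algebraic_mod_def
      by (metis nat_pow_closed)
    then have "g = a" using ka(3) cl by simp
    then show False using Suc.IH[of a] ka(2) Suc.prems(2) by simp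
  }
qed

text \<open>Amitsur's argument: uncountably many left inverses cannot be independent in an algebra of
  countable dimension.\<close>

lemma uncountable_inverses_algebraic:
  assumes gen: "generates Y" and I: "ideal I R" and s: "s \<in> carrier R"
    and unc: "uncountable B" and B: "B \<subseteq> F" "\<And>c. c \<in> B \<Longrightarrow> \<exists>y\<in>carrier R. y \<otimes> (s \<ominus> c) \<ominus> \<one> \<in> I"
  shows "algebraic_mod I s"
proof (rule ccontr)
  assume na: "\<not> algebraic_mod I s"
  have Y: "finite Y" "Y \<subseteq> carrier R" "\<And>a. a \<in> carrier R \<Longrightarrow> \<exists>n. a \<in> pss Y n"
    using gen by (auto simp: generates_def)
  note sI = subspace_ideal[OF I]
  note Ic = subspaceD(1)[OF sI]
  obtain y where y: "\<And>c. c \<in> B \<Longrightarrow> y c \<in> carrier R" "\<And>c. c \<in> B \<Longrightarrow> y c \<otimes> (s \<ominus> c) \<ominus> \<one> \<in> I"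
    using B(2) by metis
  \<comment> \<open>Countably many finite dimensional pieces cover all inverses, so one piece
    contains infinitely many of them.\<close>
  have "B = (\<Union>n. {c \<in> B. y c \<in> pss Y n})" using Y(3) y(1) by blast
  then obtain n where "uncountable {c \<in> B. y c \<in> pss Y n}"
    using unc countable_UN[of UNIV "\<lambda>n. {c \<in> B. y c \<in> pss Y n}"] by (metis countableI_type)
  then have "infinite {c \<in> B. y c \<in> pss Y n}" using countable_finite by blast
  then obtain b :: "nat \<Rightarrow> 'a" where b: "inj b" "range b \<subseteq> {c \<in> B. y c \<in> pss Y n}"
    using infinite_countable_subset by blast
  have bB: "b i \<in> B" "b i \<in> F" "y (b i) \<in> pss Y n" for i using b(2) B(1) by auto
  obtain T where T: "finite T" "T \<subseteq> carrier R" "pss Y n = spn T"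
    using pss_finite_spanning[OF Y(1,2)] by blast
  note W = subspace_polys[OF s]
  define V where "V = spn (polys s \<union> I)"
  have V: "subspace V" unfolding V_def using subspaceD(1)[OF W] Ic by (intro subspace_spn) auto
  have V_sup: "polys s \<subseteq> V" "I \<subseteq> V" unfolding V_def using spn_superset by blast+
  have "card T + 1 \<le> card T"
  proof (rule triangular_bound[OF T(1,2) Ic, where u = "\<lambda>i. y (b i)"])
    fix i assume "i < card T + 1"
    show "y (b i) \<in> spn (T \<union> I)" using bB(3)[of i] T(3) spn_mono[of T "T \<union> I"] by auto
    have pp: "linear_prod s b i \<in> polys s" by (intro linear_prod_polys s bB)
    then have pc: "linear_prod s b i \<in> carrier R" using subspaceD(2)[OF W] by blast
    \<comment> \<open>Clearing denominators: modulo \<open>I\<close> the product turns each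
      \<open>y (b l)\<close> with \<open>l < i\<close> into a polynomial in \<open>s\<close>,
      whereas \<open>b i\<close> is not one of its roots. If it did the same to
      \<open>y (b i)\<close>, then by the remainder theorem \<open>y (b i)\<close> itself would be a
      polynomial in \<open>s\<close> modulo \<open>I\<close>.\<close>
    let ?Z = "{z \<in> carrier R. z \<otimes> linear_prod s b i \<in> V}"
    have "I \<subseteq> ?Z" using ideal.I_r_closed[OF I _ pc] V_sup Ic by blast
    moreover have "y (b l) \<in> ?Z" if "l < i" for l
    proof -
      have "\<exists>q\<in>polys s. linear_prod s b i = (s \<ominus> b l) \<otimes> q"
        by (rule linear_prod_factor[OF s bB(2) that])
      then obtain q where q: "q \<in> polys s" "linear_prod s b i = (s \<ominus> b l) \<otimes> q" ..
      have cl: "q \<in> carrier R" "y (b l) \<in> carrier R" "s \<ominus> b l \<in> carrier R"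
        using subspaceD(2)[OF W q(1)] y(1)[OF bB(1)] shift_closed[OF s bB(2)] by auto
      have "(y (b l) \<otimes> (s \<ominus> b l) \<ominus> \<one>) \<otimes> q \<in> V"
        using ideal.I_r_closed[OF I y(2)[OF bB(1)] cl(1)] V_sup by blast
      moreover have "(y (b l) \<otimes> (s \<ominus> b l) \<ominus> \<one>) \<otimes> q = y (b l) \<otimes> linear_prod s b i \<ominus> q"
        unfolding q(2) using cl by (simp add: minus_eq l_distr l_minus m_assoc)
      ultimately have "y (b l) \<otimes> linear_prod s b i \<in> V"
        using subspace_diff_cancel[OF V] q(1) V_sup cl pc by auto
      then show ?thesis using cl by simp
    qed
    moreover have "y (b i) \<notin> ?Z"
    proof
      assume "y (b i) \<in> ?Z"
      then have inV: "y (b i) \<otimes> linear_prod s b i \<in> V" by simp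
      have "b l \<noteq> b i" if "l < i" for l using that injD[OF b(1)] by fastforce
      then have "\<exists>k\<in>F. \<exists>h\<in>polys s. k \<noteq> \<zero> \<and> linear_prod s b i = k \<oplus> (s \<ominus> b i) \<otimes> h"
        by (intro linear_prod_remainder s bB(2))
      then obtain k h where kh: "k \<in> F" "h \<in> polys s" "k \<noteq> \<zero>" "linear_prod s b i = k \<oplus> (s \<ominus> b i) \<otimes> h"
        by (elim bexE conjE)
      have cl: "h \<in> carrier R" "y (b i) \<in> carrier R" "s \<ominus> b i \<in> carrier R" "k \<in> carrier R"
        using subspaceD(2)[OF W kh(2)] y(1)[OF bB(1)] shift_closed[OF s bB(2)] F_carrier[OF kh(1)] by auto
      define e where "e = y (b i) \<otimes> (s \<ominus> b i) \<ominus> \<one>"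
      have e: "e \<in> I" "e \<in> carrier R" using y(2)[OF bB(1)] Ic unfolding e_def by auto
      have ee: "y (b i) \<otimes> (s \<ominus> b i) = e \<oplus> \<one>"
        unfolding e_def using cl by (simp add: minus_eq a_assoc l_neg)
      have "y (b i) \<otimes> linear_prod s b i = k \<otimes> y (b i) \<oplus> (y (b i) \<otimes> (s \<ominus> b i)) \<otimes> h"
        unfolding kh(4) using cl F_central[OF kh(1) cl(2)] by (simp add: r_distr m_assoc)
      also have "\<dots> = k \<otimes> y (b i) \<oplus> (e \<otimes> h \<oplus> h)" unfolding ee using cl e by (simp add: l_distr)
      finally have "k \<otimes> y (b i) \<oplus> (e \<otimes> h \<oplus> h) \<in> V" using inV by simp
      moreover have "e \<otimes> h \<oplus> h \<in> V"
        using ideal.I_r_closed[OF I e(1) cl(1)] kh(2) V_sup by (intro subspaceD(4)[OF V]) auto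
      ultimately have "k \<otimes> y (b i) \<in> V" using subspace_add_cancel[OF V] cl by simp
      then have "y (b i) \<in> V" using smult_cancel_subspace[OF kh(1,3) V _ cl(2)] by blast
      then obtain g j where gj: "g \<in> polys s" "j \<in> I" "y (b i) = g \<oplus> j"
        unfolding V_def spn_Un[OF W sI] by blast
      have "\<exists>m. g \<in> spn (powers s m \<union> I)"
      proof -
        have "polys s \<subseteq> {g. \<exists>m. g \<in> spn (powers s m \<union> I)}"
        proof (intro spn_min subspaceI)
          have sp: "subspace (spn (powers s m \<union> I))" for m using s Ic by (intro subspace_spn) auto
          show "{g. \<exists>m. g \<in> spn (powers s m \<union> I)} \<subseteq> carrier R" using subspaceD(2)[OF sp] by blast
          show "\<zero> \<in> {g. \<exists>m. g \<in> spn (powers s m \<union> I)}" using subspaceD(3)[OF sp] by blast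
          show "c \<otimes> a \<in> {g. \<exists>m. g \<in> spn (powers s m \<union> I)}"
            if "c \<in> F" "a \<in> {g. \<exists>m. g \<in> spn (powers s m \<union> I)}" for c a
            using that subspaceD(5)[OF sp] by blast
          show "range (\<lambda>i::nat. s [^] i) \<subseteq> {g. \<exists>m. g \<in> spn (powers s m \<union> I)}"
          proof (rule image_subsetI)
            fix i :: nat
            have "s [^] i \<in> spn (powers s (Suc i) \<union> I)" by (intro spn_base) auto
            then show "s [^] i \<in> {g. \<exists>m. g \<in> spn (powers s m \<union> I)}" by blast
          qed
          fix a a' assume "a \<in> {g. \<exists>m. g \<in> spn (powers s m \<union> I)}" "a' \<in> {g. \<exists>m. g \<in> spn (powers s m \<union> I)}"
          then obtain m m' where "a \<in> spn (powers s m \<union> I)" "a' \<in> spn (powers s m' \<union> I)" by blast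
          moreover have "spn (powers s m \<union> I) \<subseteq> spn (powers s (max m m') \<union> I)"
            "spn (powers s m' \<union> I) \<subseteq> spn (powers s (max m m') \<union> I)"
            by (intro spn_mono Un_mono image_mono; simp)+
          ultimately have "a \<oplus> a' \<in> spn (powers s (max m m') \<union> I)" using subspaceD(4)[OF sp] by blast
          then show "a \<oplus> a' \<in> {g. \<exists>m. g \<in> spn (powers s m \<union> I)}" by blast
        qed
        then show ?thesis using gj(1) by blast
      qed
      then obtain m where m: "g \<in> spn (powers s m \<union> I)" by blast
      have gc: "g \<in> carrier R" "j \<in> carrier R" using subspaceD(2)[OF W gj(1)] gj(2) Ic by auto
      have "(y (b i) \<otimes> (s \<ominus> b i) \<ominus> \<one>) \<ominus> j \<otimes> (s \<ominus> b i) \<in> I"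
        using y(2)[OF bB(1)] ideal.I_r_closed[OF I gj(2) cl(3)] by (rule subspace_minus[OF sI])
      moreover have "(y (b i) \<otimes> (s \<ominus> b i) \<ominus> \<one>) \<ominus> j \<otimes> (s \<ominus> b i) = g \<otimes> (s \<ominus> b i) \<ominus> \<one>"
        unfolding gj(3) using gc cl by (simp add: minus_eq l_distr a_ac r_neg1 r_neg2 r_neg)
      ultimately show False using not_algebraic_no_inverse[OF I s na bB(2) m] by simp
    qed
    ultimately show "\<exists>Z. subspace Z \<and> I \<subseteq> Z \<and> (\<forall>l<i. y (b l) \<in> Z) \<and> y (b i) \<notin> Z"
      using subspace_rvimage[OF V pc] by blast
  qed
  then show False by simp
qed

end

section \<open>Maximal left ideals with a core of linear growth\<close>

context central_subfield
begin

section \<open>Powers of words and algebraic words\<close>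

lemma word_val_replicate:
  assumes g: "g ` {..<l} \<subseteq> carrier R" and v: "v \<in> lists {..<l}"
  shows "word_val g (concat (replicate n v)) = word_val g v [^] n"
proof (induction n)
  case (Suc n)
  have "concat (replicate n v) \<in> lists {..<l}" using v by (induction n) auto
  then show ?case
    using Suc word_val_append[OF g v] nat_pow_Suc2[OF word_val_closed[OF g v]] by simp
qed (simp add: word_val_def)

text \<open>A monic relation of degree \<open>n\<close> rewrites the \<open>n\<close>-fold
  repetition of \<open>v\<close> into shorter repetitions, which are smaller words because
  \<open>v\<close> is nonempty.\<close>

lemma power_not_normal:
  assumes g: "g ` {..<l} \<subseteq> carrier R" and I: "ideal I R" and v: "v \<in> lists {..<l}" "v \<noteq> []"
    and n: "word_val g v [^] n \<in> spn (powers (word_val g v) n \<union> I)"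
  shows "\<not> normal g l I (concat (replicate n v))"
proof -
  have Ic: "I \<subseteq> carrier R" using subspaceD(1)[OF subspace_ideal[OF I]] .
  have *: "concat (replicate i v) \<in> lists {..<l}" for i using v(1) by (induction i) auto
  have len: "length (concat (replicate i v)) = i * length v" for i by (induction i) auto
  let ?A = "word_val g ` {w' \<in> lists {..<l}. w' < concat (replicate n v)} \<union> I"
  have "powers (word_val g v) n \<union> I \<subseteq> ?A"
  proof (intro Un_mono image_subsetI subset_refl)
    fix i assume "i \<in> {..<n}"
    then have "concat (replicate i v) < concat (replicate n v)"
      using v(2) by (simp add: list_less_def lenlex_conv len)
    then show "word_val g v [^] i \<in> word_val g ` {w' \<in> lists {..<l}. w' < concat (replicate n v)}"
      using * word_val_replicate[OF g v(1), of i] by (intro image_eqI[of _ _ "concat (replicate i v)"]) auto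
  qed
  then have "spn (powers (word_val g v) n \<union> I) \<subseteq> spn ?A" by (rule spn_mono)
  then have "word_val g (concat (replicate n v)) \<in> spn ?A"
    using n word_val_replicate[OF g v(1), of n] by auto
  then show ?thesis by (simp add: normal_def)
qed

lemma nth_concat_replicate:
  "v \<noteq> [] \<Longrightarrow> k < n * length v \<Longrightarrow> concat (replicate n v) ! k = v ! (k mod length v)"
proof (induction n arbitrary: k)
  case (Suc n)
  then show ?case by (cases "k < length v") (auto simp: nth_append le_mod_geq)
qed simp

text \<open>Few normal words force long normal words to contain high powers of short words, which is
  impossible if the short words are algebraic.\<close>

lemma algebraic_fincod:
  assumes gen: "generates (g ` {..<l})" and I: "ideal I R"
    and few: "card {w. normal g l I w \<and> length w = d} \<le> d"
    and alg: "\<And>s. s \<in> carrier R \<Longrightarrow> algebraic_mod I s"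
  shows "fincod I"
proof -
  have g: "g ` {..<l} \<subseteq> carrier R" and ex: "\<And>a. a \<in> carrier R \<Longrightarrow> \<exists>n. a \<in> pss (g ` {..<l}) n"
    using gen by (auto simp: generates_def)
  have Ic: "I \<subseteq> carrier R" using subspaceD(1)[OF subspace_ideal[OF I]] .
  define L where "L = {v. set v \<subseteq> {..<l} \<and> length v \<le> d}"
  have "finite L" unfolding L_def by (rule finite_lists_length_le) simp
  have "\<exists>n. word_val g v [^] n \<in> spn (powers (word_val g v) n \<union> I)" if "v \<in> L" for v
    using alg[of "word_val g v"] word_val_closed[OF g, of v] that unfolding algebraic_mod_def L_def by auto
  then obtain e :: "nat list \<Rightarrow> nat" where e: "\<And>v. v \<in> L \<Longrightarrow>
      word_val g v [^] e v \<in> spn (powers (word_val g v) (e v) \<union> I)" by metis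
  \<comment> \<open>There are finitely many words of length at most \<open>d\<close>, so their
    relations have a common degree bound.\<close>
  define N where "N = Max (insert 0 (e ` L))"
  have eN: "e v \<le> N" if "v \<in> L" for v
    unfolding N_def using that \<open>finite L\<close> by (intro Max_ge) auto
  \<comment> \<open>This length has room for the preperiod (at most \<open>d\<close> letters), for
    \<open>e v\<close> periods (at most \<open>N * d\<close> letters) and for the last
    \<open>d\<close> letters, where periodicity is not asserted.\<close>
  have short: "length w < (N + 3) * d + 1" if w: "normal g l I w" for w
  proof (rule ccontr)
    assume "\<not> ?thesis"
    then have long: "(N + 3) * d + 1 \<le> length w" by simp
    have "\<exists>i q. 0 < q \<and> i + q \<le> d \<and> (\<forall>t\<ge>i. t + d < length w \<longrightarrow> w ! t = w ! (t + q))"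
    proof (rule eventually_periodic_words[of "Collect (normal g l I)"])
      show "v \<in> Collect (normal g l I)" if "u @ v @ w \<in> Collect (normal g l I)" for u v w
        using normal_factor[OF g I, of u v w] that by simp
      show "2 * d \<le> length w" using long by (simp add: algebra_simps)
    qed (use few w finite_normal[of g l I d] in auto)
    then obtain i q where iq: "0 < q" "i + q \<le> d" "\<And>t. i \<le> t \<Longrightarrow> t + d < length w \<Longrightarrow> w ! t = w ! (t + q)"
      by blast
    define v where "v = take q (drop i w)"
    have iqw: "i + q \<le> length w" using iq(2) long by (simp add: algebra_simps)
    have lv: "length v = q" "v \<noteq> []" unfolding v_def using iq(1) iqw by auto
    have wl: "w \<in> lists {..<l}" using w by (simp add: normal_def)
    have vl: "v \<in> lists {..<l}" using wl set_take_subset[of q "drop i w"] set_drop_subset[of i w] unfolding v_def by auto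
    have vL: "v \<in> L" using vl lv iq by (auto simp: L_def)
    let ?m = "e v * q"
    have "?m \<le> N * d" using eN[OF vL] iq by (intro mult_le_mono) auto
    then have room: "i + ?m + d < length w" using iq long by (simp add: algebra_simps)
    have per: "w ! (i + k) = v ! (k mod q)" if "k < ?m" for k
      using that
    proof (induction k rule: less_induct)
      case (less k)
      show ?case
      proof (cases "k < q")
        case True
        then show ?thesis using iqw by (simp add: v_def)
      next
        case False
        then have "w ! (i + k) = w ! (i + (k - q))"
          using iq(3)[of "i + (k - q)"] room less.prems by simp
        also have "\<dots> = v ! ((k - q) mod q)" using less.prems False iq(1) by (intro less.IH) auto
        finally show ?thesis using False by (simp add: le_mod_geq)
      qed
    qed
    have len: "length (concat (replicate (e v) v)) = ?m" using lv by (simp add: length_concat sum_list_replicate)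
    have "take ?m (drop i w) = concat (replicate (e v) v)"
    proof (rule nth_equalityI)
      show "length (take ?m (drop i w)) = length (concat (replicate (e v) v))" using room len by simp
      fix k assume "k < length (take ?m (drop i w))"
      then have "k < ?m" by simp
      then show "take ?m (drop i w) ! k = concat (replicate (e v) v) ! k"
        using per[of k] nth_concat_replicate[of v k "e v"] lv room by simp
    qed
    then have "w = take i w @ concat (replicate (e v) v) @ drop ?m (drop i w)"
      by (metis append_take_drop_id)
    then have "normal g l I (concat (replicate (e v) v))" using normal_factor[OF g I] w by metis
    then show False using power_not_normal[OF g I vl lv(2) e[OF vL]] by blast
  qed
  let ?N = "{w. normal g l I w \<and> length w \<le> (N + 3) * d + 1}"
  have Nc: "word_val g ` ?N \<subseteq> carrier R" using word_val_closed[OF g] by (auto simp: normal_def)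
  have "carrier R \<subseteq> spn (word_val g ` ?N \<union> I)"
  proof
    fix a assume "a \<in> carrier R"
    then obtain n where "a \<in> pss (g ` {..<l}) n" using ex by blast
    moreover have "pss (g ` {..<l}) n \<subseteq> spn (word_val g ` ?N \<union> I)"
      unfolding power_sum_space_word_val
    proof (intro spn_subset_spn image_subsetI)
      fix w assume w: "w \<in> {w \<in> lists {..<l}. length w \<le> n}"
      then have "word_val g w \<in> spn (word_val g ` {w'. normal g l I w' \<and> w' \<le> w} \<union> I)"
        by (intro normal_spanning[OF g Ic]) auto
      moreover have "{w'. normal g l I w' \<and> w' \<le> w} \<subseteq> ?N" using short less_imp_le by blast
      ultimately show "word_val g w \<in> spn (word_val g ` ?N \<union> I)"
        using spn_mono[of "word_val g ` {w'. normal g l I w' \<and> w' \<le> w} \<union> I" "word_val g ` ?N \<union> I"] by blast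
    qed (use Ic Nc in auto)
    ultimately show "a \<in> spn (word_val g ` ?N \<union> I)" by blast
  qed
  then show ?thesis
    using finite_normal(2)[of g l I "(N + 3) * d + 1"] Nc Ic by (intro fincodI[of "word_val g ` ?N"]) auto
qed

section \<open>Simple modules R/L of infinite dimension\<close>

definition maximal_left_ideal :: "'a set \<Rightarrow> bool"
  where "maximal_left_ideal L \<longleftrightarrow> left_ideal R L \<and> L \<noteq> carrier R \<and>
    (\<forall>J. left_ideal R J \<longrightarrow> L \<subseteq> J \<longrightarrow> J = L \<or> J = carrier R)"

text \<open>Simplicity of \<open>R/L\<close> in usable form: for \<open>z \<notin> L\<close> the
  left ideal \<open>Rz + L\<close> is everything.\<close>

lemma maximal_left_ideal_inverse:
  assumes L: "maximal_left_ideal L" and z: "z \<in> carrier R" "z \<notin> L" and r: "r \<in> carrier R"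
  obtains y where "y \<in> carrier R" "r \<ominus> y \<otimes> z \<in> L"
proof -
  have lL: "left_ideal R L" using L by (simp add: maximal_left_ideal_def)
  let ?J = "{r \<otimes> z \<oplus> j | r j. r \<in> carrier R \<and> j \<in> L}"
  have "?J = carrier R"
    using L z(2) left_ideal_sum[OF lL z(1)] left_ideal_sum_superset[OF lL z(1)]
    unfolding maximal_left_ideal_def by blast
  then have "r \<in> ?J" using r by simp
  then obtain y j where y: "y \<in> carrier R" "j \<in> L" "r = y \<otimes> z \<oplus> j" by blast
  have "r \<ominus> y \<otimes> z = j"
  proof -
    have "y \<otimes> z \<in> carrier R" "j \<in> carrier R" using y z(1) left_ideal_closed[OF lL] by auto
    then show ?thesis unfolding y(3) by (simp add: minus_eq a_ac r_neg r_neg1 r_neg2)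
  qed
  then show thesis using that y by blast
qed

text \<open>If \<open>y \<otimes> z\<close> is \<one> modulo \<open>L\<close>, then
  \<open>((L : z) : y) \<subseteq> L\<close>. Finite codimension of \<open>(L : z)\<close> would
  therefore pass to \<open>L\<close> by \<open>fincod_colon\<close>.\<close>

lemma infinite_codim_colon:
  assumes L: "maximal_left_ideal L" and inf: "\<not> fincod L" and z: "z \<in> carrier R" "z \<notin> L"
  shows "\<not> fincod {r \<in> carrier R. r \<otimes> z \<in> L}"
proof
  have lL: "left_ideal R L" using L by (simp add: maximal_left_ideal_def)
  note sL = subspace_left_ideal[OF lL]
  note Lc = left_ideal_closed[OF lL]
  let ?J = "{r \<in> carrier R. r \<otimes> z \<in> L}"
  assume fc: "fincod ?J"
  obtain y where y: "y \<in> carrier R" "\<one> \<ominus> y \<otimes> z \<in> L"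
    using maximal_left_ideal_inverse[OF L z one_closed] by blast
  have "fincod {r \<in> carrier R. r \<otimes> y \<in> ?J}"
    by (rule fincod_colon[OF fc subspace_rvimage[OF sL z(1)] y(1)])
  moreover have "{r \<in> carrier R. r \<otimes> y \<in> ?J} \<subseteq> L"
  proof
    fix r assume "r \<in> {r \<in> carrier R. r \<otimes> y \<in> ?J}"
    then have r: "r \<in> carrier R" "r \<otimes> (y \<otimes> z) \<in> L" using y z by (auto simp: m_assoc)
    have "r \<otimes> (\<one> \<ominus> y \<otimes> z) \<in> L" using left_idealD[OF lL r(1) y(2)] .
    moreover have "r \<otimes> (\<one> \<ominus> y \<otimes> z) = r \<ominus> r \<otimes> (y \<otimes> z)"
      using r y z by (simp add: minus_eq r_distr r_minus)
    ultimately show "r \<in> L" using subspace_diff_cancel[OF sL _ r(2,1)] by simp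
  qed
  ultimately show False using fincod_mono inf Lc by blast
qed

text \<open>The finite length argument: a maximal left ideal of infinite codimension whose core \<open>P\<close> has
  linear growth would make \<open>R/P\<close> semisimple and algebraic, hence finite dimensional.\<close>

theorem maximal_left_ideal_fincod:
  assumes gen: "generates (g ` {..<l})" and unc: "uncountable F" and P: "ideal P R"
    and few: "card {w. normal g l P w \<and> length w = d} \<le> d"
    and L: "maximal_left_ideal L" and core: "P = {r \<in> carrier R. \<forall>s\<in>carrier R. r \<otimes> s \<in> L}"
  shows "fincod L"
proof (rule ccontr)
  assume inf: "\<not> fincod L"
  have lL: "left_ideal R L" using L by (simp add: maximal_left_ideal_def)
  note sL = subspace_left_ideal[OF lL] and Lc = left_ideal_closed[OF lL] and sP = subspace_ideal[OF P]
  note Pc = subspaceD(1)[OF sP]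
  have PL: "P \<subseteq> L"
  proof
    fix r assume r: "r \<in> P"
    then have "r \<otimes> \<one> \<in> L" unfolding core by blast
    then show "r \<in> L" using r Pc by auto
  qed
  have g: "g ` {..<l} \<subseteq> carrier R" using gen by (simp add: generates_def)
  obtain C where lin: "linear_growth (g ` {..<l}) P C" using normal_linear_growth[OF g P few] .
  note chain = chain_length_bound[OF gen lin Pc]
  note colon = infinite_codim_colon[OF L inf]
  \<comment> \<open>The left annihilator of the classes of \<open>M\<close> in \<open>R/L\<close>.
    If \<open>M\<close> is finite and \<open>A M \<subseteq> P\<close>, then \<open>R/P\<close>
    embeds in a finite power of \<open>R/L\<close>.\<close>
  define A where "A M = {r \<in> carrier R. \<forall>m\<in>M. r \<otimes> m \<in> L}" for M
  have lA: "left_ideal R (A M)" if "M \<subseteq> carrier R" for M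
  proof (rule left_idealI)
    have "A M = carrier R \<inter> (\<Inter>m\<in>M. {r \<in> carrier R. r \<otimes> m \<in> L})" by (auto simp: A_def)
    moreover have "subspace {r \<in> carrier R. r \<otimes> m \<in> L}" if "m \<in> M" for m
      using that \<open>M \<subseteq> carrier R\<close> by (intro subspace_rvimage sL) auto
    ultimately show "subspace (A M)" using subspace_carrier by (auto simp: subspace_def)
    fix r a assume "r \<in> carrier R" "a \<in> A M"
    then show "r \<otimes> a \<in> A M" using left_idealD[OF lL] that by (auto simp: A_def m_assoc subset_iff)
  qed
  have PA: "P \<subseteq> A M" if "M \<subseteq> carrier R" for M using that unfolding A_def core by auto
  have "\<exists>M. finite M \<and> M \<subseteq> carrier R \<and> A M \<subseteq> P"
  proof (rule ccontr)
    assume no: "\<not> ?thesis"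
    have "\<exists>s m. s \<in> A M \<and> m \<in> carrier R \<and> s \<otimes> m \<notin> L" if M: "finite M" "M \<subseteq> carrier R" for M
    proof -
      obtain s where s: "s \<in> A M" "s \<notin> P" using no M by blast
      then show ?thesis unfolding core by (auto simp: A_def)
    qed
    then obtain s m where sm: "\<And>M. finite M \<Longrightarrow> M \<subseteq> carrier R \<Longrightarrow> s M \<in> A M \<and> m M \<in> carrier R \<and> s M \<otimes> m M \<notin> L"
      by metis
    \<comment> \<open>Each step adds an \<open>m\<close> whose class is not killed by some
      \<open>s\<close> that kills all previous classes, so the annihilators descend with infinite
      dimensional factors.\<close>
    define M where "M = rec_nat {} (\<lambda>_ S. insert (m S) S)"
    have M: "M 0 = {}" "M (Suc k) = insert (m (M k)) (M k)" for k by (simp_all add: M_def)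
    have Mf: "finite (M k) \<and> M k \<subseteq> carrier R" for k by (induction k) (auto simp: M sm)
    note smk = sm[OF conjunct1[OF Mf] conjunct2[OF Mf]]
    have Mmono: "M k \<subseteq> M k'" if "k \<le> k'" for k k' using that by (induction rule: dec_induct) (auto simp: M)
    have sc: "s (M k) \<in> carrier R" for k using smk[of k] by (auto simp: A_def)
    have "C + 1 \<le> C"
    \<comment> \<open>The length bound is for ascending chains, so the descending one is cut off
      after \<open>C + 1\<close> steps and read backwards.\<close>
    proof (rule chain[where D = "\<lambda>i. A (M (Suc (C - i)))" and a = "\<lambda>i. s (M (C - i))"])
      fix i i' assume "i < C + 1" "i' < i"
      then have "M (Suc (C - i)) \<subseteq> M (C - i')" by (intro Mmono) simp
      then show "s (M (C - i')) \<in> A (M (Suc (C - i)))" using smk[of "C - i'"] by (auto simp: A_def)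
    next
      fix i
      let ?k = "C - i"
      have "{r \<in> carrier R. r \<otimes> s (M ?k) \<in> A (M (Suc ?k))} \<subseteq> {r \<in> carrier R. r \<otimes> (s (M ?k) \<otimes> m (M ?k)) \<in> L}"
        using smk[of ?k] sc by (auto simp: A_def M m_assoc)
      then show "\<not> fincod {r \<in> carrier R. r \<otimes> s (M ?k) \<in> A (M (Suc ?k))}"
        using colon[of "s (M ?k) \<otimes> m (M ?k)"] smk[of ?k] sc fincod_mono by (metis (no_types, lifting) m_closed mem_Collect_eq subsetI)
    qed (use Mf lA PA sc in auto)
    then show False by simp
  qed
  then obtain M where M: "finite M" "M \<subseteq> carrier R" "A M \<subseteq> P" by blast
  \<comment> \<open>\<open>R/P\<close> is built from copies of \<open>R/L\<close>, so every nonzero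
    quotient should be infinite dimensional. Annihilated classes are removed one at a time, which
    lifts \<open>A N \<subseteq> J\<close> from \<open>N = M\<close> to \<open>N = {}\<close>, where
    \<open>A N\<close> is \<open>R\<close>.\<close>
  have no_fincod: "J = carrier R" if J: "left_ideal R J" "fincod J" "P \<subseteq> J" for J
  proof -
    have "J = carrier R" if "finite N" "N \<subseteq> carrier R" "A N \<subseteq> J" for N
      using that
    proof (induction N rule: finite_induct)
      case empty
      then show ?case using left_ideal_closed[OF J(1)] by (auto simp: A_def)
    next
      case (insert m N)
      note sJ = subspace_left_ideal[OF J(1)]
      have m: "m \<in> carrier R" "N \<subseteq> carrier R" using insert.prems by auto
      have "A N \<subseteq> J"
      \<comment> \<open>Via multiplication by \<open>m\<close>, the factor of \<open>A N\<close> by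
        \<open>A (insert m N)\<close> is zero or a copy of the simple module \<open>R/L\<close>.
        Either \<open>J\<close> covers it, or \<open>J\<close> meets it trivially and an element of
        \<open>A N\<close> outside \<open>J\<close> generates an infinite dimensional piece of
        \<open>R/J\<close>.\<close>
      proof (cases "A N \<inter> J \<subseteq> A (insert m N)")
        case False
        then obtain y where y: "y \<in> A N" "y \<in> J" "y \<notin> A (insert m N)" by blast
        have yc: "y \<in> carrier R" using y(1) by (auto simp: A_def)
        have ym: "y \<otimes> m \<in> carrier R" "y \<otimes> m \<notin> L" using y m by (auto simp: A_def)
        show ?thesis
        proof
          fix z assume z: "z \<in> A N"
          then have zc: "z \<in> carrier R" by (auto simp: A_def)
          obtain r where r: "r \<in> carrier R" "z \<otimes> m \<ominus> r \<otimes> (y \<otimes> m) \<in> L"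
            using maximal_left_ideal_inverse[OF L ym, of "z \<otimes> m"] zc m by blast
          have ry: "r \<otimes> y \<in> A N" "r \<otimes> y \<in> J" using left_idealD lA[OF m(2)] J(1) y r by blast+
          have "z \<ominus> r \<otimes> y \<in> A N" using subspace_minus[OF subspace_left_ideal[OF lA[OF m(2)]] z ry(1)] .
          moreover have "(z \<ominus> r \<otimes> y) \<otimes> m \<in> L"
            using r zc yc m by (simp add: minus_eq l_distr l_minus m_assoc)
          ultimately have "z \<ominus> r \<otimes> y \<in> J" using insert.prems by (auto simp: A_def)
          then show "z \<in> J" using subspace_diff_cancel[OF sJ _ ry(2) zc] by blast
        qed
      next
        case sub: True
        show ?thesis
        proof (rule ccontr)
          assume "\<not> A N \<subseteq> J"
          then obtain y where y: "y \<in> A N" "y \<notin> J" by blast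
          have yc: "y \<in> carrier R" using y(1) by (auto simp: A_def)
          have "y \<notin> A (insert m N)" using y insert.prems by blast
          then have ym: "y \<otimes> m \<in> carrier R" "y \<otimes> m \<notin> L" using y m by (auto simp: A_def)
          have "{r \<in> carrier R. r \<otimes> y \<in> J} \<subseteq> {r \<in> carrier R. r \<otimes> (y \<otimes> m) \<in> L}"
          proof
            fix r assume r: "r \<in> {r \<in> carrier R. r \<otimes> y \<in> J}"
            then have "r \<otimes> y \<in> A N \<inter> J" using left_idealD[OF lA[OF m(2)] _ y(1)] by blast
            then have "r \<otimes> y \<in> A (insert m N)" using sub by blast
            then show "r \<in> {r \<in> carrier R. r \<otimes> (y \<otimes> m) \<in> L}" using r yc m by (simp add: A_def m_assoc)
          qed
          then have "fincod {r \<in> carrier R. r \<otimes> (y \<otimes> m) \<in> L}"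
            using fincod_mono[OF fincod_colon[OF J(2) sJ yc]] by blast
          then show False using colon[OF ym] by blast
        qed
      qed
      then show ?case using insert.IH m(2) by blast
    qed
    then show ?thesis using M J(3) by blast
  qed
  have lP: "left_ideal R P" by (rule left_ideal_ideal[OF P])
  \<comment> \<open>Right multiplication that is injective on \<open>R/P\<close> is surjective:
    otherwise the left ideals \<open>R t\<^sup>k + P\<close> descend with factors
    \<open>R/(Rt + P)\<close>, infinite dimensional by \<open>no_fincod\<close>.\<close>
  have regular: "{r \<otimes> t \<oplus> p | r p. r \<in> carrier R \<and> p \<in> P} = carrier R"
    if t: "t \<in> carrier R" and reg: "\<And>r. r \<in> carrier R \<Longrightarrow> r \<otimes> t \<in> P \<Longrightarrow> r \<in> P" for t
  proof (rule ccontr)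
    let ?J = "\<lambda>t. {r \<otimes> t \<oplus> p | r p. r \<in> carrier R \<and> p \<in> P}"
    assume ne: "?J t \<noteq> carrier R"
    have regk: "r \<in> P" if "r \<in> carrier R" "r \<otimes> t [^] k \<in> P" for r and k :: nat
      using that
    proof (induction k)
      case (Suc k)
      have "(r \<otimes> t [^] k) \<otimes> t \<in> P" using Suc.prems t by (simp add: m_assoc)
      then show ?case using reg[of "r \<otimes> t [^] k"] Suc t by simp
    qed simp
    have tk: "t [^] k \<in> carrier R" for k :: nat using t by simp
    have "C + 1 \<le> C"
    proof (rule chain[where D = "\<lambda>i. ?J (t [^] (Suc (C - i)))" and a = "\<lambda>i. t [^] (C - i)"])
      fix i show "left_ideal R (?J (t [^] (Suc (C - i))))" by (rule left_ideal_sum[OF lP tk])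
      show "P \<subseteq> ?J (t [^] (Suc (C - i)))" by (rule left_ideal_sum_superset[OF lP tk])
      show "t [^] (C - i) \<in> carrier R" by (rule tk)
    next
      fix i i' assume "i < C + 1" "i' < i"
      have "C - i' = (i - i' - 1) + Suc (C - i)" using \<open>i < C + 1\<close> \<open>i' < i\<close> by simp
      then have "t [^] (C - i') = t [^] (i - i' - 1) \<otimes> t [^] (Suc (C - i))"
        using nat_pow_mult[OF t, of "i - i' - 1" "Suc (C - i)"]
        by (simp only:)
      moreover have "t [^] (i - i' - 1) \<otimes> t [^] (Suc (C - i)) \<in> ?J (t [^] (Suc (C - i)))"
        by (rule left_idealD[OF left_ideal_sum[OF lP tk] tk left_ideal_sum_superset(2)[OF lP tk]])
      ultimately show "t [^] (C - i') \<in> ?J (t [^] (Suc (C - i)))" by (simp only:)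
    next
      fix i
      let ?k = "C - i"
      have "{r \<in> carrier R. r \<otimes> t [^] ?k \<in> ?J (t [^] Suc ?k)} \<subseteq> ?J t"
      proof
        fix r assume "r \<in> {r \<in> carrier R. r \<otimes> t [^] ?k \<in> ?J (t [^] Suc ?k)}"
        then obtain y p where r: "r \<in> carrier R" and y: "y \<in> carrier R" "p \<in> P" "r \<otimes> t [^] ?k = y \<otimes> t [^] Suc ?k \<oplus> p"
          by blast
        have pc: "p \<in> carrier R" using y(2) Pc by blast
        have "(r \<ominus> y \<otimes> t) \<otimes> t [^] ?k = r \<otimes> t [^] ?k \<ominus> y \<otimes> t [^] Suc ?k"
          using r y t nat_pow_Suc2[OF t, of ?k] by (simp add: minus_eq l_distr l_minus m_assoc)
        also have "\<dots> = p" unfolding y(3) using y(1) t pc by (simp add: minus_eq a_ac r_neg r_neg1 r_neg2)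
        finally have "r \<ominus> y \<otimes> t \<in> P" using regk[of "r \<ominus> y \<otimes> t" ?k] y r t by simp
        moreover have "r = y \<otimes> t \<oplus> (r \<ominus> y \<otimes> t)" using r y t by (simp add: minus_eq a_ac r_neg r_neg1 r_neg2)
        ultimately show "r \<in> ?J t" using y by blast
      qed
      moreover have "\<not> fincod (?J t)"
        using ne no_fincod[OF left_ideal_sum[OF lP t]] left_ideal_sum_superset(1)[OF lP t] by blast
      ultimately show "\<not> fincod {r \<in> carrier R. r \<otimes> t [^] ?k \<in> ?J (t [^] Suc ?k)}"
        using fincod_mono left_ideal_closed[OF left_ideal_sum[OF lP t]] by blast
    qed
    then show False by simp
  qed
  have "algebraic_mod P s" if s: "s \<in> carrier R" for s
  proof -
    \<comment> \<open>The eigenvalues of right multiplication by \<open>s\<close> on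
      \<open>R/P\<close>; \<open>a\<close> is an eigenvector.\<close>
    define Bad where "Bad = {c \<in> F. \<exists>a\<in>carrier R. a \<otimes> (s \<ominus> c) \<in> P \<and> a \<notin> P}"
    have "finite Bad"
    proof (rule ccontr)
      assume "infinite Bad"
      then obtain b :: "nat \<Rightarrow> 'a" where b: "inj b" "range b \<subseteq> Bad" using infinite_countable_subset by blast
      have bF: "b i \<in> F" for i using b(2) by (auto simp: Bad_def)
      have "\<exists>a\<in>carrier R. a \<otimes> (s \<ominus> b i) \<in> P \<and> a \<notin> P" for i using b(2) by (auto simp: Bad_def)
      then obtain a where a: "\<And>i. a i \<in> carrier R" "\<And>i. a i \<otimes> (s \<ominus> b i) \<in> P" "\<And>i. a i \<notin> P" by metis
      have pc: "linear_prod s b i \<in> carrier R" for i by (intro linear_prod_closed s bF)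
      have ev: "z \<otimes> linear_prod s b i \<otimes> (s \<ominus> b j) \<in> P" if z: "z \<in> carrier R" "z \<otimes> (s \<ominus> b j) \<in> P" for z i j
      proof -
        have "linear_prod s b i \<otimes> (s \<ominus> b j) = (s \<ominus> b j) \<otimes> linear_prod s b i"
          by (rule polys_shift(2)[OF s bF linear_prod_polys[OF s bF]])
        then have "z \<otimes> linear_prod s b i \<otimes> (s \<ominus> b j) = z \<otimes> (s \<ominus> b j) \<otimes> linear_prod s b i"
          using z(1) pc shift_closed[OF s bF[of j]] by (simp add: m_assoc)
        then show ?thesis using ideal.I_r_closed[OF P z(2) pc] by simp
      qed
      \<comment> \<open>\<open>b j\<close> differs from the first \<open>i\<close> scalars, so the
        linear factors can be cancelled one by one.\<close>
      have descend: "z \<in> P" if "z \<in> carrier R" "z \<otimes> (s \<ominus> b j) \<in> P" "z \<otimes> linear_prod s b i \<in> P" "i \<le> j" for z i j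
        using that(3,4)
      proof (induction i)
        case 0 then show ?case using that(1) by simp
      next
        case (Suc i)
        have "b j \<noteq> b i" using Suc.prems injD[OF b(1)] by fastforce
        moreover have "z \<otimes> linear_prod s b i \<otimes> (s \<ominus> b i) \<in> P"
          using Suc.prems that(1) pc shift_closed[OF s bF[of i]] by (simp add: m_assoc)
        ultimately have "z \<otimes> linear_prod s b i \<in> P"
          using shift_mult_mod(2)[OF sP _ s bF bF ev[OF that(1,2)], of i i] that(1) pc by simp
        then show ?case using Suc by simp
      qed
      have "C + 1 \<le> C"
      \<comment> \<open>\<open>linear_prod s b i\<close> kills the eigenvectors \<open>a l\<close>
        with \<open>l < i\<close>, but acts on multiples of \<open>a i\<close> by a nonzero scalar
        modulo \<open>P\<close>. Eigenvectors to distinct eigenvalues thus yield an ascending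
        chain.\<close>
      proof (rule chain[where D = "\<lambda>i. {r \<in> carrier R. r \<otimes> linear_prod s b i \<in> P}" and a = a])
        fix i show "left_ideal R {r \<in> carrier R. r \<otimes> linear_prod s b i \<in> P}"
          using left_idealD[OF lP] pc[of i] by (intro left_idealI subspace_rvimage sP pc) (auto simp: m_assoc)
        show "P \<subseteq> {r \<in> carrier R. r \<otimes> linear_prod s b i \<in> P}" using ideal.I_r_closed[OF P _ pc] Pc by blast
      next
        fix i i' :: nat assume i: "i' < i"
        have "a i' \<otimes> linear_prod s b k \<in> P" if "Suc i' \<le> k" for k
          using that
        proof (induction k rule: dec_induct)
          case base then show ?case using ev[OF a(1,2), of i' i'] a(1) pc shift_closed[OF s bF] by (simp add: m_assoc)
        next
          case (step k)
          then show ?case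
            using ideal.I_r_closed[OF P step.IH shift_closed[OF s bF[of k]]] a(1) pc shift_closed[OF s bF] by (simp add: m_assoc)
        qed
        then show "a i' \<in> {r \<in> carrier R. r \<otimes> linear_prod s b i \<in> P}" using i a(1) by simp
      next
        fix i
        have "\<exists>m\<in>carrier R. a i \<otimes> m \<notin> L" using a(1,3)[of i] unfolding core by blast
        then obtain m where m: "m \<in> carrier R" "a i \<otimes> m \<notin> L" by blast
        have "{r \<in> carrier R. r \<otimes> a i \<in> {r \<in> carrier R. r \<otimes> linear_prod s b i \<in> P}} \<subseteq>
            {r \<in> carrier R. r \<otimes> (a i \<otimes> m) \<in> L}"
        proof
          fix r assume "r \<in> {r \<in> carrier R. r \<otimes> a i \<in> {r \<in> carrier R. r \<otimes> linear_prod s b i \<in> P}}"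
          then have r: "r \<in> carrier R" "r \<otimes> a i \<otimes> linear_prod s b i \<in> P" by auto
          have "r \<otimes> a i \<otimes> (s \<ominus> b i) \<in> P"
            using left_idealD[OF lP r(1) a(2)[of i]] r(1) a(1) shift_closed[OF s bF] by (simp add: m_assoc)
          then have "r \<otimes> a i \<in> P" using descend[of "r \<otimes> a i" i i] r a(1) by simp
          then have "r \<otimes> a i \<otimes> m \<in> L" using m(1) unfolding core by blast
          then show "r \<in> {r \<in> carrier R. r \<otimes> (a i \<otimes> m) \<in> L}" using r(1) a(1) m(1) by (simp add: m_assoc)
        qed
        moreover have "\<not> fincod {r \<in> carrier R. r \<otimes> (a i \<otimes> m) \<in> L}" using colon m a(1) by simp
        ultimately show "\<not> fincod {r \<in> carrier R. r \<otimes> a i \<in> {r \<in> carrier R. r \<otimes> linear_prod s b i \<in> P}}"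
          using fincod_mono by blast
      qed (use a in auto)
      then show False by simp
    qed
    show ?thesis
    proof (rule uncountable_inverses_algebraic[OF gen P s])
      \<comment> \<open>For the remaining scalars \<open>s \<ominus> c\<close> acts injectively,
        hence surjectively, on \<open>R/P\<close>, which supplies the left inverses for Amitsur's
        count.\<close>
      show "uncountable (F - Bad)" using unc \<open>finite Bad\<close> by (simp add: countable_finite uncountable_minus_countable)
      fix c assume c: "c \<in> F - Bad"
      have sc: "s \<ominus> c \<in> carrier R" using shift_closed[OF s] c by blast
      have "\<one> \<in> {r \<otimes> (s \<ominus> c) \<oplus> p | r p. r \<in> carrier R \<and> p \<in> P}"
        using regular[OF sc] c by (auto simp: Bad_def)
      then obtain y p where y: "y \<in> carrier R" "p \<in> P" "\<one> = y \<otimes> (s \<ominus> c) \<oplus> p" by blast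
      have "y \<otimes> (s \<ominus> c) \<ominus> \<one> = \<ominus> p"
        unfolding y(3) using y(1,2) sc Pc by (auto simp: minus_eq minus_add a_ac r_neg r_neg1 r_neg2)
      then show "\<exists>y\<in>carrier R. y \<otimes> (s \<ominus> c) \<ominus> \<one> \<in> P" using y(1) subspace_uminus[OF sP y(2)] by metis
    qed auto
  qed
  then have "fincod P" by (intro algebraic_fincod[OF gen P few])
  then show False using inf fincod_mono[OF _ PL Lc] by blast
qed

end

section \<open>Left regular elements in prime Goldie rings\<close>

text \<open>The ideals to which primeness is applied are annihilators modulo \<open>P\<close> and
  not generated ideals: \<open>?I\<close> and \<open>?J\<close> contain \<open>a\<close> and
  \<open>b\<close>, and their product falls into \<open>P\<close> by construction.\<close>

lemma (in ring) prime_two_sided_elements: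
  assumes P: "prime_two_sided R P" and ab: "a \<in> carrier R" "b \<in> carrier R"
    and prod: "\<And>r. r \<in> carrier R \<Longrightarrow> a \<otimes> r \<otimes> b \<in> P"
  shows "a \<in> P \<or> b \<in> P"
proof -
  interpret P: ideal P R using P by (simp add: prime_two_sided_def)
  let ?I = "{x \<in> carrier R. \<forall>r\<in>carrier R. x \<otimes> r \<otimes> b \<in> P}"
  let ?J = "{y \<in> carrier R. \<forall>x\<in>?I. \<forall>r\<in>carrier R. x \<otimes> r \<otimes> y \<in> P}"
  have I: "ideal ?I R"
  proof (rule idealI)
    show "subgroup ?I (add_monoid R)"
    proof (rule add.subgroupI)
      show "?I \<noteq> {}" using ab by (auto intro!: exI[of _ \<zero>])
    next
      fix x assume "x \<in> ?I"
      then show "\<ominus> x \<in> ?I" using ab by (auto simp: l_minus)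
    next
      fix x y assume "x \<in> ?I" "y \<in> ?I"
      then show "x \<oplus> y \<in> ?I" using ab by (auto simp: l_distr)
    qed auto
    fix x s assume x: "x \<in> ?I" and s: "s \<in> carrier R"
    show "s \<otimes> x \<in> ?I"
    proof (intro CollectI conjI ballI)
      fix r assume r: "r \<in> carrier R"
      then have "x \<otimes> r \<otimes> b \<in> P" using x by blast
      then have "s \<otimes> (x \<otimes> r \<otimes> b) \<in> P" using s by (rule P.I_l_closed)
      then show "s \<otimes> x \<otimes> r \<otimes> b \<in> P" using x s r ab by (simp add: m_assoc)
    qed (use x s in auto)
    show "x \<otimes> s \<in> ?I"
    proof (intro CollectI conjI ballI)
      fix r assume r: "r \<in> carrier R"
      then have "x \<otimes> (s \<otimes> r) \<otimes> b \<in> P" using x s by auto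
      then show "x \<otimes> s \<otimes> r \<otimes> b \<in> P" using x s r ab by (simp add: m_assoc)
    qed (use x s in auto)
  qed (rule ring_axioms)
  have J: "ideal ?J R"
  proof (rule idealI)
    show "subgroup ?J (add_monoid R)"
    proof (rule add.subgroupI)
      show "?J \<noteq> {}" by (auto intro!: exI[of _ \<zero>])
    next
      fix x assume "x \<in> ?J"
      then show "\<ominus> x \<in> ?J" by (auto simp: r_minus)
    next
      fix x y assume "x \<in> ?J" "y \<in> ?J"
      then show "x \<oplus> y \<in> ?J" by (auto simp: r_distr)
    qed auto
    fix y s assume y: "y \<in> ?J" and s: "s \<in> carrier R"
    show "s \<otimes> y \<in> ?J"
    proof (intro CollectI conjI ballI)
      fix x r assume x: "x \<in> ?I" and r: "r \<in> carrier R"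
      have "x \<otimes> (r \<otimes> s) \<otimes> y \<in> P" using x s r y by blast
      then show "x \<otimes> r \<otimes> (s \<otimes> y) \<in> P" using x s r y by (simp add: m_assoc)
    qed (use y s in auto)
    show "y \<otimes> s \<in> ?J"
    proof (intro CollectI conjI ballI)
      fix x r assume x: "x \<in> ?I" and r: "r \<in> carrier R"
      have "x \<otimes> r \<otimes> y \<in> P" using x r y by blast
      then have "(x \<otimes> r \<otimes> y) \<otimes> s \<in> P" using s by (rule P.I_r_closed)
      then show "x \<otimes> r \<otimes> (y \<otimes> s) \<in> P" using x s r y by (simp add: m_assoc)
    qed (use y s in auto)
  qed (rule ring_axioms)
  have "ideal_prod R ?I ?J \<subseteq> P"
  proof
    fix z assume "z \<in> ideal_prod R ?I ?J"
    then show "z \<in> P"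
    proof induction
      case (prod i j)
      then have "i \<otimes> \<one> \<otimes> j \<in> P" by blast
      then show ?case using prod by simp
    qed auto
  qed
  then have "?I \<subseteq> P \<or> ?J \<subseteq> P" using P I J unfolding prime_two_sided_def by blast
  moreover have "a \<in> ?I" "b \<in> ?J" using ab prod by auto
  ultimately show ?thesis by blast
qed

context ring
begin

section \<open>Annihilators of elements under the ascending chain condition\<close>

abbreviation lann :: "'a \<Rightarrow> 'a set" where "lann a \<equiv> left_annihilator R {a}"

lemma lann_iff: "r \<in> lann a \<longleftrightarrow> r \<in> carrier R \<and> r \<otimes> a = \<zero>"
  by (simp add: left_annihilator_def)

lemma acc_lann_sequence:
  assumes acc: "acc_left_annihilators R" and f: "\<And>n :: nat. f n \<in> carrier R" "\<And>n. lann (f n) \<subseteq> lann (f (Suc n))"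
  shows "\<exists>N. \<forall>n\<ge>N. lann (f n) = lann (f N)"
  using acc[unfolded acc_left_annihilators_def, rule_format, of "\<lambda>n. lann (f n)"] f by blast

lemma acc_lann_maximal:
  assumes acc: "acc_left_annihilators R" and S: "S \<subseteq> carrier R" "S \<noteq> {}"
  obtains a where "a \<in> S" "\<And>b. b \<in> S \<Longrightarrow> lann a \<subseteq> lann b \<Longrightarrow> lann b = lann a"
proof (rule ccontr)
  assume "\<not> thesis"
  then have "\<forall>a\<in>S. \<exists>b\<in>S. lann a \<subset> lann b" using that by blast
  then obtain h where h: "\<And>a. a \<in> S \<Longrightarrow> h a \<in> S" "\<And>a. a \<in> S \<Longrightarrow> lann a \<subset> lann (h a)" by metis
  obtain a0 where "a0 \<in> S" using S(2) by blast
  then have fS: "(h ^^ n) a0 \<in> S" for n by (induction n) (auto simp: h)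
  then have strict: "lann ((h ^^ n) a0) \<subset> lann ((h ^^ Suc n) a0)" for n using h(2) by simp
  then obtain N where "\<And>n. n \<ge> N \<Longrightarrow> lann ((h ^^ n) a0) = lann ((h ^^ N) a0)"
    using acc_lann_sequence[OF acc, of "\<lambda>n. (h ^^ n) a0"] fS S(1) by blast
  then show False using strict[of N] by (metis le_Suc_eq order_refl psubset_eq)
qed

text \<open>In a nil left ideal, a nonzero \<open>a\<close> with maximal annihilator would satisfy
  \<open>a \<otimes> r \<otimes> a = \<zero>\<close> for all \<open>r\<close>: otherwise the last
  nonzero \<open>a \<otimes> (r \<otimes> a) [^] m\<close> has the same annihilator as
  \<open>a\<close>, and \<open>a \<otimes> r\<close> kills it. Primeness then gives
  \<open>a = \<zero>\<close>.\<close>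

lemma exists_nonnilpotent:
  assumes prime: "prime_ring R" and acc: "acc_left_annihilators R"
    and N: "left_ideal R N" "N \<subseteq> carrier R" "N \<noteq> {\<zero>}"
  shows "\<exists>a\<in>N. \<forall>n::nat. a [^] n \<noteq> \<zero>"
proof (rule ccontr)
  assume "\<not> ?thesis"
  then have nil: "\<And>a. a \<in> N \<Longrightarrow> \<exists>n::nat. a [^] n = \<zero>" by blast
  interpret N: additive_subgroup N R using N(1) by (simp add: left_ideal_def)
  have Nl: "\<And>r a. r \<in> carrier R \<Longrightarrow> a \<in> N \<Longrightarrow> r \<otimes> a \<in> N" using N(1) by (simp add: left_ideal_def)
  have "N - {\<zero>} \<noteq> {}" using N(3) N.zero_closed by blast
  then obtain a where a: "a \<in> N - {\<zero>}"
    "\<And>b. b \<in> N - {\<zero>} \<Longrightarrow> lann a \<subseteq> lann b \<Longrightarrow> lann b = lann a"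
    using acc_lann_maximal[OF acc, of "N - {\<zero>}"] N(2) by blast
  have ac: "a \<in> carrier R" using a(1) N(2) by blast
  have "a \<otimes> r \<otimes> a = \<zero>" if r: "r \<in> carrier R" for r
  proof (rule ccontr)
    assume ne: "a \<otimes> r \<otimes> a \<noteq> \<zero>"
    define b where "b n = a \<otimes> (r \<otimes> a) [^] n" for n :: nat
    have ra: "r \<otimes> a \<in> carrier R" "r \<otimes> a \<in> N" using r ac Nl a(1) by auto
    obtain n0 :: nat where "(r \<otimes> a) [^] n0 = \<zero>" using nil ra(2) by blast
    then have b0: "b n0 = \<zero>" using ac by (simp add: b_def)
    have b1: "b 1 \<noteq> \<zero>" using ne r ac by (simp add: b_def m_assoc)
    define n where "n = (LEAST n. b n = \<zero>)"
    have n: "b n = \<zero>" "\<And>k. k < n \<Longrightarrow> b k \<noteq> \<zero>"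
      using b0 unfolding n_def by (auto intro: LeastI dest: not_less_Least)
    have "b 0 \<noteq> \<zero>" using a(1) ac by (simp add: b_def)
    then obtain m where m: "n = Suc m" "0 < m"
      using n(1) b1 by (cases n; cases "n = 1") (auto simp: gr0_conv_Suc)
    have bS: "b (Suc k) = (a \<otimes> r) \<otimes> b k" for k
      unfolding b_def using r ac ra(1) nat_pow_Suc2[OF ra(1), of k] by (simp add: m_assoc)
    have bN: "b k \<in> N" for k
      by (induction k) (use a(1) ac r Nl in \<open>auto simp: bS b_def[of 0]\<close>)
    have "lann a \<subseteq> lann (b m)"
    proof
      fix s assume "s \<in> lann a"
      then have s: "s \<in> carrier R" "s \<otimes> a = \<zero>" by (auto simp: lann_iff)
      then have "s \<otimes> b m = (s \<otimes> a) \<otimes> (r \<otimes> a) [^] m"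
        using m_assoc[OF s(1) ac, of "(r \<otimes> a) [^] m"] ra(1) unfolding b_def by (metis nat_pow_closed)
      then show "s \<in> lann (b m)" using s ra by (simp add: lann_iff)
    qed
    then have eq: "lann (b m) = lann a" using a(2)[of "b m"] bN[of m] n(2)[of m] m by auto
    have "(a \<otimes> r) \<otimes> b m = \<zero>" using n(1) bS[of m] m(1) by simp
    then have "a \<otimes> r \<in> lann (b m)" using ac r by (simp add: lann_iff)
    then have "a \<otimes> r \<in> lann a" unfolding eq .
    then show False using ne by (simp add: lann_iff)
  qed
  then have "a \<in> {\<zero>}"
    using prime_two_sided_elements[of "{\<zero>}" a a] prime ac by (auto simp: prime_ring_def)
  then show False using a(1) by blast
qed

text \<open>The annihilators of the powers of a non-nilpotent \<open>b\<close> ascend and become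
  stationary, and a late power \<open>a\<close> has the property. It says that \<open>Ra\<close>
  meets \<open>lann a\<close> only in zero.\<close>

lemma exists_stable_annihilator:
  assumes prime: "prime_ring R" and acc: "acc_left_annihilators R"
    and N: "left_ideal R N" "N \<subseteq> carrier R" "N \<noteq> {\<zero>}"
  shows "\<exists>a\<in>N. a \<noteq> \<zero> \<and> lann (a \<otimes> a) = lann a"
proof -
  obtain b where b: "b \<in> N" "\<And>n::nat. b [^] n \<noteq> \<zero>" using exists_nonnilpotent[OF assms] by blast
  have bc: "b \<in> carrier R" using b N by blast
  have step: "lann (b [^] Suc n) \<subseteq> lann (b [^] Suc (Suc n))" for n
  proof
    fix s assume "s \<in> lann (b [^] Suc n)"
    then have s: "s \<in> carrier R" "s \<otimes> b [^] Suc n = \<zero>" by (auto simp: lann_iff)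
    have "s \<otimes> b [^] Suc (Suc n) = (s \<otimes> b [^] Suc n) \<otimes> b" using s(1) bc by (simp add: m_assoc)
    then show "s \<in> lann (b [^] Suc (Suc n))" using s bc by (simp add: lann_iff del: nat_pow_Suc)
  qed
  obtain M where M: "\<And>n. n \<ge> M \<Longrightarrow> lann (b [^] Suc n) = lann (b [^] Suc M)"
    using acc_lann_sequence[OF acc, of "\<lambda>n. b [^] Suc n"] step bc by auto
  have "b [^] Suc M \<otimes> b [^] Suc M = b [^] Suc (M + Suc M)" using nat_pow_mult[OF bc, of "Suc M" "Suc M"] by simp
  then have "lann (b [^] Suc M \<otimes> b [^] Suc M) = lann (b [^] Suc M)" using M[of "M + Suc M"] by simp
  \<comment> \<open>The exponent is positive, which keeps the power inside the left ideal.\<close>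
  moreover have "b [^] Suc M \<in> N" using N(1) b(1) bc by (simp add: left_ideal_def)
  ultimately show ?thesis using b(2) by blast
qed

text \<open>Right multiplication of the relation by \<open>a i\<close> kills the later terms by
  orthogonality and the earlier ones by induction. What remains is
  \<open>r i \<otimes> a i \<otimes> a i = \<zero>\<close>, and stability removes one factor
  \<open>a i\<close>.\<close>

lemma stable_sequence_independent:
  fixes n :: nat
  assumes a: "\<And>i. i < n \<Longrightarrow> a i \<in> carrier R" "\<And>i. i < n \<Longrightarrow> lann (a i \<otimes> a i) = lann (a i)"
    "\<And>i j. i < j \<Longrightarrow> j < n \<Longrightarrow> a j \<otimes> a i = \<zero>"
    and r: "\<And>i. i < n \<Longrightarrow> r i \<in> carrier R" and sum: "(\<Oplus>i\<in>{..<n}. r i \<otimes> a i) = \<zero>"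
    and i: "i < n"
  shows "r i \<otimes> a i = \<zero>"
  using i
proof (induction i rule: less_induct)
  case (less i)
  have cl: "(\<lambda>i. r i \<otimes> a i) \<in> {..<n} \<rightarrow> carrier R" using a(1) r by auto
  have "(\<Oplus>j\<in>{..<n}. r j \<otimes> a j) \<otimes> a i = (\<Oplus>j\<in>{..<n}. (r j \<otimes> a j) \<otimes> a i)"
    using a(1) less.prems cl by (intro finsum_ldistr) auto
  also have "\<dots> = (\<Oplus>j\<in>{..<n}. if i = j then (r i \<otimes> a i) \<otimes> a i else \<zero>)"
  proof (rule finsum_cong')
    fix j assume j: "j \<in> {..<n}"
    show "(r j \<otimes> a j) \<otimes> a i = (if i = j then (r i \<otimes> a i) \<otimes> a i else \<zero>)"
    proof (cases "i = j")
      case False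
      show ?thesis
      proof (cases "j < i")
        case True
        then show ?thesis using less.IH[of j] less.prems a(1) by auto
      next
        case F: False
        then show ?thesis using False a(3)[of i j] j a(1)[of i] a(1)[of j] r[of j] less.prems by (simp add: m_assoc)
      qed
    qed simp
  qed (use a(1) r less.prems in auto)
  also have "\<dots> = (r i \<otimes> a i) \<otimes> a i"
    using less.prems a(1) r by (intro add.finprod_singleton) auto
  finally have "r i \<otimes> (a i \<otimes> a i) = \<zero>" unfolding sum using a(1) r less.prems by (simp add: m_assoc)
  then have "r i \<in> lann (a i \<otimes> a i)" using r less.prems by (simp add: lann_iff)
  then show ?case using a(2)[OF less.prems] by (simp add: lann_iff)
qed

text \<open>The elements are chosen successively inside the left annihilators of the previous ones; finite
  uniform dimension stops the process, and their sum is left regular.\<close>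

theorem ideal_contains_left_regular:
  assumes prime: "prime_ring R" and Goldie: "left_Goldie R" and I: "ideal I R" "I \<noteq> {\<zero>}"
  obtains c where "c \<in> I" "\<And>r. r \<in> carrier R \<Longrightarrow> r \<otimes> c = \<zero> \<Longrightarrow> r = \<zero>"
proof -
  interpret I: ideal I R by (rule I(1))
  have acc: "acc_left_annihilators R" and nosum: "\<nexists>J. infinite_left_direct_sum R J"
    using Goldie by (auto simp: left_Goldie_def)
  define A where "A M = {r \<in> I. \<forall>a\<in>M. r \<otimes> a = \<zero>}" for M
  have lA: "left_ideal R (A M)" if "M \<subseteq> carrier R" for M
    unfolding left_ideal_def
  proof (intro conjI ballI additive_subgroup.intro add.subgroupI)
    show "A M \<subseteq> carrier R" by (auto simp: A_def I.Icarr)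
    show "A M \<noteq> {}" using that by (auto simp: A_def intro!: exI[of _ \<zero>])
    show "\<ominus> x \<in> A M" if "x \<in> A M" for x using that \<open>M \<subseteq> carrier R\<close> by (auto simp: A_def l_minus I.Icarr)
    show "x \<oplus> y \<in> A M" if "x \<in> A M" "y \<in> A M" for x y
      using that \<open>M \<subseteq> carrier R\<close> by (auto simp: A_def l_distr I.Icarr subset_iff)
    show "r \<otimes> x \<in> A M" if "r \<in> carrier R" "x \<in> A M" for r x
      using that \<open>M \<subseteq> carrier R\<close> by (auto simp: A_def m_assoc I.Icarr I.I_l_closed subset_iff)
  qed
  have "\<exists>a. A M \<noteq> {\<zero>} \<longrightarrow> a \<in> A M \<and> a \<noteq> \<zero> \<and> lann (a \<otimes> a) = lann a" if "M \<subseteq> carrier R" for M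
  proof -
    have "A M \<subseteq> carrier R" by (auto simp: A_def I.Icarr)
    then show ?thesis using exists_stable_annihilator[OF prime acc lA[OF that]] by blast
  qed
  then obtain h where h: "\<And>M. M \<subseteq> carrier R \<Longrightarrow> A M \<noteq> {\<zero>} \<Longrightarrow>
      h M \<in> A M \<and> h M \<noteq> \<zero> \<and> lann (h M \<otimes> h M) = lann (h M)" by metis
  \<comment> \<open>The set of chosen elements stays constant once its left annihilator inside
    \<open>I\<close> is zero, so the recursion is defined before it is known to stop.\<close>
  define M where "M = rec_nat {} (\<lambda>_ S. if A S = {\<zero>} then S else insert (h S) S)"
  have M: "M 0 = {}" "M (Suc k) = (if A (M k) = {\<zero>} then M k else insert (h (M k)) (M k))" for k
    by (simp_all add: M_def)
  have Mc: "M k \<subseteq> carrier R" for k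
  proof (induction k)
    case (Suc k) then show ?case using h[of "M k"] by (auto simp: M A_def I.Icarr)
  qed (simp add: M)
  have Mmono: "M k \<subseteq> M k'" if "k \<le> k'" for k k' using that by (induction rule: dec_induct) (auto simp: M)
  define a where "a k = h (M k)" for k
  have good: "a k \<in> A (M k)" "a k \<noteq> \<zero>" "lann (a k \<otimes> a k) = lann (a k)" "a k \<in> I"
    if "A (M k) \<noteq> {\<zero>}" for k
    using h[OF Mc that] by (auto simp: a_def A_def)
  have ortho: "a j \<otimes> a i = \<zero>" if "i < j" "A (M i) \<noteq> {\<zero>}" "A (M j) \<noteq> {\<zero>}" for i j
  proof -
    have "a i \<in> M (Suc i)" using that(2) by (simp add: M a_def)
    then have "a i \<in> M j" using Mmono[of "Suc i" j] that(1) by auto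
    then show ?thesis using good(1)[OF that(3)] by (simp add: A_def)
  qed
  have "\<exists>k. A (M k) = {\<zero>}"
  proof (rule ccontr)
    assume "\<not> ?thesis"
    then have ne: "A (M k) \<noteq> {\<zero>}" for k by blast
    note g = good[OF ne]
    have ac: "a k \<in> carrier R" for k using g(4) I.Icarr by blast
    have "infinite_left_direct_sum R (\<lambda>k. (\<lambda>r. r \<otimes> a k) ` carrier R)"
      unfolding infinite_left_direct_sum_def
    proof (intro conjI allI impI)
      fix k
      show "left_ideal R ((\<lambda>r. r \<otimes> a k) ` carrier R)"
        unfolding left_ideal_def
      proof (intro conjI ballI additive_subgroup.intro add.subgroupI)
        show "(\<lambda>r. r \<otimes> a k) ` carrier R \<subseteq> carrier R" using ac by auto
        show "(\<lambda>r. r \<otimes> a k) ` carrier R \<noteq> {}" by auto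
        show "\<ominus> x \<in> (\<lambda>r. r \<otimes> a k) ` carrier R" if "x \<in> (\<lambda>r. r \<otimes> a k) ` carrier R" for x
          using that ac by (auto simp: l_minus[symmetric])
        show "x \<oplus> y \<in> (\<lambda>r. r \<otimes> a k) ` carrier R"
          if "x \<in> (\<lambda>r. r \<otimes> a k) ` carrier R" "y \<in> (\<lambda>r. r \<otimes> a k) ` carrier R" for x y
          using that ac by (auto simp: l_distr[symmetric])
        show "r \<otimes> x \<in> (\<lambda>r. r \<otimes> a k) ` carrier R" if "r \<in> carrier R" "x \<in> (\<lambda>r. r \<otimes> a k) ` carrier R" for r x
          using that ac by (auto simp: m_assoc[symmetric])
      qed
      have "\<one> \<otimes> a k \<in> (\<lambda>r. r \<otimes> a k) ` carrier R" by (intro imageI) simp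
      then show "(\<lambda>r. r \<otimes> a k) ` carrier R \<noteq> {\<zero>}" using g(2)[of k] ac[of k] by auto
    next
      fix n x i
      assume x: "(\<forall>i\<le>n. x i \<in> (\<lambda>r. r \<otimes> a i) ` carrier R) \<and> (\<Oplus>i\<in>{..n}. x i) = \<zero>" and i: "i \<le> n"
      then have "\<forall>i\<in>{..n}. \<exists>r. r \<in> carrier R \<and> x i = r \<otimes> a i" by blast
      then obtain r where r: "\<And>i. i \<le> n \<Longrightarrow> r i \<in> carrier R" "\<And>i. i \<le> n \<Longrightarrow> x i = r i \<otimes> a i"
        by (metis atMost_iff)
      have "(\<Oplus>i\<in>{..<Suc n}. r i \<otimes> a i) = (\<Oplus>i\<in>{..n}. x i)"
        unfolding lessThan_Suc_atMost using r ac by (intro finsum_cong') auto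
      then have "r i \<otimes> a i = \<zero>"
        using x i r ac g(3) ortho[OF _ ne ne] by (intro stable_sequence_independent[of "Suc n" a r]) auto
      then show "x i = \<zero>" using r(2)[OF i] by simp
    qed
    then show False using nosum by blast
  qed
  then obtain k where k: "A (M k) = {\<zero>}" "\<And>i. i < k \<Longrightarrow> A (M i) \<noteq> {\<zero>}"
    using LeastI_ex[of "\<lambda>k. A (M k) = {\<zero>}"] not_less_Least[of _ "\<lambda>k. A (M k) = {\<zero>}"] by blast
  note g = good[OF k(2)]
  have ac: "a i \<in> carrier R" if "i < k" for i using g(4)[OF that] I.Icarr by blast
  have Mk: "M i \<subseteq> a ` {..<i}" if "i \<le> k" for i
    using that by (induction i) (auto simp: M a_def k(2) less_Suc_eq)
  define c where "c = (\<Oplus>i\<in>{..<k}. a i)"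
  have "c \<in> I"
  proof -
    have "m \<le> k \<Longrightarrow> (\<Oplus>i\<in>{..<m}. a i) \<in> I" for m
    proof (induction m)
      case (Suc m)
      have "(\<Oplus>i\<in>{..<Suc m}. a i) = a m \<oplus> (\<Oplus>i\<in>{..<m}. a i)"
        unfolding lessThan_Suc using Suc.prems ac by (intro finsum_insert) auto
      then show ?case using Suc g(4)[of m] by simp
    qed simp
    then show ?thesis by (simp add: c_def)
  qed
  moreover have "r = \<zero>" if r: "r \<in> carrier R" "r \<otimes> c = \<zero>" for r
  proof -
    have "r \<otimes> c = (\<Oplus>i\<in>{..<k}. r \<otimes> a i)" unfolding c_def using ac r by (intro finsum_rdistr) auto
    then have ra: "r \<otimes> a i = \<zero>" if "i < k" for i
      using r ac g(3) ortho k(2) that by (intro stable_sequence_independent[of k a "\<lambda>_. r"]) auto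
    \<comment> \<open>\<open>r\<close> need not lie in \<open>I\<close>, so it is multiplied into
      \<open>I\<close>: every \<open>z \<otimes> s \<otimes> r\<close> kills all chosen elements and
      is therefore zero. Primeness disposes of \<open>z\<close>.\<close>
    obtain z where z: "z \<in> I" "z \<noteq> \<zero>" using I(2) I.zero_closed by blast
    have "z \<otimes> s \<otimes> r = \<zero>" if s: "s \<in> carrier R" for s
    proof -
      have zc: "z \<in> carrier R" using z(1) I.Icarr by blast
      have "z \<otimes> s \<otimes> r \<in> I" using z(1) s r(1) by (intro I.I_r_closed) auto
      moreover have "(z \<otimes> s \<otimes> r) \<otimes> b = \<zero>" if b: "b \<in> M k" for b
      proof -
        obtain i where "i < k" "b = a i" using Mk[of k] b by auto
        then show ?thesis using ra[of i] ac[of i] zc s r(1) by (simp add: m_assoc)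
      qed
      ultimately have "z \<otimes> s \<otimes> r \<in> A (M k)" by (simp add: A_def)
      then show ?thesis using k(1) by simp
    qed
    then have "z \<in> {\<zero>} \<or> r \<in> {\<zero>}"
      using prime z(1) r(1) I.Icarr by (intro prime_two_sided_elements) (auto simp: prime_ring_def)
    then show ?thesis using z(2) by simp
  qed
  ultimately show thesis using that by blast
qed

end

section \<open>The standard identity\<close>

lemma (in field_algebra) central_subfield:
  assumes "\<one>\<^bsub>R\<^esub> \<noteq> \<zero>\<^bsub>R\<^esub>"
  shows "central_subfield R (\<phi> ` carrier K)"
proof -
  interpret h: ring_hom_ring K R \<phi>
    by (intro ring_hom_ringI2 K.ring_axioms R.ring_axioms structure_hom)
  have "subfield (\<phi> ` carrier K) R"
    using h.img_is_subfield(2)[OF K.carrier_is_subfield assms] .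
  then show ?thesis
    by (intro central_subfield.intro central_subfield_axioms.intro R.ring_axioms)
      (auto intro: structure_central)
qed

context central_subfield
begin

lemma finsum_in_subspace:
  assumes "finite A" "subspace V" "\<And>a. a \<in> A \<Longrightarrow> h a \<in> V"
  shows "(\<Oplus>a\<in>A. h a) \<in> V"
  using assms(1,3)
proof (induction A rule: finite_induct)
  case empty then show ?case using subspaceD(3)[OF assms(2)] by simp
next
  case (insert a A)
  then have "h \<in> A \<rightarrow> carrier R" "h a \<in> carrier R" using subspaceD(2)[OF assms(2)] by auto
  then show ?case using insert subspaceD(4)[OF assms(2)] by simp
qed

definition perm_sign :: "(nat \<Rightarrow> nat) \<Rightarrow> 'a"
  where "perm_sign p = (if evenperm p then \<one> else \<ominus> \<one>)"

definition standard_poly :: "nat \<Rightarrow> (nat \<Rightarrow> 'a) \<Rightarrow> 'a"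
  where "standard_poly N \<rho> =
    (\<Oplus>p\<in>{p. p permutes {..<N}}. perm_sign p \<otimes> list_prod R (map (\<rho> \<circ> p) [0..<N]))"

lemma perm_sign_closed: "perm_sign p \<in> carrier R" "perm_sign p \<in> F"
  using F_one F_closed(3) by (auto simp: perm_sign_def)

lemma list_prod_map_closed:
  "range \<rho> \<subseteq> carrier R \<Longrightarrow> list_prod R (map \<rho> w) \<in> carrier R"
  "range \<rho> \<subseteq> carrier R \<Longrightarrow> list_prod R (map (\<rho> \<circ> p) w) \<in> carrier R"
  by (intro list_prod_closed; auto)+

text \<open>Composition with the transposition of \<open>a\<close> and \<open>b\<close> matches even
  with odd permutations, and matched terms cancel. No division by 2 occurs, so the characteristic is
  arbitrary.\<close>

lemma standard_poly_alternating:
  assumes \<rho>: "range \<rho> \<subseteq> carrier R" and ab: "a < N" "b < N" "a \<noteq> b" "\<rho> a = \<rho> b"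
  shows "standard_poly N \<rho> = \<zero>"
proof -
  define h where "h p = perm_sign p \<otimes> list_prod R (map (\<rho> \<circ> p) [0..<N])" for p
  define E where "E = {p. p permutes {..<N} \<and> evenperm p}"
  define D where "D = {p. p permutes {..<N} \<and> \<not> evenperm p}"
  define \<tau> where "\<tau> p = transpose a b \<circ> p" for p :: "nat \<Rightarrow> nat"
  have hc: "h p \<in> carrier R" for p
    unfolding h_def using perm_sign_closed(1) list_prod_map_closed[OF \<rho>] by (intro m_closed)
  have fin: "finite E" "finite D"
    using finite_permutations[of "{..<N}"] unfolding E_def D_def by (auto intro: rev_finite_subset)
  have trans: "transpose a b permutes {..<N}" using ab by (intro permutes_swap_id) auto
  have perm: "\<tau> p permutes {..<N}" if "p permutes {..<N}" for p
    unfolding \<tau>_def using that trans by (rule permutes_compose)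
  have flip: "evenperm (\<tau> p) \<longleftrightarrow> \<not> evenperm p" if "p permutes {..<N}" for p
    unfolding \<tau>_def using that ab trans permutation_permutes
    by (subst evenperm_comp) (auto simp: evenperm_swap permutation_permutes)
  have inv: "\<tau> (\<tau> p) = p" for p by (simp add: \<tau>_def fun_eq_iff)
  have bij: "D = \<tau> ` E" "inj_on \<tau> E"
  proof -
    show "inj_on \<tau> E" by (rule inj_on_inverseI[of _ \<tau>]) (rule inv)
    show "D = \<tau> ` E"
    proof
      show "D \<subseteq> \<tau> ` E"
      proof
        fix p assume "p \<in> D"
        then have "\<tau> p \<in> E" using perm flip by (auto simp: D_def E_def)
        then show "p \<in> \<tau> ` E" using inv[of p] by (metis imageI)
      qed
    qed (use perm flip in \<open>auto simp: D_def E_def\<close>)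
  qed
  have swap: "h (\<tau> p) = \<ominus> h p" if "p \<in> E" for p
  proof -
    have "\<rho> (transpose a b x) = \<rho> x" for x using ab(4) by (simp add: transpose_def)
    then have "\<rho> \<circ> \<tau> p = \<rho> \<circ> p" by (simp add: \<tau>_def fun_eq_iff)
    moreover have "perm_sign (\<tau> p) = \<ominus> perm_sign p"
      using that flip[of p] by (simp add: perm_sign_def E_def)
    ultimately show ?thesis unfolding h_def using perm_sign_closed list_prod_map_closed[OF \<rho>] by (simp add: l_minus)
  qed
  have "{p. p permutes {..<N}} = E \<union> D" by (auto simp: E_def D_def)
  then have "standard_poly N \<rho> = (\<Oplus>p\<in>E \<union> D. h p)" by (simp add: standard_poly_def h_def)
  also have "\<dots> = (\<Oplus>p\<in>E. h p) \<oplus> (\<Oplus>p\<in>D. h p)"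
    by (rule finsum_Un_disjoint[OF fin]) (use hc in \<open>auto simp: E_def D_def\<close>)
  also have "(\<Oplus>p\<in>D. h p) = (\<Oplus>p\<in>E. h (\<tau> p))"
    unfolding bij(1) using bij(2) hc by (intro finsum_reindex) auto
  also have "(\<Oplus>p\<in>E. h p) \<oplus> (\<Oplus>p\<in>E. h (\<tau> p)) = (\<Oplus>p\<in>E. h p \<oplus> h (\<tau> p))"
    using hc by (intro finsum_addf[symmetric]) auto
  also have "\<dots> = (\<Oplus>p\<in>E. \<zero>)" using swap hc by (intro finsum_cong') (auto simp: r_neg)
  finally show ?thesis by simp
qed

text \<open>In the summand of \<open>p\<close> the variable \<open>\<rho> i\<close> stands at the
  single place \<open>j\<close> with \<open>p j = i\<close>; \<open>A p\<close> and
  \<open>B p\<close> collect what stands before and after it.\<close>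

lemma standard_poly_linear:
  assumes \<rho>: "range \<rho> \<subseteq> carrier R" and i: "i < N"
  obtains A B :: "(nat \<Rightarrow> nat) \<Rightarrow> 'a" where "\<And>p. A p \<in> carrier R" "\<And>p. B p \<in> carrier R"
    "\<And>z. z \<in> carrier R \<Longrightarrow> standard_poly N (\<rho>(i := z)) =
      (\<Oplus>p\<in>{p. p permutes {..<N}}. A p \<otimes> z \<otimes> B p)"
proof -
  define pre where "pre p = list_prod R (map (\<rho> \<circ> p) [0..<inv_into UNIV p i])" for p
  define B where "B p = list_prod R (map (\<rho> \<circ> p) [Suc (inv_into UNIV p i)..<N])" for p
  define A where "A p = perm_sign p \<otimes> pre p" for p
  have pc: "pre p \<in> carrier R" for p unfolding pre_def by (rule list_prod_map_closed[OF \<rho>])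
  have Bc: "B p \<in> carrier R" for p unfolding B_def by (rule list_prod_map_closed[OF \<rho>])
  have Ac: "A p \<in> carrier R" for p using pc perm_sign_closed by (simp add: A_def)
  have eq: "perm_sign p \<otimes> list_prod R (map (\<rho>(i := z) \<circ> p) [0..<N]) = A p \<otimes> z \<otimes> B p"
    if p: "p permutes {..<N}" and z: "z \<in> carrier R" for p z
  proof -
    define j where "j = inv_into UNIV p i"
    have pj: "p j = i" unfolding j_def using p by (simp add: permutes_inverses)
    have j: "j < N" using permutes_in_image[OF p, of j] pj i by simp
    have ne: "p k \<noteq> i" if "k \<noteq> j" for k using permutes_inj[OF p] pj that by (metis injD)
    have "[0..<N] = [0..<j] @ j # [Suc j..<N]" using j by (metis le_add_diff_inverse less_imp_le upt_add_eq_append upt_conv_Cons zero_le)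
    then have "map (\<rho>(i := z) \<circ> p) [0..<N] =
        map (\<rho>(i := z) \<circ> p) [0..<j] @ z # map (\<rho>(i := z) \<circ> p) [Suc j..<N]" using pj by simp
    also have "map (\<rho>(i := z) \<circ> p) [0..<j] = map (\<rho> \<circ> p) [0..<j]" using ne by auto
    also have "map (\<rho>(i := z) \<circ> p) [Suc j..<N] = map (\<rho> \<circ> p) [Suc j..<N]" using ne by auto
    finally have "list_prod R (map (\<rho>(i := z) \<circ> p) [0..<N]) =
        list_prod R (map (\<rho> \<circ> p) [0..<j] @ z # map (\<rho> \<circ> p) [Suc j..<N])" by (rule arg_cong)
    also have "\<dots> = pre p \<otimes> (z \<otimes> B p)"
      using list_prod_append[of "map (\<rho> \<circ> p) [0..<j]" "z # map (\<rho> \<circ> p) [Suc j..<N]"] z \<rho>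
      unfolding pre_def B_def j_def[symmetric] by (auto simp: image_subset_iff)
    finally have "list_prod R (map (\<rho>(i := z) \<circ> p) [0..<N]) = pre p \<otimes> (z \<otimes> B p)" .
    then show ?thesis using pc Bc z perm_sign_closed by (simp add: A_def m_assoc)
  qed
  have "standard_poly N (\<rho>(i := z)) = (\<Oplus>p\<in>{p. p permutes {..<N}}. A p \<otimes> z \<otimes> B p)"
    if z: "z \<in> carrier R" for z
    unfolding standard_poly_def using Ac Bc z eq by (intro finsum_cong') auto
  then show thesis using that[of A B] Ac Bc by blast
qed

text \<open>Among \<open>N\<close> elements of a space of dimension less than \<open>N\<close>, some
  \<open>\<rho> i\<close> is a combination of its predecessors modulo \<open>P\<close>. By linearity
  in that variable and alternation, only terms in \<open>P\<close> survive.\<close>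

lemma standard_poly_in_ideal:
  assumes P: "ideal P R" and T: "finite T" "T \<subseteq> carrier R" "card T < N" "spn (T \<union> P) = carrier R"
    and \<rho>: "range \<rho> \<subseteq> carrier R"
  shows "standard_poly N \<rho> \<in> P"
proof -
  note sP = subspace_ideal[OF P]
  note Pc = subspaceD(1)[OF sP]
  have \<rho>c: "\<rho> i \<in> carrier R" for i using \<rho> by auto
  have "\<not> (\<forall>i<N. \<rho> i \<notin> spn (\<rho> ` {..<i} \<union> P))"
    using chain_bound[OF T(1,2) Pc, of N \<rho>] T(3,4) \<rho>c by auto
  then obtain i where i: "i < N" "\<rho> i \<in> spn (\<rho> ` {..<i} \<union> P)" by blast
  obtain A B :: "(nat \<Rightarrow> nat) \<Rightarrow> 'a" where AB: "\<And>p. A p \<in> carrier R" "\<And>p. B p \<in> carrier R"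
    "\<And>z. z \<in> carrier R \<Longrightarrow> standard_poly N (\<rho>(i := z)) =
      (\<Oplus>p\<in>{p. p permutes {..<N}}. A p \<otimes> z \<otimes> B p)"
    by (rule standard_poly_linear[OF \<rho> i(1)]) (rule that)
  have fin: "finite {p. p permutes {..<N}}" by (intro finite_permutations) simp
  define st where "st z = standard_poly N (\<rho>(i := z))" for z
  have stP: "st z \<in> P" if "z \<in> P" for z
  proof -
    have "(\<Oplus>p\<in>{p. p permutes {..<N}}. A p \<otimes> z \<otimes> B p) \<in> P"
      using that AB by (intro finsum_in_subspace[OF fin sP] ideal.I_r_closed[OF P] ideal.I_l_closed[OF P])
    then show ?thesis using AB(3)[of z] that Pc by (auto simp: st_def)
  qed
  have "subspace {z \<in> carrier R. st z \<in> P}"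
  proof (intro subspaceI)
    show "\<zero> \<in> {z \<in> carrier R. st z \<in> P}" using stP[of \<zero>] subspaceD(3)[OF sP] by simp
    fix x y assume "x \<in> {z \<in> carrier R. st z \<in> P}" "y \<in> {z \<in> carrier R. st z \<in> P}"
    then have xy: "x \<in> carrier R" "y \<in> carrier R" "st x \<in> P" "st y \<in> P" by auto
    have "st (x \<oplus> y) = (\<Oplus>p\<in>{p. p permutes {..<N}}. A p \<otimes> x \<otimes> B p \<oplus> A p \<otimes> y \<otimes> B p)"
      unfolding st_def AB(3)[OF a_closed[OF xy(1,2)]] using AB(1,2) xy
      by (intro finsum_cong') (auto simp: l_distr r_distr)
    also have "\<dots> = st x \<oplus> st y"
      unfolding st_def AB(3)[OF xy(1)] AB(3)[OF xy(2)] using AB(1,2) xy by (intro finsum_addf) auto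
    finally show "x \<oplus> y \<in> {z \<in> carrier R. st z \<in> P}" using xy subspaceD(4)[OF sP] by simp
  next
    fix c x assume c: "c \<in> F" and "x \<in> {z \<in> carrier R. st z \<in> P}"
    then have x: "x \<in> carrier R" "st x \<in> P" by auto
    note cc = F_carrier[OF c]
    have "st (c \<otimes> x) = (\<Oplus>p\<in>{p. p permutes {..<N}}. c \<otimes> (A p \<otimes> x \<otimes> B p))"
    proof -
      have "A p \<otimes> (c \<otimes> x) \<otimes> B p = c \<otimes> (A p \<otimes> x \<otimes> B p)" for p
        using AB(1,2) x cc F_central[OF c AB(1)[of p]] by (simp add: m_assoc[symmetric])
      then show ?thesis unfolding st_def using AB(3)[of "c \<otimes> x"] cc x by simp
    qed
    also have "\<dots> = c \<otimes> st x"
      unfolding st_def AB(3)[OF x(1)] using AB(1,2) x cc fin by (intro finsum_rdistr[symmetric]) auto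
    finally show "c \<otimes> x \<in> {z \<in> carrier R. st z \<in> P}" using x cc subspaceD(5)[OF sP c] by simp
  qed auto
  then have "spn (\<rho> ` {..<i} \<union> P) \<subseteq> {z \<in> carrier R. st z \<in> P}"
  proof (rule spn_min)
    show "\<rho> ` {..<i} \<union> P \<subseteq> {z \<in> carrier R. st z \<in> P}"
    proof (intro Un_least image_subsetI subsetI)
      fix l assume "l \<in> {..<i}"
      then have "standard_poly N (\<rho>(i := \<rho> l)) = \<zero>"
        using \<rho> i(1) by (intro standard_poly_alternating[of _ l N i]) auto
      then show "\<rho> l \<in> {z \<in> carrier R. st z \<in> P}" using \<rho>c subspaceD(3)[OF sP] by (simp add: st_def)
    qed (use stP Pc in auto)
  qed
  then have "st (\<rho> i) \<in> P" using i(2) by blast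
  then show ?thesis by (simp add: st_def)
qed

end

text \<open>The assumption \<open>zero\<close> says that the ideals of codimension less than
  \<open>N\<close> intersect in zero, with codimension measured by spanning sets. The identity
  obtained is the standard one of degree \<open>N\<close>.\<close>

lemma (in field_algebra) bounded_codimension_PI:
  assumes one: "\<one>\<^bsub>R\<^esub> \<noteq> \<zero>\<^bsub>R\<^esub>"
    and zero: "\<And>r. r \<in> carrier R \<Longrightarrow> (\<And>P T. ideal P R \<Longrightarrow> finite T \<Longrightarrow> T \<subseteq> carrier R \<Longrightarrow> card T < N \<Longrightarrow>
      linear_span R (\<phi> ` carrier K) (T \<union> P) = carrier R \<Longrightarrow> r \<in> P) \<Longrightarrow> r = \<zero>\<^bsub>R\<^esub>"
  shows "PI_algebra K R \<phi>"
proof -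
  interpret central_subfield R "\<phi> ` carrier K" by (rule central_subfield[OF one])
  interpret h: ring_hom_ring K R \<phi>
    by (intro ring_hom_ringI2 K.ring_axioms R.ring_axioms structure_hom)
  let ?P = "{p. p permutes {..<N}}"
  define word where "word p = map p [0..<N]" for p :: "nat \<Rightarrow> nat"
  define sg where "sg p = (if evenperm p then \<one>\<^bsub>K\<^esub> else \<ominus>\<^bsub>K\<^esub> \<one>\<^bsub>K\<^esub>)" for p :: "nat \<Rightarrow> nat"
  \<comment> \<open>The standard polynomial as a coefficient function: a sign on the word of each
    permutation, zero elsewhere. Distinct permutations have distinct words, so nothing is
    merged.\<close>
  define f where "f w = (if w \<in> word ` ?P then sg (inv_into ?P word w) else \<zero>\<^bsub>K\<^esub>)" for w
  have fin: "finite ?P" by (intro finite_permutations) simp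
  have inj: "inj_on word ?P"
  proof (rule inj_onI)
    fix p q assume pq: "p \<in> ?P" "q \<in> ?P" "word p = word q"
    show "p = q"
    proof
      fix i show "p i = q i"
      proof (cases "i < N")
        case True
        then have "word p ! i = p i" "word q ! i = q i" by (simp_all add: word_def)
        then show ?thesis using pq(3) by simp
      next
        case False
        then show ?thesis using pq permutes_not_in[of p "{..<N}" i] permutes_not_in[of q "{..<N}" i] by simp
      qed
    qed
  qed
  have sg: "sg p \<in> carrier K" "sg p \<noteq> \<zero>\<^bsub>K\<^esub>" for p
    using K.one_not_zero K.add.inv_eq_1_iff[OF K.one_closed] by (auto simp: sg_def)
  have fw: "f (word p) = sg p" if "p \<in> ?P" for p using that inj by (simp add: f_def)
  have supp: "{w. f w \<noteq> \<zero>\<^bsub>K\<^esub>} = word ` ?P"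
  proof
    show "word ` ?P \<subseteq> {w. f w \<noteq> \<zero>\<^bsub>K\<^esub>}" using fw sg(2) by auto
  qed (auto simp: f_def split: if_splits)
  have "free_algebra_elem K f"
    unfolding free_algebra_elem_def supp using sg(1) fin by (auto simp: f_def)
  moreover have "\<exists>w. f w \<noteq> \<zero>\<^bsub>K\<^esub>" using fw[of id] sg(2) permutes_id by (metis mem_Collect_eq)
  moreover have "free_algebra_eval K R \<phi> \<rho> f = \<zero>\<^bsub>R\<^esub>" if \<rho>: "range \<rho> \<subseteq> carrier R" for \<rho>
  proof -
    have \<phi>sg: "\<phi> (sg p) = perm_sign p" for p by (simp add: sg_def perm_sign_def)
    have "free_algebra_eval K R \<phi> \<rho> f = (\<Oplus>\<^bsub>R\<^esub>w\<in>word ` ?P. \<phi> (f w) \<otimes>\<^bsub>R\<^esub> list_prod R (map \<rho> w))"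
      by (simp add: free_algebra_eval_def supp)
    also have "\<dots> = (\<Oplus>\<^bsub>R\<^esub>p\<in>?P. \<phi> (f (word p)) \<otimes>\<^bsub>R\<^esub> list_prod R (map \<rho> (word p)))"
      using inj sg(1) fw list_prod_map_closed[OF \<rho>] by (intro R.finsum_reindex) auto
    also have "\<dots> = standard_poly N \<rho>"
      unfolding standard_poly_def using perm_sign_closed list_prod_map_closed[OF \<rho>]
      by (intro R.finsum_cong') (auto simp: fw \<phi>sg word_def[symmetric], simp add: word_def)
    finally have eq: "free_algebra_eval K R \<phi> \<rho> f = standard_poly N \<rho>" .
    have "standard_poly N \<rho> \<in> carrier R"
      unfolding standard_poly_def using perm_sign_closed list_prod_map_closed[OF \<rho>] by (intro R.finsum_closed) auto
    then show ?thesis unfolding eq using standard_poly_in_ideal[OF _ _ _ _ _ \<rho>] by (intro zero) auto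
  qed
  ultimately show ?thesis unfolding PI_algebra_def by blast
qed

section \<open>Gelfand--Kirillov dimension and quotients\<close>

lemma UP_simps:
  "p \<in> up K \<Longrightarrow> p \<in> carrier (UP K)" "p \<in> up K \<Longrightarrow> up_ring.coeff (UP K) p i = p i"
  "\<zero>\<^bsub>UP K\<^esub> = (\<lambda>i. \<zero>\<^bsub>K\<^esub>)"
  by (simp_all add: UP_def)

context central_subfield
begin

section \<open>Spanning sets and dimension\<close>

lemma spn_eq_Span: "set us \<subseteq> carrier R \<Longrightarrow> spn (set us) = Span F us"
  by (simp only: linear_span_def Span_subalgebra_minimal[OF subfield_F])

lemma finite_dimension_spn:
  assumes "finite T" "T \<subseteq> carrier R" shows "finite_dimension F (spn T)"
proof -
  obtain us where "set us = T" using finite_list[OF assms(1)] by blast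
  then show ?thesis using spn_eq_Span[of us] Span_finite_dimension[OF subfield_F, of us] assms(2) by simp
qed

lemma independent_not_in_spn:
  "independent F us \<Longrightarrow> i < length us \<Longrightarrow> us ! i \<notin> spn (set (drop (Suc i) us))"
proof (induction us arbitrary: i)
  case (Cons u us)
  note ind = independent_backwards[OF Cons.prems(1)]
  have "set us \<subseteq> carrier R" using ind(2) by (rule independent_in_carrier)
  then show ?case using Cons ind by (cases i) (auto simp: spn_eq_Span simp del: Span.simps)
qed simp

lemma finite_dimension_basis:
  assumes "finite_dimension F E"
  obtains us where "independent F us" "length us = dim F E" "set us \<subseteq> carrier R" "E = spn (set us)"
proof -
  have "dimension (dim F E) F E" using finite_dimensionE[OF subfield_F assms] by (simp add: over_def)
  from exists_base[OF subfield_F this]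
  obtain us where us: "set us \<subseteq> carrier R" "independent F us" "length us = dim F E" "Span F us = E"
    by (elim exE conjE)
  have "E = spn (set us)" unfolding spn_eq_Span[OF us(1)] us(4) ..
  then show thesis by (rule that[OF us(2,3,1)])
qed

lemma dim_le_card:
  assumes E: "finite_dimension F E" and T: "finite T" "T \<subseteq> carrier R" "E \<subseteq> spn T"
  shows "dim F E \<le> card T"
proof -
  obtain us where us: "independent F us" "length us = dim F E" "set us \<subseteq> carrier R" "E = spn (set us)"
    by (rule finite_dimension_basis[OF E])
  let ?n = "length us"
  have "?n \<le> card T"
  \<comment> \<open>Independent lists grow at the front: each entry is independent of those after
    it. The list is therefore read from its end.\<close>
  proof (rule chain_bound[OF T(1,2), where P = "{}" and u = "\<lambda>a. us ! (?n - Suc a)"])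
    fix a assume a: "a < ?n"
    then have "us ! (?n - Suc a) \<in> E" unfolding us(4) by (intro spn_base) auto
    then show "us ! (?n - Suc a) \<in> spn (T \<union> {})" using T(3) by auto
    have "(\<lambda>a. us ! (?n - Suc a)) ` {..<a} \<subseteq> set (drop (Suc (?n - Suc a)) us)"
    proof (rule image_subsetI)
      fix b assume "b \<in> {..<a}"
      then have "?n - Suc b = Suc (?n - Suc a) + (a - Suc b)" "a - Suc b < length (drop (Suc (?n - Suc a)) us)"
        using a by auto
      then show "us ! (?n - Suc b) \<in> set (drop (Suc (?n - Suc a)) us)"
        using a nth_mem[of "a - Suc b" "drop (Suc (?n - Suc a)) us"] by (simp add: add.commute)
    qed
    then have "spn ((\<lambda>a. us ! (?n - Suc a)) ` {..<a} \<union> {}) \<subseteq> spn (set (drop (Suc (?n - Suc a)) us))"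
      by (intro spn_mono) simp
    then show "us ! (?n - Suc a) \<notin> spn ((\<lambda>a. us ! (?n - Suc a)) ` {..<a} \<union> {})"
    proof -
      have "?n - Suc a < ?n" using a by simp
      then have "us ! (?n - Suc a) \<notin> spn (set (drop (Suc (?n - Suc a)) us))" by (rule independent_not_in_spn[OF us(1)])
      then show ?thesis
        using \<open>spn ((\<lambda>a. us ! (?n - Suc a)) ` {..<a} \<union> {}) \<subseteq> spn (set (drop (Suc (?n - Suc a)) us))\<close> by blast
    qed
  qed simp
  then show ?thesis using us(2) by simp
qed

text \<open>\<open>GKdim\<close> ranges over finite dimensional subspaces, the growth arguments over
  finite generating sets; both define the same filtration.\<close>

lemma pss_spn:
  assumes Y: "Y \<subseteq> carrier R" shows "pss (spn Y) n = pss Y n"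
proof
  show "pss Y n \<subseteq> pss (spn Y) n" by (intro pss_mono spn_superset) simp
  have "list_prod R ws \<in> pss Y (length ws)" if "set ws \<subseteq> spn Y" for ws
    using that
  proof (induction ws)
    case (Cons w ws)
    have "spn Y \<subseteq> pss Y 1" using generator_in_pss[OF Y] by (intro spn_min subspace_pss Y) auto
    then show ?case using pss_mult[OF Y, of w 1 "list_prod R ws" "length ws"] Cons by auto
  qed (simp add: one_in_pss)
  then have "{list_prod R ws |ws. set ws \<subseteq> spn Y \<and> length ws \<le> n} \<subseteq> pss Y n"
    using pss_mono[of _ n Y Y] by blast
  then show "pss (spn Y) n \<subseteq> pss Y n"
    unfolding power_sum_space_def[of R F "spn Y"] by (intro spn_min subspace_pss Y)
qed

lemma finite_dimension_pss: "finite Y \<Longrightarrow> Y \<subseteq> carrier R \<Longrightarrow> finite_dimension F (pss Y n)"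
  by (metis finite_dimension_spn pss_finite_spanning)

lemma finite_dimension_pss': 
  assumes "finite_dimension F V" shows "finite_dimension F (pss V n)"
proof -
  obtain us where "set us \<subseteq> carrier R" "V = spn (set us)" by (rule finite_dimension_basis[OF assms])
  then show ?thesis using pss_spn[of "set us" n] finite_dimension_pss[of "set us" n] by simp
qed

end

context field_algebra
begin

section \<open>Growth bounds and Gelfand-Kirillov dimension\<close>

lemma GKdim_eq:
  "GKdim K R \<phi> = (SUP V \<in> {V. subalgebra (\<phi> ` carrier K) V R \<and> R.finite_dimension (\<phi> ` carrier K) V}.
      limsup (\<lambda>n. ereal (log (real n) (real (R.dim (\<phi> ` carrier K) (power_sum_space R (\<phi> ` carrier K) V n))))))"
  by (simp add: GKdim_def Let_def)

text \<open>A real \<open>r\<close> strictly between the upper limit and 3 bounds the exponent of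
  the dimension for all large \<open>n\<close>.\<close>

lemma GKdim_less_3_subcubic:
  assumes one: "\<one>\<^bsub>R\<^esub> \<noteq> \<zero>\<^bsub>R\<^esub>" and GK: "GKdim K R \<phi> < 3" and Y: "finite Y" "Y \<subseteq> carrier R"
  shows "central_subfield.subcubic R (\<phi> ` carrier K) Y"
proof -
  interpret central_subfield R "\<phi> ` carrier K" by (rule central_subfield[OF one])
  let ?F = "\<phi> ` carrier K"
  let ?d = "\<lambda>n. R.dim ?F (pss (spn Y) n)"
  have fd: "R.finite_dimension ?F (spn Y)" by (rule finite_dimension_spn[OF Y])
  have "limsup (\<lambda>n. ereal (log (real n) (real (?d n)))) \<le> GKdim K R \<phi>"
    unfolding GKdim_eq using fd subspace_spn[OF Y(2)] by (intro SUP_upper) (simp add: subspace_iff_subalgebra)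
  then have "limsup (\<lambda>n. ereal (log (real n) (real (?d n)))) < ereal 3" using GK by (simp add: order_le_less_trans)
  from ereal_dense2[OF this]
  obtain r where r: "limsup (\<lambda>n. ereal (log (real n) (real (?d n)))) < ereal r" "ereal r < ereal 3"
    by (elim exE conjE)
  have "eventually (\<lambda>n. ereal (log (real n) (real (?d n))) < ereal r) sequentially"
    by (rule Limsup_lessD[OF r(1)])
  then obtain n0 where n0: "\<And>n. n \<ge> n0 \<Longrightarrow> log (real n) (real (?d n)) < r"
    by (auto simp: eventually_sequentially)
  \<comment> \<open>The bound \<open>n \<ge> 2\<close> makes the base of the logarithm exceed 1, so
    that it can be inverted.\<close>
  have "\<exists>T. finite T \<and> T \<subseteq> carrier R \<and> real (card T) \<le> real n powr r \<and> pss Y n \<subseteq> spn T"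
    if n: "n \<ge> max n0 2" for n
  proof -
    obtain us where us: "R.independent ?F us" "length us = ?d n" "set us \<subseteq> carrier R" "pss (spn Y) n = spn (set us)"
      by (rule finite_dimension_basis[OF finite_dimension_pss'[OF fd]])
    have "real (?d n) \<le> real n powr r"
    proof (cases "?d n = 0")
      case False
      have "real (?d n) = real n powr log (real n) (real (?d n))" using False n by (intro powr_log_cancel[symmetric]) auto
      also have "\<dots> \<le> real n powr r" using n0[of n] n by (intro powr_mono) auto
      finally show ?thesis .
    qed simp
    moreover have "real (card (set us)) \<le> real (?d n)" using card_length[of us] us(2) by simp
    ultimately have "real (card (set us)) \<le> real n powr r" by linarith
    then show ?thesis using us pss_spn[OF Y(2)] by (intro exI[of _ "set us"]) auto
  qed
  then show ?thesis unfolding subcubic_def using r(2) by (intro exI[of _ r] conjI exI[of _ "max n0 2"]) auto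
qed

text \<open>For every \<open>e > 0\<close>, \<open>C * (n + 1)\<close> is eventually at most
  \<open>n powr (1 + e)\<close>.\<close>

lemma GKdim_le_1:
  assumes one: "\<one>\<^bsub>R\<^esub> \<noteq> \<zero>\<^bsub>R\<^esub>"
    and lin: "\<And>Y. finite Y \<Longrightarrow> Y \<subseteq> carrier R \<Longrightarrow>
      \<exists>C. central_subfield.linear_growth R (\<phi> ` carrier K) Y {\<zero>\<^bsub>R\<^esub>} C"
  shows "GKdim K R \<phi> \<le> 1"
  unfolding GKdim_eq
proof (rule SUP_least)
  interpret central_subfield R "\<phi> ` carrier K" by (rule central_subfield[OF one])
  let ?F = "\<phi> ` carrier K"
  fix V assume "V \<in> {V. subalgebra ?F V R \<and> R.finite_dimension ?F V}"
  then have fd: "R.finite_dimension ?F V" by simp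
  obtain us where us: "set us \<subseteq> carrier R" "V = spn (set us)" by (rule finite_dimension_basis[OF fd])
  obtain C where C: "linear_growth (set us) {\<zero>\<^bsub>R\<^esub>} C" using lin[of "set us"] us(1) by auto
  let ?d = "\<lambda>n. R.dim ?F (pss V n)"
  have d: "?d n \<le> C * (n + 1)" for n
  proof -
    obtain T where T: "finite T" "T \<subseteq> carrier R" "card T \<le> C * (n + 1)" "pss (set us) n \<subseteq> spn (T \<union> {\<zero>\<^bsub>R\<^esub>})"
      using C unfolding linear_growth_def by blast
    have "spn (T \<union> {\<zero>\<^bsub>R\<^esub>}) \<subseteq> spn T"
      using subspaceD(3)[OF subspace_spn[OF T(2)]] spn_superset[of T] T(2) by (intro spn_subset_spn) auto
    then have "pss V n \<subseteq> spn T" using T(4) us pss_spn[OF us(1)] by auto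
    then show ?thesis using dim_le_card[OF finite_dimension_pss'[OF fd] T(1,2)] T(3) by (meson le_trans)
  qed
  show "limsup (\<lambda>n. ereal (log (real n) (real (?d n)))) \<le> 1"
  proof (rule ereal_le_epsilon2)
    fix e :: real assume e: "0 < e"
    \<comment> \<open>\<open>2 * C * n\<close> dominates \<open>C * (n + 1)\<close>; the added 1
      keeps \<open>c\<close> at least 1 even for \<open>C = 0\<close>. Beyond
      \<open>c powr (1 / e)\<close> one has \<open>c \<le> n powr e\<close>.\<close>
    define c where "c = 2 * real C + 1"
    have c: "c \<ge> 1" by (simp add: c_def)
    obtain n1 where n1: "c powr (1 / e) < real n1" using reals_Archimedean2 by blast
    have "log (real n) (real (?d n)) \<le> 1 + e" if n: "n \<ge> max n1 2" for n
    proof (cases "?d n = 0")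
      \<comment> \<open>Dimension zero is covered by the default value 0 of the logarithm at
        0.\<close>
      case True then show ?thesis using e by (simp add: log_def)
    next
      case False
      have "real (?d n) \<le> real (C * (n + 1))" using d[of n] by (simp only: of_nat_le_iff)
      also have "\<dots> = real C * (real n + 1)" by (simp add: distrib_left)
      also have "\<dots> \<le> real C * (2 * real n)" using n by (intro mult_left_mono) auto
      also have "\<dots> \<le> c * real n" using n by (simp add: c_def algebra_simps)
      also have "c = (c powr (1 / e)) powr e" using c e by (simp add: powr_powr)
      also have "\<dots> * real n \<le> real n powr e * real n"
        using n1 n e by (intro mult_right_mono powr_mono2) auto
      also have "\<dots> = real n powr (1 + e)" using n by (simp add: powr_add)
      finally have "real (?d n) \<le> real n powr (1 + e)" .
      then have "log (real n) (real (?d n)) \<le> log (real n) (real n powr (1 + e))"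
        using False n by (intro log_mono) auto
      then show ?thesis using n by simp
    qed
    then have "eventually (\<lambda>n. ereal (log (real n) (real (?d n))) \<le> ereal (1 + e)) sequentially"
      unfolding eventually_sequentially by (intro exI[of _ "max n1 2"]) auto
    then have "limsup (\<lambda>n. ereal (log (real n) (real (?d n)))) \<le> ereal (1 + e)" by (rule Limsup_bounded)
    then show "limsup (\<lambda>n. ereal (log (real n) (real (?d n)))) \<le> 1 + ereal e" by (simp add: one_ereal_def)
  qed
qed

text \<open>The powers of a transcendental \<open>s\<close> up to exponent \<open>n\<close> are
  independent and lie in the \<open>n\<close>-th space of the line spanned by
  \<open>s\<close>.\<close>

lemma GKdim_ge_1:
  assumes one: "\<one>\<^bsub>R\<^esub> \<noteq> \<zero>\<^bsub>R\<^esub>" and s: "s \<in> carrier R"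
    and na: "\<not> central_subfield.algebraic_mod R (\<phi> ` carrier K) {\<zero>\<^bsub>R\<^esub>} s"
  shows "1 \<le> GKdim K R \<phi>"
proof -
  interpret central_subfield R "\<phi> ` carrier K" by (rule central_subfield[OF one])
  let ?F = "\<phi> ` carrier K"
  let ?d = "\<lambda>n. R.dim ?F (pss (spn {s}) n)"
  have fd: "R.finite_dimension ?F (spn {s})" using s by (intro finite_dimension_spn) auto
  have d: "n < ?d n" for n
  proof -
    obtain us where us: "length us = ?d n" "set us \<subseteq> carrier R" "pss (spn {s}) n = spn (set us)"
      by (rule finite_dimension_basis[OF finite_dimension_pss'[OF fd]])
    have "n + 1 \<le> card (set us)"
    proof (rule chain_bound[where P = "{\<zero>\<^bsub>R\<^esub>}" and u = "\<lambda>i. s [^]\<^bsub>R\<^esub> i"])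
      fix a :: nat assume a: "a < n + 1"
      have "list_prod R (replicate a s) = s [^]\<^bsub>R\<^esub> a"
        using R.nat_pow_Suc2[OF s] by (induction a) auto
      moreover have "list_prod R (replicate a s) \<in> pss (spn {s}) n"
        using a s spn_superset[of "{s}"] by (intro list_prod_in_pss) auto
      ultimately show "s [^]\<^bsub>R\<^esub> a \<in> spn (set us \<union> {\<zero>\<^bsub>R\<^esub>})"
        using us(3) spn_mono[of "set us" "set us \<union> {\<zero>\<^bsub>R\<^esub>}"] by auto
      show "s [^]\<^bsub>R\<^esub> a \<notin> spn ((\<lambda>i. s [^]\<^bsub>R\<^esub> i) ` {..<a} \<union> {\<zero>\<^bsub>R\<^esub>})"
        using na unfolding algebraic_mod_def by blast
    qed (use us in auto)
    then show ?thesis using us(1) card_length[of us] by simp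
  qed
  have "ereal 1 \<le> ereal (log (real n) (real (?d n)))" if n: "n \<ge> 2" for n
  proof -
    have "log (real n) (real n) \<le> log (real n) (real (?d n))" using n d[of n] by (intro log_mono) auto
    then show ?thesis using n by simp
  qed
  then have "eventually (\<lambda>n. ereal 1 \<le> ereal (log (real n) (real (?d n)))) sequentially"
    unfolding eventually_sequentially by blast
  then have "ereal 1 \<le> limsup (\<lambda>n. ereal (log (real n) (real (?d n))))"
    by (rule le_Limsup[rotated]) simp
  also have "\<dots> \<le> GKdim K R \<phi>"
    unfolding GKdim_eq using fd subspace_spn[of "{s}"] s by (intro SUP_upper) (simp add: subspace_iff_subalgebra)
  finally show ?thesis by (simp add: one_ereal_def)
qed

lemma affine_generates:
  assumes one: "\<one>\<^bsub>R\<^esub> \<noteq> \<zero>\<^bsub>R\<^esub>" and aff: "affine_algebra K R \<phi>"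
  obtains Y where "central_subfield.generates R (\<phi> ` carrier K) Y"
proof -
  interpret central_subfield R "\<phi> ` carrier K" by (rule central_subfield[OF one])
  obtain Y where Y: "finite Y" "Y \<subseteq> carrier R" "generate_ring R (\<phi> ` carrier K \<union> Y) = carrier R"
    using aff by (auto simp: affine_algebra_def)
  have "\<exists>n. a \<in> pss Y n" if "a \<in> generate_ring R (\<phi> ` carrier K \<union> Y)" for a
    using that
  proof induction
    case one then show ?case using one_in_pss by blast
  next
    case (incl h)
    have "h \<in> pss Y 1" if "h \<in> \<phi> ` carrier K"
      using subspaceD(5)[OF subspace_pss[OF Y(2)] that one_in_pss[of Y 1]] F_carrier[OF that] by simp
    then show ?case using incl generator_in_pss[OF Y(2), of h 1] by auto
  next
    case (a_inv h) then show ?case using subspace_uminus[OF subspace_pss[OF Y(2)]] by blast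
  next
    case (eng_add h1 h2)
    then obtain m n where "h1 \<in> pss Y m" "h2 \<in> pss Y n" by blast
    then have "h1 \<in> pss Y (max m n)" "h2 \<in> pss Y (max m n)"
      using pss_mono[of m "max m n" Y Y] pss_mono[of n "max m n" Y Y] by auto
    then show ?case using subspaceD(4)[OF subspace_pss[OF Y(2)]] by blast
  next
    case (eng_mult h1 h2) then show ?case using pss_mult[OF Y(2)] by blast
  qed
  then have "generates Y" using Y unfolding generates_def by simp
  then show thesis by (rule that)
qed

section \<open>Algebraic elements: polynomials and spans of powers\<close>

lemma eval_eq_sum:
  assumes p: "p \<in> carrier (UP K)" and n: "deg K p \<le> n" and s: "s \<in> carrier R"
  shows "UnivPoly.eval K R \<phi> s p = (\<Oplus>\<^bsub>R\<^esub>i\<in>{..n}. \<phi> (up_ring.coeff (UP K) p i) \<otimes>\<^bsub>R\<^esub> s [^]\<^bsub>R\<^esub> i)"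
proof -
  interpret UP: UP_ring K "UP K" by (intro UP_ring.intro K.ring_axioms) simp
  interpret h: ring_hom_ring K R \<phi>
    by (intro ring_hom_ringI2 K.ring_axioms R.ring_axioms structure_hom)
  have c: "\<phi> (up_ring.coeff (UP K) p i) \<in> carrier R" for i using p by simp
  show ?thesis
    unfolding eval_def restrict_apply if_P[OF p]
    by (rule R.add.finprod_mono_neutral_cong_left) (use n c s p UP.deg_aboveD[OF _ p] in auto)
qed

lemma algebraic_over_imp_algebraic_mod:
  assumes one: "\<one>\<^bsub>R\<^esub> \<noteq> \<zero>\<^bsub>R\<^esub>" and s: "s \<in> carrier R" and alg: "algebraic_over K R \<phi> s"
  shows "central_subfield.algebraic_mod R (\<phi> ` carrier K) {\<zero>\<^bsub>R\<^esub>} s"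
proof -
  interpret central_subfield R "\<phi> ` carrier K" by (rule central_subfield[OF one])
  interpret UP: UP_ring K "UP K" by (intro UP_ring.intro K.ring_axioms) simp
  interpret h: ring_hom_ring K R \<phi>
    by (intro ring_hom_ringI2 K.ring_axioms R.ring_axioms structure_hom)
  obtain p where p: "p \<in> carrier (UP K)" "p \<noteq> \<zero>\<^bsub>UP K\<^esub>" "UnivPoly.eval K R \<phi> s p = \<zero>\<^bsub>R\<^esub>"
    using alg by (auto simp: algebraic_over_def)
  let ?n = "deg K p"
  define c where "c i = \<phi> (up_ring.coeff (UP K) p i)" for i
  have c: "c i \<in> \<phi> ` carrier K" "c i \<in> carrier R" for i using p(1) by (auto simp: c_def)
  \<comment> \<open>A unit of \<open>K\<close> goes to a unit of \<open>R\<close>, which is nonzero;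
    dividing by it makes the relation monic.\<close>
  have lc: "c ?n \<noteq> \<zero>\<^bsub>R\<^esub>"
  proof
    assume "c ?n = \<zero>\<^bsub>R\<^esub>"
    moreover have lead: "up_ring.coeff (UP K) p ?n \<in> carrier K" "up_ring.coeff (UP K) p ?n \<noteq> \<zero>\<^bsub>K\<^esub>"
      using UP.lcoeff_nonzero[OF p(2,1)] p(1) by auto
    moreover have "\<phi> (inv\<^bsub>K\<^esub> (up_ring.coeff (UP K) p ?n)) \<otimes>\<^bsub>R\<^esub> c ?n = \<one>\<^bsub>R\<^esub>"
    proof -
      have u: "up_ring.coeff (UP K) p ?n \<in> Units K" using lead K.field_Units by simp
      have "\<phi> (inv\<^bsub>K\<^esub> (up_ring.coeff (UP K) p ?n)) \<otimes>\<^bsub>R\<^esub> c ?n = \<phi> (inv\<^bsub>K\<^esub> (up_ring.coeff (UP K) p ?n) \<otimes>\<^bsub>K\<^esub> up_ring.coeff (UP K) p ?n)"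
        unfolding c_def using u K.Units_inv_closed[OF u] lead(1) by (simp del: K.Units_l_inv)
      then show ?thesis using u by simp
    qed
    moreover have "inv\<^bsub>K\<^esub> (up_ring.coeff (UP K) p ?n) \<in> carrier K"
      using lead K.field_Units by (intro K.Units_inv_closed) simp
    ultimately show False using one by simp
  qed
  let ?V = "spn (powers s ?n \<union> {\<zero>\<^bsub>R\<^esub>})"
  have V: "subspace ?V" using s by (intro subspace_spn) auto
  have fin: "(\<Oplus>\<^bsub>R\<^esub>i\<in>{..<?n}. c i \<otimes>\<^bsub>R\<^esub> s [^]\<^bsub>R\<^esub> i) \<in> ?V"
    by (intro finsum_in_subspace V subspaceD(5)[OF V] c spn_base) auto
  have "\<zero>\<^bsub>R\<^esub> = (\<Oplus>\<^bsub>R\<^esub>i\<in>{..?n}. c i \<otimes>\<^bsub>R\<^esub> s [^]\<^bsub>R\<^esub> i)"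
    using eval_eq_sum[OF p(1) order_refl s] p(3) by (simp add: c_def)
  also have "{..?n} = insert ?n {..<?n}" by auto
  also have "(\<Oplus>\<^bsub>R\<^esub>i\<in>insert ?n {..<?n}. c i \<otimes>\<^bsub>R\<^esub> s [^]\<^bsub>R\<^esub> i) =
      c ?n \<otimes>\<^bsub>R\<^esub> s [^]\<^bsub>R\<^esub> ?n \<oplus>\<^bsub>R\<^esub> (\<Oplus>\<^bsub>R\<^esub>i\<in>{..<?n}. c i \<otimes>\<^bsub>R\<^esub> s [^]\<^bsub>R\<^esub> i)"
    using c s by (intro R.finsum_insert) auto
  finally have "c ?n \<otimes>\<^bsub>R\<^esub> s [^]\<^bsub>R\<^esub> ?n \<oplus>\<^bsub>R\<^esub> (\<Oplus>\<^bsub>R\<^esub>i\<in>{..<?n}. c i \<otimes>\<^bsub>R\<^esub> s [^]\<^bsub>R\<^esub> i) \<in> ?V"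
    using subspaceD(3)[OF V] by simp
  then have "c ?n \<otimes>\<^bsub>R\<^esub> s [^]\<^bsub>R\<^esub> ?n \<in> ?V" using subspace_add_cancel[OF V _ fin] c s by simp
  then have "s [^]\<^bsub>R\<^esub> ?n \<in> ?V" using smult_cancel_subspace[OF c(1) lc V] s by simp
  then show ?thesis unfolding algebraic_mod_def by blast
qed

lemma algebraic_mod_imp_algebraic_over:
  assumes one: "\<one>\<^bsub>R\<^esub> \<noteq> \<zero>\<^bsub>R\<^esub>" and s: "s \<in> carrier R"
    and alg: "central_subfield.algebraic_mod R (\<phi> ` carrier K) {\<zero>\<^bsub>R\<^esub>} s"
  shows "algebraic_over K R \<phi> s"
proof -
  interpret central_subfield R "\<phi> ` carrier K" by (rule central_subfield[OF one])
  interpret UP: UP_ring K "UP K" by (intro UP_ring.intro K.ring_axioms) simp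
  interpret h: ring_hom_ring K R \<phi>
    by (intro ring_hom_ringI2 K.ring_axioms R.ring_axioms structure_hom)
  obtain n :: nat where n: "s [^]\<^bsub>R\<^esub> n \<in> spn (powers s n \<union> {\<zero>\<^bsub>R\<^esub>})" using alg by (auto simp: algebraic_mod_def)
  have "\<exists>c. (\<forall>i. c i \<in> carrier K) \<and> y = (\<Oplus>\<^bsub>R\<^esub>i\<in>{..<m}. \<phi> (c i) \<otimes>\<^bsub>R\<^esub> s [^]\<^bsub>R\<^esub> i)"
    if "y \<in> spn (powers s m \<union> {\<zero>\<^bsub>R\<^esub>})" for y and m :: nat
    using that
  proof (induction m arbitrary: y)
    case 0
    then show ?case using spn_subspace[OF subspace_zero] by (intro exI[of _ "\<lambda>_. \<zero>\<^bsub>K\<^esub>"]) auto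
  next
    case (Suc m)
    have "powers s (Suc m) \<union> {\<zero>\<^bsub>R\<^esub>} = insert (s [^]\<^bsub>R\<^esub> m) (powers s m \<union> {\<zero>\<^bsub>R\<^esub>})" by (simp add: lessThan_Suc insert_commute)
    then have "y \<in> spn (insert (s [^]\<^bsub>R\<^esub> m) (powers s m \<union> {\<zero>\<^bsub>R\<^esub>}))" using Suc.prems by (simp only:)
    moreover have "s [^]\<^bsub>R\<^esub> m \<in> carrier R" "powers s m \<union> {\<zero>\<^bsub>R\<^esub>} \<subseteq> carrier R" using s by auto
    ultimately obtain k b where kb: "k \<in> \<phi> ` carrier K" "b \<in> spn (powers s m \<union> {\<zero>\<^bsub>R\<^esub>})"
        "y = k \<otimes>\<^bsub>R\<^esub> s [^]\<^bsub>R\<^esub> m \<oplus>\<^bsub>R\<^esub> b"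
      by (rule spn_insertE)
    obtain c where c: "\<And>i. c i \<in> carrier K" "b = (\<Oplus>\<^bsub>R\<^esub>i\<in>{..<m}. \<phi> (c i) \<otimes>\<^bsub>R\<^esub> s [^]\<^bsub>R\<^esub> i)"
      using Suc.IH[OF kb(2)] by blast
    obtain k' where k': "k' \<in> carrier K" "k = \<phi> k'" using kb(1) by blast
    let ?c = "c(m := k')"
    have "(\<Oplus>\<^bsub>R\<^esub>i\<in>{..<Suc m}. \<phi> (?c i) \<otimes>\<^bsub>R\<^esub> s [^]\<^bsub>R\<^esub> i) =
        \<phi> (?c m) \<otimes>\<^bsub>R\<^esub> s [^]\<^bsub>R\<^esub> m \<oplus>\<^bsub>R\<^esub> (\<Oplus>\<^bsub>R\<^esub>i\<in>{..<m}. \<phi> (?c i) \<otimes>\<^bsub>R\<^esub> s [^]\<^bsub>R\<^esub> i)"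
      unfolding lessThan_Suc using c(1) k'(1) s by (intro R.finsum_insert) auto
    also have "(\<Oplus>\<^bsub>R\<^esub>i\<in>{..<m}. \<phi> (?c i) \<otimes>\<^bsub>R\<^esub> s [^]\<^bsub>R\<^esub> i) = b"
      unfolding c(2) using c(1) s by (intro R.finsum_cong') auto
    finally show ?case using kb(3) k' c(1) by (intro exI[of _ ?c]) auto
  qed
  then obtain c where c: "\<And>i. c i \<in> carrier K" "s [^]\<^bsub>R\<^esub> n = (\<Oplus>\<^bsub>R\<^esub>i\<in>{..<n}. \<phi> (c i) \<otimes>\<^bsub>R\<^esub> s [^]\<^bsub>R\<^esub> i)"
    using n by blast
  \<comment> \<open>The monic polynomial of the relation; its leading coefficient 1 shows that it is
    nonzero.\<close>
  define p where "p i = (if i < n then \<ominus>\<^bsub>K\<^esub> c i else if i = n then \<one>\<^bsub>K\<^esub> else \<zero>\<^bsub>K\<^esub>)" for i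
  have "p \<in> up K"
  proof (rule mem_upI)
    show "p i \<in> carrier K" for i using c(1) by (simp add: p_def)
    show "\<exists>m. bound \<zero>\<^bsub>K\<^esub> m p" by (intro exI[of _ n] bound.intro) (simp add: p_def)
  qed
  then have pc: "p \<in> carrier (UP K)" and coeff: "up_ring.coeff (UP K) p i = p i" for i
    by (fact UP_simps)+
  have "deg K p \<le> n" using coeff by (intro UP.deg_aboveI[OF _ pc]) (simp add: p_def)
  then have "UnivPoly.eval K R \<phi> s p = (\<Oplus>\<^bsub>R\<^esub>i\<in>{..n}. \<phi> (p i) \<otimes>\<^bsub>R\<^esub> s [^]\<^bsub>R\<^esub> i)"
    using eval_eq_sum[OF pc _ s] coeff by simp
  also have "{..n} = insert n {..<n}" by auto
  also have "(\<Oplus>\<^bsub>R\<^esub>i\<in>insert n {..<n}. \<phi> (p i) \<otimes>\<^bsub>R\<^esub> s [^]\<^bsub>R\<^esub> i) =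
      \<phi> (p n) \<otimes>\<^bsub>R\<^esub> s [^]\<^bsub>R\<^esub> n \<oplus>\<^bsub>R\<^esub> (\<Oplus>\<^bsub>R\<^esub>i\<in>{..<n}. \<phi> (p i) \<otimes>\<^bsub>R\<^esub> s [^]\<^bsub>R\<^esub> i)"
    using c(1) s by (intro R.finsum_insert) (auto simp: p_def)
  also have "(\<Oplus>\<^bsub>R\<^esub>i\<in>{..<n}. \<phi> (p i) \<otimes>\<^bsub>R\<^esub> s [^]\<^bsub>R\<^esub> i) =
      (\<Oplus>\<^bsub>R\<^esub>i\<in>{..<n}. (\<ominus>\<^bsub>R\<^esub> \<one>\<^bsub>R\<^esub>) \<otimes>\<^bsub>R\<^esub> (\<phi> (c i) \<otimes>\<^bsub>R\<^esub> s [^]\<^bsub>R\<^esub> i))"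
    using c(1) s by (intro R.finsum_cong') (auto simp: p_def R.l_minus)
  also have "\<dots> = (\<ominus>\<^bsub>R\<^esub> \<one>\<^bsub>R\<^esub>) \<otimes>\<^bsub>R\<^esub> s [^]\<^bsub>R\<^esub> n"
    unfolding c(2) using c(1) s by (intro R.finsum_rdistr[symmetric]) auto
  also have "\<phi> (p n) \<otimes>\<^bsub>R\<^esub> s [^]\<^bsub>R\<^esub> n \<oplus>\<^bsub>R\<^esub> (\<ominus>\<^bsub>R\<^esub> \<one>\<^bsub>R\<^esub>) \<otimes>\<^bsub>R\<^esub> s [^]\<^bsub>R\<^esub> n = \<zero>\<^bsub>R\<^esub>"
    using s by (simp add: p_def R.l_minus R.r_neg)
  finally have "UnivPoly.eval K R \<phi> s p = \<zero>\<^bsub>R\<^esub>" .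
  moreover have "p \<noteq> \<zero>\<^bsub>UP K\<^esub>"
  proof
    assume "p = \<zero>\<^bsub>UP K\<^esub>"
    then have "p n = \<zero>\<^bsub>K\<^esub>" using fun_cong[OF UP_simps(3)[of K], of n] by (simp only:)
    then show False using K.one_not_zero by (simp add: p_def)
  qed
  ultimately show ?thesis using pc unfolding algebraic_over_def by blast
qed

section \<open>Transfer between R modulo P and the ring R/P\<close>

lemma quot_transfer:
  assumes one: "\<one>\<^bsub>R\<^esub> \<noteq> \<zero>\<^bsub>R\<^esub>" and P: "ideal P R" "P \<noteq> carrier R"
  defines "S \<equiv> R Quot P" and "\<psi> \<equiv> quot_structure R \<phi> P" and "\<pi> \<equiv> \<lambda>a. P +>\<^bsub>R\<^esub> a"
  shows "\<one>\<^bsub>S\<^esub> \<noteq> \<zero>\<^bsub>S\<^esub>"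
    and "s \<in> carrier R \<Longrightarrow> central_subfield.algebraic_mod S (\<psi> ` carrier K) {\<zero>\<^bsub>S\<^esub>} (\<pi> s) \<Longrightarrow>
      central_subfield.algebraic_mod R (\<phi> ` carrier K) P s"
    and "Y \<subseteq> carrier R \<Longrightarrow> central_subfield.linear_growth R (\<phi> ` carrier K) Y P C \<Longrightarrow>
      central_subfield.linear_growth S (\<psi> ` carrier K) (\<pi> ` Y) {\<zero>\<^bsub>S\<^esub>} C"
proof -
  interpret A: central_subfield R "\<phi> ` carrier K" by (rule central_subfield[OF one])
  interpret P: ideal P R by (rule P(1))
  interpret Q: field_algebra K S \<psi> unfolding S_def \<psi>_def by (rule field_algebra_Quot[OF P(1)])
  have hom: "\<pi> \<in> ring_hom R S" unfolding \<pi>_def S_def by (rule P.rcos_ring_hom)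
  interpret \<pi>: ring_hom_ring R S \<pi> by (intro ring_hom_ringI2 R.ring_axioms Q.R.ring_axioms hom)
  have carS: "carrier S = \<pi> ` carrier R" unfolding S_def \<pi>_def by (auto simp: FactRing_simps)
  have zeroS: "\<zero>\<^bsub>S\<^esub> = P" by (simp add: S_def FactRing_def)
  have ker: "\<pi> a = \<zero>\<^bsub>S\<^esub> \<longleftrightarrow> a \<in> P" if "a \<in> carrier R" for a
    unfolding \<pi>_def zeroS using that P.a_rcos_const[of a] P.a_rcos_self[of a] by auto
  show oneS: "\<one>\<^bsub>S\<^esub> \<noteq> \<zero>\<^bsub>S\<^esub>"
  proof
    assume "\<one>\<^bsub>S\<^esub> = \<zero>\<^bsub>S\<^esub>"
    then have "\<one>\<^bsub>R\<^esub> \<in> P" using ker[OF R.one_closed] \<pi>.hom_one by simp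
    then show False using P(2) P.one_imp_carrier by simp
  qed
  interpret B: central_subfield S "\<psi> ` carrier K" by (rule Q.central_subfield[OF oneS])
  have \<psi>: "\<psi> c = \<pi> (\<phi> c)" for c by (simp add: \<psi>_def \<pi>_def quot_structure_def)
  have \<phi>c: "\<phi> c \<in> carrier R" if "c \<in> carrier K" for c using A.F_carrier that by blast
  have sP: "A.subspace P" by (rule A.subspace_ideal[OF P(1)])
  have push: "\<pi> ` A.spn Z \<subseteq> B.spn (\<pi> ` Z)" if Z: "Z \<subseteq> carrier R" for Z
  proof -
    have S: "B.subspace (B.spn (\<pi> ` Z))" using Z by (intro B.subspace_spn) auto
    have "A.subspace {a \<in> carrier R. \<pi> a \<in> B.spn (\<pi> ` Z)}"
    proof (rule A.subspaceI)
      fix c a assume c: "c \<in> \<phi> ` carrier K" and a: "a \<in> {a \<in> carrier R. \<pi> a \<in> B.spn (\<pi> ` Z)}"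
      then obtain k where k: "k \<in> carrier K" "c = \<phi> k" by blast
      have "\<psi> k \<otimes>\<^bsub>S\<^esub> \<pi> a \<in> B.spn (\<pi> ` Z)" using a k by (intro B.subspaceD(5)[OF S]) auto
      then show "c \<otimes>\<^bsub>R\<^esub> a \<in> {a \<in> carrier R. \<pi> a \<in> B.spn (\<pi> ` Z)}" using a k \<phi>c by (simp add: \<psi>)
    qed (use B.subspaceD(3,4)[OF S] in auto)
    then have "A.spn Z \<subseteq> {a \<in> carrier R. \<pi> a \<in> B.spn (\<pi> ` Z)}"
      using Z by (intro A.spn_min) (auto intro: B.spn_base)
    then show ?thesis by blast
  qed
  \<comment> \<open>Membership in a span of \<open>R/P\<close> lifts to the span of the
    representatives enlarged by the kernel \<open>P\<close>.\<close>
  have pull: "a \<in> A.spn (Z \<union> P)" if a: "a \<in> carrier R" "\<pi> a \<in> B.spn (\<pi> ` Z \<union> {\<zero>\<^bsub>S\<^esub>})" and Z: "Z \<subseteq> carrier R" for a Z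
  proof -
    have V: "A.subspace (A.spn (Z \<union> P))" using Z A.subspaceD(1)[OF sP] by (intro A.subspace_spn) auto
    have Vc: "v \<in> A.spn (Z \<union> P) \<Longrightarrow> v \<in> carrier R" for v using A.subspaceD(2)[OF V] .
    have "B.subspace (\<pi> ` A.spn (Z \<union> P))"
    proof (rule B.subspaceI)
      show "\<pi> ` A.spn (Z \<union> P) \<subseteq> carrier S" using Vc by auto
      show "\<zero>\<^bsub>S\<^esub> \<in> \<pi> ` A.spn (Z \<union> P)" using A.subspaceD(3)[OF V] \<pi>.hom_zero by (metis imageI)
      fix x y assume "x \<in> \<pi> ` A.spn (Z \<union> P)" "y \<in> \<pi> ` A.spn (Z \<union> P)"
      then obtain u v where "u \<in> A.spn (Z \<union> P)" "v \<in> A.spn (Z \<union> P)" "x = \<pi> u" "y = \<pi> v" by blast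
      then show "x \<oplus>\<^bsub>S\<^esub> y \<in> \<pi> ` A.spn (Z \<union> P)"
        using A.subspaceD(4)[OF V, of u v] Vc \<pi>.hom_add[of u v] by (metis imageI)
    next
      fix c x assume "c \<in> \<psi> ` carrier K" "x \<in> \<pi> ` A.spn (Z \<union> P)"
      then obtain k u where k: "k \<in> carrier K" "c = \<psi> k" and u: "u \<in> A.spn (Z \<union> P)" "x = \<pi> u" by blast
      have "\<phi> k \<otimes>\<^bsub>R\<^esub> u \<in> A.spn (Z \<union> P)" using k u by (intro A.subspaceD(5)[OF V]) auto
      then show "c \<otimes>\<^bsub>S\<^esub> x \<in> \<pi> ` A.spn (Z \<union> P)" using k u \<phi>c Vc by (auto simp: \<psi> intro!: image_eqI[of _ _ "\<phi> k \<otimes>\<^bsub>R\<^esub> u"])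
    qed
    then have "B.spn (\<pi> ` Z \<union> {\<zero>\<^bsub>S\<^esub>}) \<subseteq> \<pi> ` A.spn (Z \<union> P)"
      using A.spn_superset[of "Z \<union> P"] by (intro B.spn_min) (auto dest: B.subspaceD(3))
    then obtain b where b: "b \<in> A.spn (Z \<union> P)" "\<pi> a = \<pi> b" using a(2) by blast
    have "\<pi> (a \<ominus>\<^bsub>R\<^esub> b) = \<zero>\<^bsub>S\<^esub>" using b a(1) Vc[OF b(1)] by (simp add: R.minus_eq Q.R.r_neg)
    then have "a \<ominus>\<^bsub>R\<^esub> b \<in> P" using ker[of "a \<ominus>\<^bsub>R\<^esub> b"] a(1) Vc[OF b(1)] by simp
    then have "a \<ominus>\<^bsub>R\<^esub> b \<in> A.spn (Z \<union> P)" by (intro A.spn_base) simp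
    then show ?thesis using A.subspace_diff_cancel[OF V _ b(1) a(1)] by blast
  qed
  have pow: "\<pi> s [^]\<^bsub>S\<^esub> i = \<pi> (s [^]\<^bsub>R\<^esub> i)" if "s \<in> carrier R" for s and i :: nat
    using that by (induction i) auto
  show "A.algebraic_mod P s" if s: "s \<in> carrier R" and alg: "B.algebraic_mod {\<zero>\<^bsub>S\<^esub>} (\<pi> s)"
  proof -
    obtain n where n: "\<pi> s [^]\<^bsub>S\<^esub> n \<in> B.spn (B.powers (\<pi> s) n \<union> {\<zero>\<^bsub>S\<^esub>})" using alg by (auto simp: B.algebraic_mod_def)
    have "B.powers (\<pi> s) n = \<pi> ` A.powers s n" using pow[OF s] by auto
    then have "s [^]\<^bsub>R\<^esub> n \<in> A.spn (A.powers s n \<union> P)"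
      using n s pow[OF s] by (intro pull) auto
    then show ?thesis unfolding A.algebraic_mod_def by blast
  qed
  show "B.linear_growth (\<pi> ` Y) {\<zero>\<^bsub>S\<^esub>} C" if Y: "Y \<subseteq> carrier R" and lin: "A.linear_growth Y P C"
    unfolding B.linear_growth_def
  proof
    fix n
    obtain T where T: "finite T" "T \<subseteq> carrier R" "card T \<le> C * (n + 1)" "A.pss Y n \<subseteq> A.spn (T \<union> P)"
      using lin unfolding A.linear_growth_def by blast
    have TP: "T \<union> P \<subseteq> carrier R" using T(2) A.subspaceD(1)[OF sP] by auto
    have "\<pi> a = \<zero>\<^bsub>S\<^esub>" if "a \<in> P" for a using ker[of a] A.subspaceD(2)[OF sP] that by blast
    then have sub: "\<pi> ` (T \<union> P) \<subseteq> \<pi> ` T \<union> {\<zero>\<^bsub>S\<^esub>}" by blast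
    have V: "B.subspace (B.spn (\<pi> ` T \<union> {\<zero>\<^bsub>S\<^esub>}))" using T(2) by (intro B.subspace_spn) auto
    have "B.pss (\<pi> ` Y) n \<subseteq> B.spn (\<pi> ` T \<union> {\<zero>\<^bsub>S\<^esub>})"
      unfolding power_sum_space_def[of S]
    proof (intro B.spn_min V subsetI)
      fix y assume "y \<in> {list_prod S ws |ws. set ws \<subseteq> \<pi> ` Y \<and> length ws \<le> n}"
      then obtain ws where ws: "y = list_prod S ws" "ws \<in> lists (\<pi> ` Y)" "length ws \<le> n" by (auto simp: lists_eq_set)
      then obtain vs where vs: "vs \<in> lists Y" "ws = map \<pi> vs" unfolding lists_image by blast
      have "set vs \<subseteq> carrier R" using vs(1) Y by auto
      then have "list_prod S (map \<pi> vs) = \<pi> (list_prod R vs)"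
        by (induction vs) (auto simp: A.list_prod_closed list_prod_def[of S])
      moreover have "list_prod R vs \<in> A.pss Y n" using vs ws(3) by (intro A.list_prod_in_pss) auto
      ultimately have "y \<in> \<pi> ` A.spn (T \<union> P)" using T(4) ws(1) vs(2) by auto
      also have "\<dots> \<subseteq> B.spn (\<pi> ` (T \<union> P))" by (rule push[OF TP])
      also have "\<dots> \<subseteq> B.spn (\<pi> ` T \<union> {\<zero>\<^bsub>S\<^esub>})" by (rule B.spn_mono[OF sub])
      finally show "y \<in> B.spn (\<pi> ` T \<union> {\<zero>\<^bsub>S\<^esub>})" .
    qed
    moreover have "card (\<pi> ` T) \<le> C * (n + 1)" using card_image_le[OF T(1), of \<pi>] T(3) by simp
    ultimately show "\<exists>T. finite T \<and> T \<subseteq> carrier S \<and> card T \<le> C * (n + 1) \<and>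
        B.pss (\<pi> ` Y) n \<subseteq> B.spn (T \<union> {\<zero>\<^bsub>S\<^esub>})"
      using T(1,2) by (intro exI[of _ "\<pi> ` T"]) auto
  qed
qed

end

section \<open>Primitivity\<close>

context central_subfield
begin

section \<open>Existence of maximal left ideals\<close>

lemma left_ideal_Union_chain:
  assumes C: "C \<noteq> {}" "\<And>J. J \<in> C \<Longrightarrow> left_ideal R J" "\<And>J J'. J \<in> C \<Longrightarrow> J' \<in> C \<Longrightarrow> J \<subseteq> J' \<or> J' \<subseteq> J"
  shows "left_ideal R (\<Union>C)"
proof (rule left_idealI)
  note S = subspaceD[OF subspace_left_ideal[OF C(2)]]
  show "subspace (\<Union>C)"
  proof (rule subspaceI)
    fix a b assume "a \<in> \<Union>C" "b \<in> \<Union>C"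
    then obtain J J' where J: "J \<in> C" "J' \<in> C" "a \<in> J" "b \<in> J'" by blast
    then have "(a \<in> J \<and> b \<in> J) \<or> (a \<in> J' \<and> b \<in> J')" using C(3) by blast
    then show "a \<oplus> b \<in> \<Union>C" using S(4) J(1,2) by blast
  qed (use C(1) S(2,3,5) in blast)+
  fix r a assume "r \<in> carrier R" "a \<in> \<Union>C"
  then show "r \<otimes> a \<in> \<Union>C" using left_idealD[OF C(2)] by blast
qed

text \<open>Properness is expressed by the absence of \<one>, which survives unions of
  chains.\<close>

lemma exists_maximal_left_ideal:
  assumes J: "left_ideal R J" "J \<noteq> carrier R"
  obtains L where "maximal_left_ideal L" "J \<subseteq> L"
proof -
  let ?A = "{L. left_ideal R L \<and> J \<subseteq> L \<and> \<one> \<notin> L}"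
  have "\<exists>M\<in>?A. \<forall>Z\<in>?A. M \<subseteq> Z \<longrightarrow> Z = M"
  proof (rule subset_Zorn_nonempty)
    show "?A \<noteq> {}" using J left_ideal_carrier_iff by blast
    fix C assume C: "C \<noteq> {}" "subset.chain ?A C"
    then have "\<And>Z. Z \<in> C \<Longrightarrow> Z \<in> ?A" "\<And>Z Z'. Z \<in> C \<Longrightarrow> Z' \<in> C \<Longrightarrow> Z \<subseteq> Z' \<or> Z' \<subseteq> Z"
      by (auto simp: subset_chain_def)
    then have "left_ideal R (\<Union>C)" "J \<subseteq> \<Union>C" "\<one> \<notin> \<Union>C"
      using C(1) left_ideal_Union_chain[of C] by blast+
    then show "\<Union>C \<in> ?A" by blast
  qed
  then obtain L where L: "L \<in> ?A" "\<forall>Z\<in>?A. L \<subseteq> Z \<longrightarrow> Z = L" by (elim bexE)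
  have "maximal_left_ideal L"
    unfolding maximal_left_ideal_def
  proof (intro conjI allI impI)
    show "L \<noteq> carrier R" using L(1) by auto
    fix Z assume Z: "left_ideal R Z" "L \<subseteq> Z"
    show "Z = L \<or> Z = carrier R"
      using L Z left_ideal_carrier_iff[OF Z(1)] by blast
  qed (use L(1) in auto)
  then show thesis using that L(1) by blast
qed

section \<open>Primes modulo which an element stays transcendental\<close>

lemma algebraic_mod_mult:
  assumes P: "ideal P R" and I: "ideal I R" and J: "ideal J R" and s: "s \<in> carrier R"
    and prod: "\<And>a b. a \<in> I \<Longrightarrow> b \<in> J \<Longrightarrow> a \<otimes> b \<in> P"
    and alg: "algebraic_mod I s" "algebraic_mod J s"
  shows "algebraic_mod P s"
proof -
  note Pc = subspaceD(1)[OF subspace_ideal[OF P]]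
  have pw: "powers s k \<subseteq> carrier R" for k using s by auto
  have "\<exists>n u a. u \<in> spn (powers s n) \<and> a \<in> I \<and> s [^] (n::nat) = u \<oplus> a" if "ideal I R" "algebraic_mod I s" for I
    using that spn_Un_cong[OF pw subspaceD(1)[OF subspace_ideal[OF that(1)]]] spn_subspace[OF subspace_ideal[OF that(1)]]
    unfolding algebraic_mod_def by auto
  from this[OF I alg(1)] this[OF J alg(2)] obtain n u a m v b
    where u: "u \<in> spn (powers s n)" "a \<in> I" "s [^] (n::nat) = u \<oplus> a"
      and v: "v \<in> spn (powers s m)" "b \<in> J" "s [^] (m::nat) = v \<oplus> b" by blast
  have cl: "u \<in> carrier R" "a \<in> carrier R" "v \<in> carrier R" "b \<in> carrier R"
    using u v spn_carrier[OF pw] subspaceD(1)[OF subspace_ideal[OF I]] subspaceD(1)[OF subspace_ideal[OF J]] by auto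
  let ?V = "spn (powers s (n + m) \<union> P)"
  have V: "subspace ?V" using pw Pc by (intro subspace_spn) auto
  have pV: "s [^] k \<in> ?V" if "k < n + m" for k using that by (intro spn_base) auto
  have 1: "s [^] i \<otimes> w \<in> ?V" if "w \<in> spn (powers s m)" "i \<le> n" for w i
  proof -
    have "spn (powers s m) \<subseteq> {w \<in> carrier R. s [^] i \<otimes> w \<in> ?V}"
      using s that(2) pV by (intro spn_min subspace_lvimage V) (auto simp: nat_pow_mult)
    then show ?thesis using that(1) by blast
  qed
  have 2: "w \<otimes> v \<in> ?V" if "w \<in> spn (powers s n)" for w
  proof -
    have "spn (powers s n) \<subseteq> {w \<in> carrier R. w \<otimes> v \<in> ?V}"
      using s 1[OF v(1)] cl by (intro spn_min subspace_rvimage V) auto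
    then show ?thesis using that by blast
  qed
  have 3: "w \<otimes> s [^] m \<in> ?V" if "w \<in> spn (powers s n)" for w
  proof -
    have "spn (powers s n) \<subseteq> {w \<in> carrier R. w \<otimes> s [^] m \<in> ?V}"
      using s pV by (intro spn_min subspace_rvimage V) (auto simp: nat_pow_mult)
    then show ?thesis using that by blast
  qed
  have ab: "a \<otimes> b \<in> ?V" using prod[OF u(2) v(2)] by (intro spn_base) auto
  \<comment> \<open>The product of the relations \<open>s [^] n = u \<oplus> a\<close> and
    \<open>s [^] m = v \<oplus> b\<close>. With \<open>a \<otimes> v\<close> written as
    \<open>s [^] n \<otimes> v \<ominus> u \<otimes> v\<close>, and \<open>u \<otimes> b\<close>
    absorbed in \<open>u \<otimes> s [^] m\<close>, only lower powers and
    \<open>a \<otimes> b \<in> P\<close> remain.\<close>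
  have "s [^] (n + m) = u \<otimes> s [^] m \<oplus> (s [^] n \<otimes> v \<ominus> u \<otimes> v \<oplus> a \<otimes> b)"
  proof -
    have "s [^] (n + m) = (u \<oplus> a) \<otimes> (v \<oplus> b)" using nat_pow_mult[OF s, of n m] u(3) v(3) by simp
    also have "\<dots> = u \<otimes> (v \<oplus> b) \<oplus> ((u \<oplus> a) \<otimes> v \<ominus> u \<otimes> v \<oplus> a \<otimes> b)"
      using cl by (simp add: l_distr r_distr minus_eq a_ac r_neg r_neg1 r_neg2)
    finally show ?thesis using u(3) v(3) by simp
  qed
  also have "\<dots> \<in> ?V"
    using 1[OF v(1)] 2[OF u(1)] 3[OF u(1)] ab by (intro subspaceD(4)[OF V] subspace_minus[OF V]) auto
  finally show ?thesis unfolding algebraic_mod_def by blast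
qed

text \<open>The monic polynomials in \<open>s\<close> are closed under multiplication, so an ideal maximal among those
  containing none of them is prime.\<close>

lemma exists_prime_not_algebraic:
  assumes I: "ideal I R" and s: "s \<in> carrier R" and na: "\<not> algebraic_mod I s"
  obtains P where "prime_two_sided R P" "I \<subseteq> P" "\<not> algebraic_mod P s"
proof -
  let ?A = "{P. ideal P R \<and> I \<subseteq> P \<and> \<not> algebraic_mod P s}"
  have "\<exists>M\<in>?A. \<forall>Z\<in>?A. M \<subseteq> Z \<longrightarrow> Z = M"
  proof (rule subset_Zorn_nonempty)
    show "?A \<noteq> {}" using I na by blast
    fix C assume C: "C \<noteq> {}" "subset.chain ?A C"
    then have CA: "\<And>Z. Z \<in> C \<Longrightarrow> Z \<in> ?A" and ch: "\<And>Z Z'. Z \<in> C \<Longrightarrow> Z' \<in> C \<Longrightarrow> Z \<subseteq> Z' \<or> Z' \<subseteq> Z"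
      by (auto simp: subset_chain_def)
    have CI: "ideal Z R" if "Z \<in> C" for Z using CA[OF that] by blast
    have U: "left_ideal R (\<Union>C)" using C(1) ch CI left_ideal_ideal by (intro left_ideal_Union_chain) auto
    have "ideal (\<Union>C) R"
    proof (rule idealI[OF ring_axioms])
      show "subgroup (\<Union>C) (add_monoid R)" using U by (simp add: left_ideal_def additive_subgroup_def)
      show "x \<otimes> a \<in> \<Union>C" if "a \<in> \<Union>C" "x \<in> carrier R" for a x using left_idealD[OF U that(2,1)] .
      show "a \<otimes> x \<in> \<Union>C" if "a \<in> \<Union>C" "x \<in> carrier R" for a x using that ideal.I_r_closed[OF CI] by blast
    qed
    \<comment> \<open>A relation modulo the union uses one element of it and so holds modulo a
      member of the chain.\<close>
    moreover have "\<not> algebraic_mod (\<Union>C) s"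
    proof
      assume "algebraic_mod (\<Union>C) s"
      then obtain n where n: "s [^] n \<in> spn (powers s n \<union> \<Union>C)" by (auto simp: algebraic_mod_def)
      have pw: "powers s n \<subseteq> carrier R" using s by auto
      have "s [^] n \<in> {u \<oplus> b | u b. u \<in> spn (powers s n) \<and> b \<in> \<Union>C}"
        using n spn_Un_cong[OF pw left_ideal_closed[OF U]] spn_subspace[OF subspace_left_ideal[OF U]] by simp
      then obtain u b Z where ub: "u \<in> spn (powers s n)" "b \<in> Z" "Z \<in> C" "s [^] n = u \<oplus> b" by blast
      have V: "subspace (spn (powers s n \<union> Z))"
        using pw left_ideal_closed[OF left_ideal_ideal[OF CI[OF ub(3)]]] by (intro subspace_spn) auto
      have "u \<in> spn (powers s n \<union> Z)" using ub(1) spn_mono[of "powers s n" "powers s n \<union> Z"] by blast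
      then have "s [^] n \<in> spn (powers s n \<union> Z)"
        unfolding ub(4) using ub(2) by (intro subspaceD(4)[OF V]) (auto intro: spn_base)
      then show False using CA[OF ub(3)] unfolding algebraic_mod_def by blast
    qed
    moreover have "I \<subseteq> \<Union>C" using C(1) CA by blast
    ultimately show "\<Union>C \<in> ?A" by blast
  qed
  then obtain P where P: "P \<in> ?A" "\<forall>Z\<in>?A. P \<subseteq> Z \<longrightarrow> Z = P" by (elim bexE)
  have iP: "ideal P R" using P(1) by blast
  interpret P: ideal P R by (rule iP)
  have big: "algebraic_mod (P <+>\<^bsub>R\<^esub> J) s" if J: "ideal J R" "\<not> J \<subseteq> P" for J
  proof (rule ccontr)
    assume n: "\<not> ?thesis"
    interpret J: ideal J R by (rule J(1))
    have "P \<subseteq> P <+>\<^bsub>R\<^esub> J" "J \<subseteq> P <+>\<^bsub>R\<^esub> J"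
    proof -
      have "p \<in> P <+>\<^bsub>R\<^esub> J" if "p \<in> P" for p
        unfolding set_add_def' using that J.zero_closed P.Icarr[OF that] by (intro UN_I[of p] UN_I[of \<zero>]) auto
      moreover have "p \<in> P <+>\<^bsub>R\<^esub> J" if "p \<in> J" for p
        unfolding set_add_def' using that P.zero_closed J.Icarr[OF that] by (intro UN_I[of \<zero>] UN_I[of p]) auto
      ultimately show "P \<subseteq> P <+>\<^bsub>R\<^esub> J" "J \<subseteq> P <+>\<^bsub>R\<^esub> J" by blast+
    qed
    moreover from this have "P <+>\<^bsub>R\<^esub> J \<in> ?A" using n add_ideals[OF iP J(1)] P(1) by blast
    ultimately show False using P(2) J(2) by blast
  qed
  have "prime_two_sided R P"
    unfolding prime_two_sided_def
  proof (intro conjI iP allI impI)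
    show "P \<noteq> carrier R"
    proof
      assume "P = carrier R"
      then have "s [^] (0::nat) \<in> spn (powers s 0 \<union> P)" by (intro spn_base) auto
      then show False using P(1) unfolding algebraic_mod_def by blast
    qed
    fix I1 I2 assume I12: "ideal I1 R" "ideal I2 R" "ideal_prod R I1 I2 \<subseteq> P"
    show "I1 \<subseteq> P \<or> I2 \<subseteq> P"
    proof (rule ccontr)
      assume "\<not> ?thesis"
      then have alg: "algebraic_mod (P <+>\<^bsub>R\<^esub> I1) s" "algebraic_mod (P <+>\<^bsub>R\<^esub> I2) s" using big I12 by auto
      have "algebraic_mod P s"
      \<comment> \<open>The relations modulo \<open>P + I1\<close> and \<open>P + I2\<close>
        multiply to one modulo \<open>P\<close>, because the product of these two ideals lies in
        \<open>P\<close>.\<close>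
      proof (rule algebraic_mod_mult[OF iP add_ideals[OF iP I12(1)] add_ideals[OF iP I12(2)] s _ alg])
        fix a b assume "a \<in> P <+>\<^bsub>R\<^esub> I1" "b \<in> P <+>\<^bsub>R\<^esub> I2"
        then obtain p i p' j where h: "p \<in> P" "i \<in> I1" "p' \<in> P" "j \<in> I2" "a = p \<oplus> i" "b = p' \<oplus> j"
          unfolding set_add_def' by blast
        have cl: "p \<in> carrier R" "i \<in> carrier R" "p' \<in> carrier R" "j \<in> carrier R"
          using h P.Icarr ideal.Icarr[OF I12(1)] ideal.Icarr[OF I12(2)] by auto
        have "i \<otimes> j \<in> P" using I12(3) ideal_prod.prod[OF h(2,4), of R] by blast
        then have "p \<otimes> (p' \<oplus> j) \<oplus> (i \<otimes> p' \<oplus> i \<otimes> j) \<in> P"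
          using h cl P.I_r_closed[OF h(1)] P.I_l_closed[OF h(3)] by (intro P.a_closed) auto
        moreover have "a \<otimes> b = p \<otimes> (p' \<oplus> j) \<oplus> (i \<otimes> p' \<oplus> i \<otimes> j)"
          unfolding h using cl by (simp add: l_distr r_distr a_ac)
        ultimately show "a \<otimes> b \<in> P" by simp
      qed
      then show False using P(1) by blast
    qed
  qed
  then show thesis using that P(1) by blast
qed

section \<open>Cores of left ideals and primitivity\<close>

lemma core_ideal:
  assumes L: "left_ideal R L"
  shows "ideal {r \<in> carrier R. \<forall>s\<in>carrier R. r \<otimes> s \<in> L} R"
proof (rule idealI[OF ring_axioms])
  note S = subspaceD[OF subspace_left_ideal[OF L]]
  let ?P = "{r \<in> carrier R. \<forall>s\<in>carrier R. r \<otimes> s \<in> L}"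
  have "subspace ?P"
    using S F_carrier by (intro subspaceI) (auto simp: l_distr m_assoc)
  then show "subgroup ?P (add_monoid R)" by (simp add: subspace_iff_subalgebra subalgebra_def)
  show "x \<otimes> a \<in> ?P" if "a \<in> ?P" "x \<in> carrier R" for a x
    using that left_idealD[OF L] by (auto simp: m_assoc)
  show "a \<otimes> x \<in> ?P" if "a \<in> ?P" "x \<in> carrier R" for a x
    using that by (auto simp: m_assoc)
qed

text \<open>The core is the annihilator of \<open>R/L\<close>. As \<open>L\<close> is a left ideal,
  \<open>r\<close> kills \<open>R/L\<close> once it kills the classes of a finite spanning set, so
  the core contains an intersection of finitely many colon spaces of finite codimension.\<close>

lemma core_fincod:
  assumes L: "left_ideal R L" "fincod L"
  shows "fincod {r \<in> carrier R. \<forall>s\<in>carrier R. r \<otimes> s \<in> L}"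
proof -
  note sL = subspace_left_ideal[OF L(1)] and Lc = left_ideal_closed[OF L(1)]
  obtain T where T: "finite T" "T \<subseteq> carrier R" "spn (T \<union> L) = carrier R"
    using L(2) by (auto simp: fincod_def)
  have "fincod {r \<in> carrier R. \<forall>t\<in>T. r \<otimes> t \<in> L} \<and> subspace {r \<in> carrier R. \<forall>t\<in>T. r \<otimes> t \<in> L}"
    using T(1,2)
  proof (induction T rule: finite_induct)
    case empty then show ?case using fincod_carrier subspace_carrier by simp
  next
    case (insert t T)
    have eq: "{r \<in> carrier R. \<forall>t\<in>insert t T. r \<otimes> t \<in> L} =
        {r \<in> carrier R. r \<otimes> t \<in> L} \<inter> {r \<in> carrier R. \<forall>t\<in>T. r \<otimes> t \<in> L}" by blast
    have t: "t \<in> carrier R" and IH: "fincod {r \<in> carrier R. \<forall>t\<in>T. r \<otimes> t \<in> L}"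
      "subspace {r \<in> carrier R. \<forall>t\<in>T. r \<otimes> t \<in> L}" using insert by auto
    have "subspace (A \<inter> B)" if "subspace A" "subspace B" for A B using that by (auto simp: subspace_def)
    then show ?case
      unfolding eq using fincod_Int[OF fincod_colon[OF L(2) sL t] IH(1) subspace_rvimage[OF sL t] IH(2)]
        subspace_rvimage[OF sL t] IH(2) by blast
  qed
  moreover have "{r \<in> carrier R. \<forall>t\<in>T. r \<otimes> t \<in> L} \<subseteq> {r \<in> carrier R. \<forall>s\<in>carrier R. r \<otimes> s \<in> L}"
  proof
    fix r assume r: "r \<in> {r \<in> carrier R. \<forall>t\<in>T. r \<otimes> t \<in> L}"
    then have rc: "r \<in> carrier R" by simp
    have "spn (T \<union> L) \<subseteq> {s \<in> carrier R. r \<otimes> s \<in> L}"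
      using r T(2) Lc left_idealD[OF L(1) rc] by (intro spn_min subspace_lvimage sL) auto
    then show "r \<in> {r \<in> carrier R. \<forall>s\<in>carrier R. r \<otimes> s \<in> L}" using T(3) rc by blast
  qed
  ultimately show ?thesis using fincod_mono by blast
qed

text \<open>\<open>R/L\<close> is simple by maximality, and it is faithful because its annihilator
  is the core of \<open>L\<close>.\<close>

lemma primitive_of_maximal_left_ideal:
  assumes L: "maximal_left_ideal L" and core: "{r \<in> carrier R. \<forall>s\<in>carrier R. r \<otimes> s \<in> L} = {\<zero>}"
  shows "primitive_ring R"
proof -
  have lL: "left_ideal R L" and Lne: "L \<noteq> carrier R" using L by (auto simp: maximal_left_ideal_def)
  note sL = subspace_left_ideal[OF lL]
  interpret LA: abelian_subgroup L R
    using lL by (intro abelian_subgroupI3 abelian_group_axioms) (simp add: left_ideal_def)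
  define q where "q a = L +> a" for a
  have q_eq: "q a = q b \<longleftrightarrow> a \<ominus> b \<in> L" if ab: "a \<in> carrier R" "b \<in> carrier R" for a b
  proof
    assume "q a = q b"
    then have "a \<in> L +> b" using LA.a_rcos_self[OF ab(1)] by (simp add: q_def)
    then show "a \<ominus> b \<in> L" using LA.a_rcos_module_imp[OF ab(2)] by (simp add: minus_eq)
  next
    assume "a \<ominus> b \<in> L"
    then have "a \<in> L +> b" using LA.a_rcos_module_rev[OF ab(2,1)] by (simp add: minus_eq)
    then show "q a = q b" unfolding q_def using a_repr_independence[OF _ ab(2) LA.a_subgroup] by simp
  qed
  have q_zero: "q \<zero> = L" unfolding q_def by (rule LA.a_rcos_const) (rule subspaceD(3)[OF sL])
  have q_L: "q a = L \<longleftrightarrow> a \<in> L" if "a \<in> carrier R" for a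
    using q_eq[OF that zero_closed] that unfolding q_zero by (simp add: minus_eq)
  have q_add: "q a <+>\<^bsub>R\<^esub> q b = q (a \<oplus> b)" if "a \<in> carrier R" "b \<in> carrier R" for a b
    unfolding q_def using that by (rule LA.a_rcos_sum)
  \<comment> \<open>Scalars act through a chosen representative of the coset; \<open>smult\<close>
    shows that the choice does not matter, since \<open>L\<close> is a left ideal.\<close>
  define M :: "('a, 'a set) module" where "M =
    \<lparr>carrier = q ` carrier R, monoid.mult = undefined, one = undefined, ring.zero = L,
     add = set_add R, smult = (\<lambda>r A. q (r \<otimes> (SOME a. a \<in> carrier R \<and> A = q a)))\<rparr>"
  have M: "carrier M = q ` carrier R" "\<zero>\<^bsub>M\<^esub> = L" "A \<oplus>\<^bsub>M\<^esub> B = A <+>\<^bsub>R\<^esub> B" for A B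
    by (simp_all add: M_def)
  have smult: "r \<odot>\<^bsub>M\<^esub> q a = q (r \<otimes> a)" if "r \<in> carrier R" "a \<in> carrier R" for r a
  proof -
    define b where "b = (SOME b. b \<in> carrier R \<and> q a = q b)"
    have b: "b \<in> carrier R" "q a = q b"
      using someI[of "\<lambda>b. b \<in> carrier R \<and> q a = q b" a] that(2) unfolding b_def by auto
    have "r \<otimes> (b \<ominus> a) \<in> L" using b that q_eq[of b a] left_idealD[OF lL that(1)] by auto
    then have "q (r \<otimes> b) = q (r \<otimes> a)"
      using q_eq[of "r \<otimes> b" "r \<otimes> a"] that b by (simp add: minus_eq r_distr r_minus)
    then show ?thesis by (simp add: M_def b_def)
  qed
  have ag: "abelian_group M"
  proof (rule abelian_groupI)
    fix A assume "A \<in> carrier M"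
    then obtain a where a: "a \<in> carrier R" "A = q a" by (auto simp: M)
    show "\<exists>B\<in>carrier M. B \<oplus>\<^bsub>M\<^esub> A = \<zero>\<^bsub>M\<^esub>"
      by (rule bexI[of _ "q (\<ominus> a)"]) (use a q_add q_zero in \<open>auto simp: M l_neg\<close>)
  qed (auto simp: M q_add a_ac q_zero[symmetric])
  have lm: "left_module R M"
    by (intro left_module.intro left_module_axioms.intro ring_axioms ag)
      (auto simp: M(1,3) smult q_add l_distr r_distr m_assoc)
  have "simple_left_module R M"
    unfolding simple_left_module_def
  proof (intro conjI lm allI impI)
    show "carrier M \<noteq> {\<zero>\<^bsub>M\<^esub>}"
    proof
      assume "carrier M = {\<zero>\<^bsub>M\<^esub>}"
      then have "q \<one> = L" unfolding M by (metis imageI one_closed singletonD)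
      then show False using q_L[OF one_closed] left_ideal_carrier_iff[OF lL] Lne by simp
    qed
    fix N assume "submodule N R M"
    then interpret N: submodule N R M .
    show "N = {\<zero>\<^bsub>M\<^esub>} \<or> N = carrier M"
    proof (cases "\<exists>a\<in>carrier R. q a \<in> N \<and> a \<notin> L")
      case True
      then obtain a where a: "a \<in> carrier R" "q a \<in> N" "a \<notin> L" by blast
      have "q r \<in> N" if r: "r \<in> carrier R" for r
      proof -
        obtain y where y: "y \<in> carrier R" "r \<ominus> y \<otimes> a \<in> L"
          by (rule maximal_left_ideal_inverse[OF L a(1,3) r])
        then have "q r = y \<odot>\<^bsub>M\<^esub> q a" using q_eq[of r "y \<otimes> a"] smult a(1) r by simp
        then show ?thesis using N.smult_closed[OF y(1) a(2)] by simp
      qed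
      then show ?thesis using N.subset by (auto simp: M)
    next
      case False
      then have "N \<subseteq> {\<zero>\<^bsub>M\<^esub>}" using N.subset q_L by (auto simp: M)
      moreover have "\<zero>\<^bsub>M\<^esub> \<in> N" using N.one_closed by simp
      ultimately show ?thesis by blast
    qed
  qed
  moreover have "faithful_module R M"
    unfolding faithful_module_def
  proof (intro ballI impI)
    fix r assume r: "r \<in> carrier R" and ann: "\<forall>x\<in>carrier M. r \<odot>\<^bsub>M\<^esub> x = \<zero>\<^bsub>M\<^esub>"
    have "r \<otimes> s \<in> L" if s: "s \<in> carrier R" for s
    proof -
      have "q (r \<otimes> s) = L" using ann s smult[OF r s] by (auto simp: M)
      then show ?thesis using q_L[of "r \<otimes> s"] r s by simp
    qed
    then have "r \<in> {\<zero>}" using core r by blast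
    then show "r = \<zero>" by simp
  qed
  ultimately show ?thesis by (rule primitive_ringI)
qed

end

section \<open>Choice of the scalar and the contradiction\<close>

theorem theorem2p9:
  fixes K :: "('k, 'm) ring_scheme" and R :: "('a, 'n) ring_scheme"
    and \<phi> :: "'k \<Rightarrow> 'a" and x :: 'a
  assumes "field_algebra K R \<phi>"
    and "uncountable (carrier K)"
    and "affine_algebra K R \<phi>"
    and "prime_ring R"
    and "Goldie R"
    and "\<not> simple_ring R"
    and "\<not> PI_algebra K R \<phi>"
    and "GKdim K R \<phi> < 3"
    and "x \<in> carrier R"
    and "\<not> algebraic_over K R \<phi> x"
    and "\<And>P. prime_two_sided R P \<Longrightarrow> GKdim K (R Quot P) (quot_structure R \<phi> P) = 1 \<Longrightarrow>
      algebraic_over K (R Quot P) (quot_structure R \<phi> P) (P +>\<^bsub>R\<^esub> x)"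
    and "\<And>P. prime_two_sided R P \<Longrightarrow> GKdim K (R Quot P) (quot_structure R \<phi> P) = 1 \<Longrightarrow>
      poly_star K (ring_center (R Quot P)) (quot_structure R \<phi> P)"
  shows "primitive_ring R"
proof (rule ccontr)
  \<comment> \<open>This enters at one place only, to make the core of a maximal left ideal
    nonzero.\<close>
  assume not_primitive: "\<not> primitive_ring R"
  interpret field_algebra K R \<phi> by fact
  have one: "\<one>\<^bsub>R\<^esub> \<noteq> \<zero>\<^bsub>R\<^esub>"
    using assms(4) R.one_zeroD unfolding prime_ring_def prime_two_sided_def by metis
  interpret A: central_subfield R "\<phi> ` carrier K" by (rule central_subfield[OF one])
  interpret h: ring_hom_ring K R \<phi>
    by (intro ring_hom_ringI2 K.ring_axioms R.ring_axioms structure_hom)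
  let ?F = "\<phi> ` carrier K"
  note x = \<open>x \<in> carrier R\<close>
  have leftG: "left_Goldie R" using assms(5) by (simp add: Goldie_def)
  \<comment> \<open>Uncountability has to pass from \<open>K\<close> to its image, over which all
    spans are taken.\<close>
  have "inj_on \<phi> (carrier K)"
  proof (rule inj_onI)
    fix a b assume ab: "a \<in> carrier K" "b \<in> carrier K" "\<phi> a = \<phi> b"
    show "a = b"
    proof (rule ccontr)
      assume "a \<noteq> b"
      then have u: "a \<ominus>\<^bsub>K\<^esub> b \<in> Units K" using ab K.field_Units by simp
      have "\<phi> (inv\<^bsub>K\<^esub> (a \<ominus>\<^bsub>K\<^esub> b) \<otimes>\<^bsub>K\<^esub> (a \<ominus>\<^bsub>K\<^esub> b)) = \<one>\<^bsub>R\<^esub>" using u by simp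
      moreover have "\<phi> (a \<ominus>\<^bsub>K\<^esub> b) = \<zero>\<^bsub>R\<^esub>" using ab by (simp add: K.minus_eq R.r_neg)
      ultimately show False using one u h.hom_mult[of "inv\<^bsub>K\<^esub> (a \<ominus>\<^bsub>K\<^esub> b)" "a \<ominus>\<^bsub>K\<^esub> b"] K.Units_closed K.Units_inv_closed by auto
    qed
  qed
  then have unc: "uncountable ?F" using assms(2) countable_image_inj_on by blast
  have na: "\<not> A.algebraic_mod {\<zero>\<^bsub>R\<^esub>} x" using algebraic_mod_imp_algebraic_over[OF one x] assms(10) by blast
  note regular = R.ideal_contains_left_regular[OF assms(4) leftG]
  note subcubic = GKdim_less_3_subcubic[OF one assms(8)]
  have alg: "A.algebraic_mod I x" if I: "ideal I R" "I \<noteq> {\<zero>\<^bsub>R\<^esub>}" for I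
  proof (rule ccontr)
    assume "\<not> A.algebraic_mod I x"
    then obtain P where P: "prime_two_sided R P" "I \<subseteq> P" "\<not> A.algebraic_mod P x"
      by (rule A.exists_prime_not_algebraic[OF I(1) x])
    have iP: "ideal P R" and Pne: "P \<noteq> carrier R" using P(1) by (auto simp: prime_two_sided_def)
    have "\<zero>\<^bsub>R\<^esub> \<in> I" using A.subspaceD(3)[OF A.subspace_ideal[OF I(1)]] .
    then have "P \<noteq> {\<zero>\<^bsub>R\<^esub>}" using I(2) P(2) by blast
    then obtain c where c: "c \<in> P" "\<And>r. r \<in> carrier R \<Longrightarrow> r \<otimes>\<^bsub>R\<^esub> c = \<zero>\<^bsub>R\<^esub> \<Longrightarrow> r = \<zero>\<^bsub>R\<^esub>"
      using regular[OF iP] by blast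
    have cc: "c \<in> carrier R" using c(1) ideal.Icarr[OF iP] by blast
    let ?S = "R Quot P" and ?\<psi> = "quot_structure R \<phi> P"
    interpret Q: field_algebra K ?S ?\<psi> by (rule field_algebra_Quot[OF iP])
    note tr = quot_transfer[OF one iP Pne]
    have "GKdim K ?S ?\<psi> \<le> 1"
    proof (rule Q.GKdim_le_1[OF tr(1)])
      fix Z assume Z: "finite Z" "Z \<subseteq> carrier ?S"
      have "carrier ?S = (\<lambda>a. P +>\<^bsub>R\<^esub> a) ` carrier R" by (auto simp: FactRing_simps)
      then obtain Y where Y: "Y \<subseteq> carrier R" "finite Y" "Z = (\<lambda>a. P +>\<^bsub>R\<^esub> a) ` Y"
        using finite_subset_image[OF Z(1)] Z(2) by metis
      \<comment> \<open>\<open>c\<close> is adjoined because the count multiplies words in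
        \<open>Y\<close> by powers of \<open>c\<close>.\<close>
      have "A.subcubic (insert c Y)" by (rule subcubic) (use Y cc in auto)
      then obtain C where "A.linear_growth Y P C"
        using A.linear_growth_modulo[OF Y(2,1) iP c] by blast
      then show "\<exists>C. central_subfield.linear_growth ?S (?\<psi> ` carrier K) Z {\<zero>\<^bsub>?S\<^esub>} C"
        using tr(3)[OF Y(1)] Y(3) by blast
    qed
    moreover have "1 \<le> GKdim K ?S ?\<psi>"
    proof (rule Q.GKdim_ge_1[OF tr(1)])
      show "P +>\<^bsub>R\<^esub> x \<in> carrier ?S" using x by (auto simp: FactRing_simps)
      show "\<not> central_subfield.algebraic_mod ?S (?\<psi> ` carrier K) {\<zero>\<^bsub>?S\<^esub>} (P +>\<^bsub>R\<^esub> x)"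
        using tr(2)[OF x] P(3) by blast
    qed
    ultimately have "algebraic_over K ?S ?\<psi> (P +>\<^bsub>R\<^esub> x)" using assms(11)[OF P(1)] by simp
    then have "central_subfield.algebraic_mod ?S (?\<psi> ` carrier K) {\<zero>\<^bsub>?S\<^esub>} (P +>\<^bsub>R\<^esub> x)"
      using x by (intro Q.algebraic_over_imp_algebraic_mod[OF tr(1)]) (auto simp: FactRing_simps)
    then show False using tr(2)[OF x] P(3) by blast
  qed
  obtain Y where gen: "A.generates Y" by (rule affine_generates[OF one assms(3)])
  then have Y: "finite Y" "Y \<subseteq> carrier R" by (auto simp: A.generates_def)
  obtain g :: "nat \<Rightarrow> 'a" where "bij_betw g {..<card Y} Y"
    using ex_bij_betw_nat_finite[OF Y(1)] by (auto simp: atLeast0LessThan)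
  then have g: "g ` {..<card Y} = Y" by (simp add: bij_betw_def)
  \<comment> \<open>The intersection of all ideals of codimension less than \<open>N\<close>, in the
    form that \<open>bounded_codimension_PI\<close> expects.\<close>
  define D where "D N = {r \<in> carrier R. \<forall>P T. ideal P R \<longrightarrow> finite T \<longrightarrow> T \<subseteq> carrier R \<longrightarrow> card T < N \<longrightarrow>
    A.spn (T \<union> P) = carrier R \<longrightarrow> r \<in> P}" for N
  have D_ideal: "ideal (D N) R" for N
  proof (rule idealI[OF R.ring_axioms])
    show "subgroup (D N) (add_monoid R)"
    proof (rule R.add.subgroupI)
      have "\<zero>\<^bsub>R\<^esub> \<in> D N" using A.subspaceD(3)[OF A.subspace_ideal] by (simp add: D_def)
      then show "D N \<noteq> {}" by blast
    qed (auto simp: D_def intro: A.subspace_uminus[OF A.subspace_ideal] A.subspaceD(4)[OF A.subspace_ideal])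
  qed (auto simp: D_def intro: ideal.I_l_closed ideal.I_r_closed)
  have D_alg: "A.algebraic_mod (D N) x" for N
  proof (rule alg[OF D_ideal])
    show "D N \<noteq> {\<zero>\<^bsub>R\<^esub>}"
    proof
      assume D0: "D N = {\<zero>\<^bsub>R\<^esub>}"
      have "PI_algebra K R \<phi>"
      proof (rule bounded_codimension_PI[OF one, of N])
        fix r assume "r \<in> carrier R" "\<And>P T. ideal P R \<Longrightarrow> finite T \<Longrightarrow> T \<subseteq> carrier R \<Longrightarrow> card T < N \<Longrightarrow>
          A.spn (T \<union> P) = carrier R \<Longrightarrow> r \<in> P"
        then have "r \<in> D N" by (simp add: D_def)
        then show "r = \<zero>\<^bsub>R\<^esub>" using D0 by simp
      qed
      then show False using assms(7) by simp
    qed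
  qed
  let ?J = "\<lambda>I c. {r \<otimes>\<^bsub>R\<^esub> (x \<ominus>\<^bsub>R\<^esub> c) \<oplus>\<^bsub>R\<^esub> j | r j. r \<in> carrier R \<and> j \<in> I}"
  \<comment> \<open>Left invertibility of \<open>x \<ominus> c\<close> in \<open>R\<close>, phrased
    modulo the zero ideal so that Amitsur's count applies.\<close>
  define B0 where "B0 = {c \<in> ?F. \<exists>y\<in>carrier R. y \<otimes>\<^bsub>R\<^esub> (x \<ominus>\<^bsub>R\<^esub> c) \<ominus>\<^bsub>R\<^esub> \<one>\<^bsub>R\<^esub> \<in> {\<zero>\<^bsub>R\<^esub>}}"
  have "countable B0"
  proof (rule ccontr)
    assume "uncountable B0"
    then have "A.algebraic_mod {\<zero>\<^bsub>R\<^esub>} x"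
      by (rule A.uncountable_inverses_algebraic[OF gen R.zeroideal x]) (auto simp: B0_def)
    then show False using na by blast
  qed
  moreover have "countable (\<Union>N. {c \<in> ?F. ?J (D N) c \<noteq> carrier R})"
    using A.finite_spectrum[OF A.left_ideal_ideal[OF D_ideal] x D_alg] by (intro countable_UN) (auto intro: countable_finite)
  ultimately have "uncountable (?F - (B0 \<union> (\<Union>N. {c \<in> ?F. ?J (D N) c \<noteq> carrier R})))"
    using unc by (intro uncountable_minus_countable countable_Un)
  then have "?F - (B0 \<union> (\<Union>N. {c \<in> ?F. ?J (D N) c \<noteq> carrier R})) \<noteq> {}"
    using countable_empty by metis
  then obtain c where c': "c \<in> ?F - (B0 \<union> (\<Union>N. {c \<in> ?F. ?J (D N) c \<noteq> carrier R}))" by (auto simp only: ex_in_conv[symmetric])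
  then have c: "c \<in> ?F" "c \<notin> B0" "\<And>N. ?J (D N) c = carrier R" by blast+
  have xc: "x \<ominus>\<^bsub>R\<^esub> c \<in> carrier R" using x A.F_carrier[OF c(1)] by simp
  note zero = A.left_ideal_ideal[OF R.zeroideal]
  note J0 = A.left_ideal_sum[OF zero xc] and J0_mem = A.left_ideal_sum_superset(2)[OF zero xc]
  have "?J {\<zero>\<^bsub>R\<^esub>} c \<noteq> carrier R"
  proof
    assume "?J {\<zero>\<^bsub>R\<^esub>} c = carrier R"
    then have "\<one>\<^bsub>R\<^esub> \<in> ?J {\<zero>\<^bsub>R\<^esub>} c" by simp
    then obtain y where y: "y \<in> carrier R" "\<one>\<^bsub>R\<^esub> = y \<otimes>\<^bsub>R\<^esub> (x \<ominus>\<^bsub>R\<^esub> c) \<oplus>\<^bsub>R\<^esub> \<zero>\<^bsub>R\<^esub>" by blast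
    have "y \<otimes>\<^bsub>R\<^esub> (x \<ominus>\<^bsub>R\<^esub> c) \<in> carrier R" using y(1) xc by (rule R.m_closed)
    then have "y \<otimes>\<^bsub>R\<^esub> (x \<ominus>\<^bsub>R\<^esub> c) \<ominus>\<^bsub>R\<^esub> \<one>\<^bsub>R\<^esub> = \<zero>\<^bsub>R\<^esub>" using y(2) by (metis R.r_zero R.r_right_minus_eq)
    then show False using c(1,2) y(1) by (auto simp: B0_def)
  qed
  then obtain L where L: "A.maximal_left_ideal L" "?J {\<zero>\<^bsub>R\<^esub>} c \<subseteq> L"
    by (rule A.exists_maximal_left_ideal[OF J0])
  have lL: "left_ideal R L" and Lne: "L \<noteq> carrier R" using L(1) by (auto simp: A.maximal_left_ideal_def)
  have xcL: "x \<ominus>\<^bsub>R\<^esub> c \<in> L" using L(2) J0_mem by blast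
  define P where "P = {r \<in> carrier R. \<forall>s\<in>carrier R. r \<otimes>\<^bsub>R\<^esub> s \<in> L}"
  have iP: "ideal P R" unfolding P_def by (rule A.core_ideal[OF lL])
  have "P \<noteq> {\<zero>\<^bsub>R\<^esub>}"
    using A.primitive_of_maximal_left_ideal[OF L(1)] not_primitive unfolding P_def by blast
  then obtain e where e: "e \<in> P" "\<And>r. r \<in> carrier R \<Longrightarrow> r \<otimes>\<^bsub>R\<^esub> e = \<zero>\<^bsub>R\<^esub> \<Longrightarrow> r = \<zero>\<^bsub>R\<^esub>"
    using regular[OF iP] by blast
  have "A.subcubic (insert e (g ` {..<card Y}))"
    by (rule subcubic) (use Y g e(1) in \<open>auto simp: P_def\<close>)
  then obtain d where d: "card {w. A.normal g (card Y) P w \<and> length w = d} \<le> d"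
    using A.few_normal_words[OF _ iP e, of g "card Y"] g Y(2) by blast
  have "A.fincod L"
    by (rule A.maximal_left_ideal_fincod[of g "card Y" P d L]) (use gen g unc iP d L(1) P_def in auto)
  then have "A.fincod P" unfolding P_def by (rule A.core_fincod[OF lL])
  then obtain T where T: "finite T" "T \<subseteq> carrier R" "A.spn (T \<union> P) = carrier R" by (auto simp: A.fincod_def)
  have PL: "P \<subseteq> L"
  proof
    fix r assume "r \<in> P"
    then have r: "r \<in> carrier R" "\<forall>s\<in>carrier R. r \<otimes>\<^bsub>R\<^esub> s \<in> L" unfolding P_def by blast+
    then show "r \<in> L" using bspec[OF r(2) R.one_closed] by simp
  qed
  \<comment> \<open>\<open>D N\<close> asks for fewer than \<open>N\<close> spanning elements, hence
    the \<open>+ 1\<close>. The choice of \<open>c\<close> makes \<open>R(x - c)\<close> and this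
    \<open>D\<close> add up to \<open>R\<close>, yet now both lie in \<open>L\<close>.\<close>
  have "D (card T + 1) \<subseteq> P" using T iP by (auto simp: D_def)
  then have "?J (D (card T + 1)) c \<subseteq> L"
    using PL A.left_idealD[OF lL _ xcL] A.subspaceD(4)[OF A.subspace_left_ideal[OF lL]] by blast
  then show False using c(3) A.left_ideal_closed[OF lL] Lne by blast
qed

end
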